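(* Let $\alpha\in\mathbb{R}$ and $\kappa>1$ be such that \[\left|\alpha-\frac{a}{q}\right|\ge\frac{1}{\kappa q^{9/4}}\] for all integers $a$ and all positive integers $q$. For a positive integer $N$ and real $X$ let \[R_{\alpha}(N,X):=N^{-1}\#\{(m,n)\in\mathbb{N}^2:\ m<n\le N,\ \|\alpha(m^2-n^2)\|\le XN^{-1}\}.\] Then \[R_{\alpha}(N,X)=X+O(X^{7/8})+O(\kappa^2(\log N)^{-1})\] for all $N$ and $X$ with $1\le X\le\log N$, where the implied constants are absolute (uniform in $\alpha,\kappa,N,X$).
   Context: $\|t\|$ denotes the distance from the real number $t$ to the nearest integer. $\mathbb{N}=\{1,2,3,\dots\}$. *)

theory Defs
  imports "HOL-Analysis.Analysis"
begin

definition dist_nearest_int :: "real \<Rightarrow> real" where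
  "dist_nearest_int t = \<bar>t - of_int (round t)\<bar>"

lemma dist_nearest_int_le: "dist_nearest_int t \<le> \<bar>t - of_int k\<bar>"
  unfolding dist_nearest_int_def by (rule round_diff_minimal)

(* The squares are subtracted as reals, since subtraction on nat would truncate m^2 - n^2 to 0. *)
definition pair_corr :: "real \<Rightarrow> nat \<Rightarrow> real \<Rightarrow> real" where
  "pair_corr \<alpha> N X =
     real (card {(m::nat, n::nat). 1 \<le> m \<and> m < n \<and> n \<le> N \<and>
              dist_nearest_int (\<alpha> * ((real m)\<^sup>2 - (real n)\<^sup>2)) \<le> X / real N}) / real N"

end

(*
With u = n - m and w = m, the pair correlation counts, for each u, the w <= N - u such that
alpha (2uw + u^2) is within X/N of an integer.  Put Y = sqrt X.  If no q <= N/(2^i Y) satisfies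
||2 alpha u q|| <= Y/(2^i N), then Dirichlet's theorem and a count over residue classes give the
expected main term with error O(2^i Y).  It remains to bound the number of u violating this
condition at level i, summed over i with weight 2^i.

After dividing out common factors, one has to count pairs (u, q) with u <= N/g, q <= N/(2^i Y) and
|2 alpha uq - b| <= Y/(g 2^i N) for some b coprime to uq, and to save a power of r = g 2^i greater
than 1 over N.  Coprimality makes the number of admissible u for a given q (or of q for a given u)
at most 1 + O(length * tolerance).  This alone falls short of the required saving.  The remedy is to
move a prime p > r^2 from q to u or from u to q: the product uq is unchanged, and the resulting pairs
are few by the same bound.  Pairs with no prime to move are rare when log N is large compared
with r^(3/4) (by a sieve bound), and have a smooth product otherwise (handled by a divisor sum).
The Diophantine condition on alpha limits the size of r.
*)
theory Submission
  imports Defs "HOL-Number_Theory.Number_Theory" "HOL-Real_Asymp.Real_Asymp"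
begin

section \<open>Chebyshev and Mertens upper bounds\<close>


text \<open>Let r = g * 2^i. Summing over g and, with weight 2^i, over i requires a bound N * r^(-c)
  with c > 1; the exponent reached is 9/8. Fixing one coordinate and counting the other gives min(U,
  V) + O(\<delta> U V), that is N * r^(-1/2) + O(N * r^(-2)), since U \<le> N/g, V \<le> N/2^i and
  \<delta> = Y/(r N). Only the first term, one possible solution per value of the fixed coordinate,
  is too large. A moved prime p \<ge> r^2 shrinks the range of the coordinate that loses it to
  N/r^2, which repairs this term, while the second grows only by the logarithm of the largest prime
  moved. With that logarithm equal to r^(3/4), N * r^(-5/4) is left there, and pairs with no prime
  to move are rarer by about r^(-3/4), on top of r^(-1/2). When r^(3/4) exceeds log N, every prime
  from r^2 up to N is moved, and the exponent 9/4 in the hypothesis on \<alpha> absorbs the N^(1/5)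
  lost to smooth products. The choice Y = sqrt X balances the two errors N/q and q X/N of a count
  over residue classes mod q.\<close>

definition psi :: "nat \<Rightarrow> real" where
  "psi n = (\<Sum>d = 1..n. mangoldt d)"

lemma psi_mono: "m \<le> n \<Longrightarrow> psi m \<le> psi n"
  unfolding psi_def by (rule sum_mono2) (auto simp: mangoldt_nonneg)

lemma sum_over_multiples:
  fixes f g :: "nat \<Rightarrow> real"
  shows "(\<Sum>n = 1..N. \<Sum>d | d dvd n. f d * g (n div d)) = (\<Sum>d = 1..N. f d * (\<Sum>m = 1..N div d. g m))"
proof -
  have "(\<Sum>n = 1..N. \<Sum>d | d dvd n. f d * g (n div d))
      = (\<Sum>(n, d) \<in> (SIGMA n:{1..N}. {d. d dvd n}). f d * g (n div d))"
    by (subst sum.Sigma) auto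
  also have "\<dots> = (\<Sum>(d, m) \<in> (SIGMA d:{1..N}. {1..N div d}). f d * g m)"
  proof (rule sum.reindex_bij_witness[where i = "\<lambda>(d, m). (d * m, d)" and j = "\<lambda>(n, d). (d, n div d)"])
    fix a assume "a \<in> (SIGMA n:{1..N}. {d. d dvd n})"
    then obtain n d where a: "a = (n, d)" "1 \<le> n" "n \<le> N" "d dvd n" by auto
    then obtain e where e: "n = d * e" by auto
    have "d > 0" "e > 0" using a e by (auto intro: Nat.gr0I)
    moreover have "e \<le> N div d" using a e \<open>d > 0\<close>
      by (metis div_le_mono nonzero_mult_div_cancel_left less_not_refl)
    moreover have "d \<le> N" using a by (meson dvd_imp_le le_trans less_le_trans zero_less_one)
    ultimately show "(case a of (n, d) \<Rightarrow> (d, n div d)) \<in> (SIGMA d:{1..N}. {1..N div d})"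
      using a e by auto
  next
    fix b assume "b \<in> (SIGMA d:{1..N}. {1..N div d})"
    then obtain d m where b: "b = (d, m)" "1 \<le> d" "d \<le> N" "1 \<le> m" "m \<le> N div d" by auto
    have "d * m \<le> N" using b by (metis div_times_less_eq_dividend dual_order.trans mult.commute mult_le_mono2)
    then show "(case b of (d, m) \<Rightarrow> (d * m, d)) \<in> (SIGMA n:{1..N}. {d. d dvd n})"
      using b by auto
  qed auto
  also have "\<dots> = (\<Sum>d = 1..N. \<Sum>m = 1..N div d. f d * g m)"
    by (subst sum.Sigma) auto
  finally show ?thesis by (simp add: sum_distrib_left)
qed

lemma ln_fact_mangoldt: "ln (fact n) = (\<Sum>d = 1..n. mangoldt d * real (n div d))"
proof -
  have "ln (fact n :: real) = (\<Sum>k = 1..n. ln (real k))"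
    by (induction n) (auto simp: ln_mult sum.atLeast_Suc_atMost add.commute)
  also have "\<dots> = (\<Sum>k = 1..n. \<Sum>d | d dvd k. mangoldt d * 1)"
    by (intro sum.cong refl) (subst mult_1_right, subst mangoldt_sum, auto)
  also have "\<dots> = (\<Sum>d = 1..n. mangoldt d * (\<Sum>m = 1..n div d. 1))"
    by (rule sum_over_multiples[where g = "\<lambda>_. 1"])
  finally show ?thesis by simp
qed

text \<open>Compare log (2n)! - 2 log n! through Legendre's identity: the coefficient floor(2n/d) -
  2 floor(n/d) of \<Lambda>(d) is never negative and is at least 1 for n < d \<le> 2n, while the
  central binomial coefficient is at most 4^n.\<close>

lemma psi_double: "psi (2 * n) \<le> psi n + 2 * real n * ln 2"
proof -
  have fact_sq: "(fact (2 * n) :: real) = real ((2 * n) choose n) * (fact n * fact n)"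
    using binomial_fact[of n "2 * n", where ?'a = real] by (simp add: mult_2 field_simps)
  have "real ((2 * n) choose n) \<le> 2 ^ (2 * n)"
    using binomial_le_pow2[of "2 * n" n] by (metis of_nat_le_iff of_nat_numeral of_nat_power)
  then have "ln (real ((2 * n) choose n)) \<le> ln (2 ^ (2 * n))"
    by (subst ln_le_cancel_iff) (auto simp: zero_less_binomial_iff)
  then have up: "ln (fact (2 * n) :: real) - 2 * ln (fact n) \<le> 2 * real n * ln 2"
    unfolding fact_sq by (subst ln_mult) (auto simp: ln_mult ln_realpow)
  have ext: "ln (fact n :: real) = (\<Sum>d = 1..2 * n. mangoldt d * real (n div d))"
    unfolding ln_fact_mangoldt by (rule sum.mono_neutral_left) auto
  have "(\<Sum>d = Suc n..2 * n. mangoldt d) \<le> (\<Sum>d = Suc n..2 * n. mangoldt d * (real (2 * n div d) - 2 * real (n div d)))"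
  proof (rule sum_mono)
    fix d assume d: "d \<in> {Suc n..2 * n}"
    then have "n div d = 0" "2 * n div d \<ge> 1" by (auto simp: Suc_le_eq div_greater_zero_iff)
    then have "1 \<le> real (2 * n div d) - 2 * real (n div d)" by simp
    from mult_left_mono[OF this mangoldt_nonneg[of d]]
    show "mangoldt d \<le> mangoldt d * (real (2 * n div d) - 2 * real (n div d))" by simp
  qed
  also have "\<dots> \<le> (\<Sum>d = 1..2 * n. mangoldt d * (real (2 * n div d) - 2 * real (n div d)))"
  proof (rule sum_mono2)
    fix d
    have "2 * (n div d) \<le> 2 * n div d" by (cases "d = 0") (auto simp: less_eq_div_iff_mult_less_eq)
    then have "2 * real (n div d) \<le> real (2 * n div d)"
      by (metis of_nat_le_iff of_nat_mult of_nat_numeral)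
    then show "0 \<le> mangoldt d * (real (2 * n div d) - 2 * real (n div d))"
      by (intro mult_nonneg_nonneg mangoldt_nonneg) simp
  qed auto
  also have "\<dots> = ln (fact (2 * n)) - 2 * ln (fact n)"
    unfolding ext ln_fact_mangoldt[of "2 * n"]
    by (simp add: sum_subtractf sum_distrib_left algebra_simps)
  also have "psi (2 * n) = psi n + (\<Sum>d = Suc n..2 * n. mangoldt d)"
    unfolding psi_def by (subst sum.union_disjoint[symmetric]) (auto intro!: sum.cong)
  ultimately show ?thesis using up by simp
qed

lemma psi_le: "psi n \<le> 5 * real n"
proof (induction n rule: less_induct)
  case (less n)
  show ?case
  proof (cases "n \<le> 1")
    case True
    then show ?thesis by (cases n) (auto simp: psi_def)
  next
    case False
    define m where "m = (n + 1) div 2"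
    have m: "m < n" "n \<le> 2 * m" "2 * m \<le> n + 1" using False by (auto simp: m_def)
    have "psi n \<le> psi (2 * m)" using m by (intro psi_mono)
    also have "\<dots> \<le> psi m + 2 * real m * ln 2" by (rule psi_double)
    \<comment> \<open>Since 2m \<le> n + 1 \<le> 3n/2 for n \<ge> 2, the factor returned by the
      induction is 3.2 * 3/2 = 4.8, just below 5.\<close>
    also have "\<dots> \<le> 5 * real m + 2 * real m * (7/10)"
      using less.IH[OF m(1)] ln2_le_25_over_36 by (intro add_mono mult_left_mono) auto
    also have "\<dots> = 32/10 * (2 * real m)" by simp
    also have "2 * real m \<le> real n + 1" using m(3) using of_nat_mono[OF m(3), where ?'a = real] by simp
    also have "real n + 1 \<le> 3/2 * real n" using False by simp
    finally show ?thesis by simp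
  qed
qed

text \<open>The upper half of Mertens's first theorem: log n! is expanded by Legendre's identity and
  compared with log n^n; the Chebyshev bound pays for rounding n/d.\<close>

lemma sum_mangoldt_over_le: "(\<Sum>d = 1..n. mangoldt d / real d) \<le> ln (real n) + 5"
proof (cases "n = 0")
  case False
  have "real n * (\<Sum>d = 1..n. mangoldt d / real d) = (\<Sum>d = 1..n. mangoldt d * (real n / real d))"
    by (simp add: sum_distrib_left algebra_simps)
  also have "\<dots> \<le> (\<Sum>d = 1..n. mangoldt d * (real (n div d) + 1))"
  proof (intro sum_mono mult_left_mono mangoldt_nonneg)
    fix d assume "d \<in> {1..n}"
    then have "n < d * (n div d) + d" using mult_div_mod_eq[of d n] mod_less_divisor[of d n] by (simp, linarith)
    then have "real n < real d * real (n div d) + real d"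
      by (metis of_nat_add of_nat_less_iff of_nat_mult)
    then have "real n / real d < real (n div d) + 1"
      using \<open>d \<in> {1..n}\<close> by (simp add: field_simps)
    then show "real n / real d \<le> real (n div d) + 1" by simp
  qed
  also have "\<dots> = ln (fact n) + psi n"
    by (simp add: ln_fact_mangoldt psi_def algebra_simps sum.distrib)
  also have "ln (fact n :: real) \<le> ln (real n ^ n)"
    using fact_le_power[of n, where ?'a = real] False by (subst ln_le_cancel_iff) auto
  also have "ln (real n ^ n) = real n * ln (real n)" using False by (simp add: ln_realpow)
  also have "psi n \<le> 5 * real n" by (rule psi_le)
  finally have "real n * (\<Sum>d = 1..n. mangoldt d / real d) \<le> real n * (ln (real n) + 5)"
    by (simp add: algebra_simps)
  then show ?thesis using False by simp
qed simp

text \<open>An arbitrarily small multiple of log y is enough in place of log log y and needs no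
  partial summation: primes with log p \<ge> 1/\<eta> satisfy 1/p \<le> \<eta> \<Lambda>(p)/p, and
  the finitely many others go into the constant. After exponentiation the cost is a small power of
  y.\<close>

lemma sum_inverse_primes_le:
  assumes "\<eta> > 0"
  shows "\<exists>C. \<forall>y::nat. y \<ge> 1 \<longrightarrow> (\<Sum>p | prime p \<and> p \<le> y. 1 / real p) \<le> \<eta> * ln (real y) + C"
proof -
  define P where "P = nat \<lceil>exp (1 / \<eta>)\<rceil>"
  have P: "real P \<ge> exp (1 / \<eta>)" unfolding P_def by linarith
  have "P > 0" using P by (metis exp_gt_zero less_le_trans of_nat_0_less_iff)
  have lnP: "ln (real p) \<ge> 1 / \<eta>" if "p \<ge> P" for p
    using P that by (subst ln_ge_iff) (use \<open>P > 0\<close> in auto)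
  have "(\<Sum>p | prime p \<and> p \<le> y. 1 / real p) \<le> \<eta> * ln (real y) + (real P + 5 * \<eta>)" if y: "y \<ge> 1" for y :: nat
  proof -
    have "(\<Sum>p | prime p \<and> p \<le> y. 1 / real p) \<le> (\<Sum>p | prime p \<and> p < P. 1 / real p) + (\<Sum>p | prime p \<and> P \<le> p \<and> p \<le> y. 1 / real p)"
      by (subst sum.union_disjoint[symmetric]) (auto intro!: sum_mono2)
    also have "(\<Sum>p | prime p \<and> p < P. 1 / real p) \<le> (\<Sum>p | prime p \<and> p < P. 1)"
      by (intro sum_mono) (auto simp: prime_gt_0_nat Suc_le_eq)
    also have "\<dots> \<le> real (card {..<P})"
      unfolding sum_constant mult_1_right of_nat_le_iff by (simp, intro card_mono[of "{..<P}", simplified]) auto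
    also have "(\<Sum>p | prime p \<and> P \<le> p \<and> p \<le> y. 1 / real p) \<le> (\<Sum>p | prime p \<and> P \<le> p \<and> p \<le> y. \<eta> * (mangoldt p / real p))"
    proof (rule sum_mono)
      fix p assume p: "p \<in> {p. prime p \<and> P \<le> p \<and> p \<le> y}"
      then have "1 \<le> \<eta> * ln (real p)" using lnP[of p] assms by (simp add: field_simps)
      then show "1 / real p \<le> \<eta> * (mangoldt p / real p)" using p by (auto simp: field_simps intro!: divide_right_mono)
    qed
    also have "\<dots> \<le> (\<Sum>p = 1..y. \<eta> * (mangoldt p / real p))"
      using assms by (intro sum_mono2) (auto simp: mangoldt_nonneg Suc_le_eq prime_gt_0_nat)
    also have "\<dots> \<le> \<eta> * (ln (real y) + 5)"
      unfolding sum_distrib_left[symmetric] using sum_mangoldt_over_le assms by (intro mult_left_mono) auto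
    finally show ?thesis by (simp add: algebra_simps)
  qed
  then show ?thesis by blast
qed

section \<open>Integers with restricted prime factors\<close>


text \<open>A single notion covers smooth numbers, rough numbers and numbers free of primes from an
  interval, according to \<open>P\<close>.\<close>

definition composed_of :: "(nat \<Rightarrow> bool) \<Rightarrow> nat set" where
  "composed_of P = {n. n > 0 \<and> (\<forall>p. prime p \<longrightarrow> p dvd n \<longrightarrow> P p)}"

lemma composed_of_dvd: "n \<in> composed_of P \<Longrightarrow> d dvd n \<Longrightarrow> d \<in> composed_of P"
proof -
  assume n: "n \<in> composed_of P" and d: "d dvd n"
  have "d > 0" using n d by (auto simp: composed_of_def intro: dvd_pos_nat)
  moreover have "P p" if "prime p" "p dvd d" for p
    using n that dvd_trans[OF that(2) d] by (auto simp: composed_of_def)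
  ultimately show "d \<in> composed_of P" by (simp add: composed_of_def)
qed

lemma composed_of_mult: "a \<in> composed_of P \<Longrightarrow> b \<in> composed_of P \<Longrightarrow> a * b \<in> composed_of P"
  unfolding composed_of_def by (auto simp: prime_dvd_mult_iff)

lemma composed_of_mono: "n \<in> composed_of P \<Longrightarrow> (\<And>p. prime p \<Longrightarrow> p dvd n \<Longrightarrow> P p \<Longrightarrow> Q p) \<Longrightarrow> n \<in> composed_of Q"
  unfolding composed_of_def by auto

lemma one_composed_of [simp]: "Suc 0 \<in> composed_of P"
  unfolding composed_of_def by auto

lemma composed_of_pos: "n \<in> composed_of P \<Longrightarrow> n > 0"
  unfolding composed_of_def by auto

lemma coprime_composed_of:
  assumes "a \<in> composed_of P" "b \<in> composed_of Q" "\<And>p. prime p \<Longrightarrow> P p \<Longrightarrow> Q p \<Longrightarrow> False"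
  shows "coprime a b"
proof (rule ccontr)
  assume "\<not> coprime a b"
  then have "gcd a b \<noteq> 1" unfolding coprime_iff_gcd_eq_1 .
  then obtain p where p: "prime p" "p dvd gcd a b" using prime_factor_nat by blast
  then have "p dvd a" "p dvd b" by simp_all
  then have "P p" "Q p" using assms(1,2) p(1) by (simp_all add: composed_of_def)
  then show False using assms(3) p(1) by blast
qed

lemma composed_of_factor:
  "n > 0 \<Longrightarrow> \<exists>a b. n = a * b \<and> a \<in> composed_of P \<and> b \<in> composed_of (\<lambda>p. \<not> P p)"
proof (induction n rule: less_induct)
  case (less n)
  show ?case
  proof (cases "n = 1")
    case True
    then show ?thesis using one_composed_of by (intro exI[of _ 1]) simp
  next
    case False
    then obtain p where p: "prime p" "p dvd n" using prime_factor_nat by blast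
    then obtain m where m: "n = p * m" by auto
    have "m < n" "m > 0" using m less.prems prime_gt_1_nat[OF p(1)] by auto
    then obtain a b where ab: "m = a * b" "a \<in> composed_of P" "b \<in> composed_of (\<lambda>p. \<not> P p)"
      using less.IH by blast
    have pp: "P p \<Longrightarrow> p \<in> composed_of P" "\<not> P p \<Longrightarrow> p \<in> composed_of (\<lambda>p. \<not> P p)"
      using p(1) primes_dvd_imp_eq[OF _ p(1)] by (auto simp: composed_of_def prime_gt_0_nat)
    show ?thesis
    proof (cases "P p")
      case True
      then have "p * a \<in> composed_of P" using ab(2) pp(1) by (intro composed_of_mult)
      then show ?thesis using ab m by (intro exI[of _ "p * a"] exI[of _ b]) simp
    next
      case False
      then have "p * b \<in> composed_of (\<lambda>p. \<not> P p)" using ab(3) pp(2) by (intro composed_of_mult)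
      then show ?thesis using ab m by (intro exI[of _ a] exI[of _ "p * b"]) simp
    qed
  qed
qed

section \<open>Reciprocal sums and logarithmic density\<close>

definition recip_sum :: "nat set \<Rightarrow> nat \<Rightarrow> real" where
  "recip_sum A x = (\<Sum>n | n \<in> A \<and> 1 \<le> n \<and> n \<le> x. 1 / real n)"

lemma finite_bounded [simp]: "finite {n::nat. n \<in> A \<and> 1 \<le> n \<and> n \<le> x}"
  by (rule finite_subset[of _ "{..x}"]) auto

lemma recip_sum_nonneg: "recip_sum A x \<ge> 0"
  unfolding recip_sum_def by (intro sum_nonneg) auto

lemma recip_sum_mono: "A \<subseteq> B \<Longrightarrow> x \<le> y \<Longrightarrow> recip_sum A x \<le> recip_sum B y"
  unfolding recip_sum_def by (intro sum_mono2) auto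

lemma recip_sum_UNIV_le: "x \<ge> 1 \<Longrightarrow> recip_sum UNIV x \<le> 1 + ln (real x)"
proof -
  assume "x \<ge> 1"
  have "recip_sum UNIV x = harm x"
    unfolding recip_sum_def harm_def by (intro sum.cong) (auto simp: field_simps)
  moreover have "harm (Suc 0) = (1 :: real)" by (rule harm_expand(2))
  ultimately show ?thesis using euler_mascheroni_sequence_decreasing[of 1 x] \<open>x \<ge> 1\<close> by simp
qed

lemma recip_sum_UNIV_ge: "ln (real x) \<le> recip_sum UNIV x"
proof (cases "x = 0")
  case False
  have "recip_sum UNIV x = harm x"
    unfolding recip_sum_def harm_def by (intro sum.cong) (auto simp: field_simps)
  moreover have "ln (real x) \<le> ln (real x + 1)" using False by simp
  ultimately show ?thesis using ln_le_harm[of x] by simp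
qed (simp add: recip_sum_def)

text \<open>The Euler product bound without infinite series: splitting off the multiples of the new
  prime p gives S \<le> S_old + S/p for the truncated sum S, because n/p \<le> x whenever n \<le>
  x.\<close>

lemma recip_sum_composed_le:
  assumes "finite Q" "\<And>p. p \<in> Q \<Longrightarrow> prime p"
  shows "recip_sum (composed_of (\<lambda>p. p \<in> Q)) x \<le> (\<Prod>p\<in>Q. 1 / (1 - 1 / real p))"
  using assms
proof (induction Q)
  case empty
  have "{n. n \<in> composed_of (\<lambda>p. p \<in> {}) \<and> 1 \<le> n \<and> n \<le> x} \<subseteq> {1}"
  proof
    fix n assume "n \<in> {n. n \<in> composed_of (\<lambda>p. p \<in> {}) \<and> 1 \<le> n \<and> n \<le> x}"
    then have "\<not> prime q \<or> \<not> q dvd n" for q by (auto simp: composed_of_def)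
    then show "n \<in> {1}" using prime_factor_nat[of n] by blast
  qed
  then have "recip_sum (composed_of (\<lambda>p. p \<in> {})) x \<le> (\<Sum>n\<in>{1}. 1 / real n)"
    unfolding recip_sum_def by (intro sum_mono2) auto
  then show ?case by simp
next
  case (insert p Q)
  have p: "prime p" "p > 1" using insert.prems prime_gt_1_nat by auto
  let ?A = "composed_of (\<lambda>q. q \<in> Q)" and ?B = "composed_of (\<lambda>q. q \<in> insert p Q)"
  let ?L = "{n. n \<in> ?A \<and> 1 \<le> n \<and> n \<le> x}" and ?R = "{n. n \<in> ?B \<and> 1 \<le> n \<and> n \<le> x}"
  have "?R \<subseteq> ?L \<union> (*) p ` ?R"
  proof
    fix n assume n: "n \<in> ?R"
    show "n \<in> ?L \<union> (*) p ` ?R"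
    proof (cases "p dvd n")
      case True
      then obtain m where m: "n = p * m" by auto
      then have "m \<in> ?B" using n composed_of_dvd[of n _ m] by auto
      moreover have "m \<ge> 1" using n m by (auto intro: Nat.gr0I simp: Suc_le_eq)
      moreover have "m \<le> x" using n m p mult_le_mono1[of 1 p m] by (simp, linarith)
      ultimately show ?thesis using m by auto
    next
      case False
      then show ?thesis using n by (auto simp: composed_of_def)
    qed
  qed
  then have "recip_sum ?B x \<le> (\<Sum>n\<in>?L \<union> (*) p ` ?R. 1 / real n)"
    unfolding recip_sum_def by (intro sum_mono2) auto
  also have "\<dots> \<le> (\<Sum>n\<in>?L. 1 / real n) + (\<Sum>n\<in>(*) p ` ?R. 1 / real n)"
  proof -
    have "0 \<le> (\<Sum>n\<in>?L \<inter> (*) p ` ?R. 1 / real n)" by (intro sum_nonneg) simp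
    then show ?thesis by (simp only: sum_Un finite_bounded finite_imageI)
  qed
  also have "(\<Sum>n\<in>(*) p ` ?R. 1 / real n) = (\<Sum>n\<in>?R. 1 / real n) / real p"
    using p by (subst sum.reindex) (auto simp: inj_on_def sum_divide_distrib mult.commute)
  finally have "recip_sum ?B x \<le> recip_sum ?A x + recip_sum ?B x / real p"
    unfolding recip_sum_def .
  then have "recip_sum ?B x * (1 - 1 / real p) \<le> recip_sum ?A x" by (simp add: algebra_simps)
  moreover have "1 - 1 / real p > 0" using p by simp
  ultimately have "recip_sum ?B x \<le> 1 / (1 - 1 / real p) * recip_sum ?A x" by (simp add: pos_le_divide_eq)
  also have "\<dots> \<le> 1 / (1 - 1 / real p) * (\<Prod>p\<in>Q. 1 / (1 - 1 / real p))"
    using insert p by (intro mult_left_mono) auto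
  finally show ?case using insert.hyps by simp
qed

lemma recip_sum_smooth_le:
  assumes "\<eta> > 0"
  shows "\<exists>C > 0. \<forall>y x. y \<ge> 1 \<longrightarrow> recip_sum (composed_of (\<lambda>p. real p < y)) x \<le> C * y powr \<eta>"
proof -
  \<comment> \<open>The half anticipates 1/(1 - t) \<le> 1 + 2t for t \<le> 1/2, which doubles the
    sum over primes in the exponent.\<close>
  obtain C where C: "\<And>y::nat. y \<ge> 1 \<Longrightarrow> (\<Sum>p | prime p \<and> p \<le> y. 1 / real p) \<le> \<eta> / 2 * ln (real y) + C"
    using sum_inverse_primes_le[of "\<eta> / 2"] assms by auto
  have "recip_sum (composed_of (\<lambda>p. real p < y)) x \<le> exp (2 * C) * y powr \<eta>" if y: "y \<ge> 1" for y x
  proof -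
    define n where "n = nat \<lfloor>y\<rfloor>"
    have n: "n \<ge> 1" "real n \<le> y" using y by (auto simp: n_def le_nat_floor)
    let ?Q = "{p. prime p \<and> p \<le> n}"
    have "recip_sum (composed_of (\<lambda>p. real p < y)) x \<le> recip_sum (composed_of (\<lambda>p. p \<in> ?Q)) x"
    proof (intro recip_sum_mono subsetI order_refl)
      fix m assume "m \<in> composed_of (\<lambda>p. real p < y)"
      then show "m \<in> composed_of (\<lambda>p. p \<in> ?Q)"
        by (rule composed_of_mono) (use le_nat_floor in \<open>auto simp: n_def\<close>)
    qed
    also have "\<dots> \<le> (\<Prod>p\<in>?Q. 1 / (1 - 1 / real p))"
      by (intro recip_sum_composed_le) auto
    also have "\<dots> \<le> (\<Prod>p\<in>?Q. exp (2 * (1 / real p)))"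
    proof (intro prod_mono conjI)
      fix p assume p: "p \<in> ?Q"
      then have "real p \<ge> 2" using prime_ge_2_nat by auto
      then have "1 / (1 - 1 / real p) \<le> 1 + 2 * (1 / real p)"
      proof -
        define t where "t = 1 / real p"
        have t: "0 < t" "t \<le> 1 / 2" using \<open>real p \<ge> 2\<close> by (auto simp: t_def divide_simps)
        have "0 \<le> t * (1 - 2 * t)" using t by (intro mult_nonneg_nonneg) auto
        then have "1 \<le> (1 + 2 * t) * (1 - t)" by (simp add: algebra_simps)
        then have "1 / (1 - t) \<le> 1 + 2 * t" using t by (simp add: pos_divide_le_eq)
        then show ?thesis by (simp add: t_def)
      qed
      also have "\<dots> \<le> exp (2 * (1 / real p))" by (rule exp_ge_add_one_self)
      finally show "1 / (1 - 1 / real p) \<le> exp (2 * (1 / real p))" .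
      show "0 \<le> 1 / (1 - 1 / real p)" using \<open>real p \<ge> 2\<close> by simp
    qed
    also have "\<dots> = exp (2 * (\<Sum>p\<in>?Q. 1 / real p))"
      by (simp add: exp_sum sum_distrib_left)
    also have "\<dots> \<le> exp (\<eta> * ln (real n) + 2 * C)" using C[OF n(1)] by simp
    also have "\<dots> \<le> exp (\<eta> * ln y + 2 * C)" using n assms y by simp
    also have "\<dots> = exp (2 * C) * y powr \<eta>" using y by (simp add: exp_add powr_def mult.commute)
    finally show ?thesis .
  qed
  then show ?thesis by (intro exI[of _ "exp (2 * C)"]) auto
qed

text \<open>By coprimality a product ab determines both a and b, so expanding the left side produces
  distinct reciprocals of integers up to x * z.\<close>

lemma recip_sum_mult_le:
  assumes "\<And>a b. a \<in> A \<Longrightarrow> b \<in> B \<Longrightarrow> coprime a b" "x \<ge> 1" "z \<ge> 1"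
  shows "recip_sum A x * recip_sum B z \<le> recip_sum UNIV (x * z)"
proof -
  let ?A = "{n. n \<in> A \<and> 1 \<le> n \<and> n \<le> x}" and ?B = "{n. n \<in> B \<and> 1 \<le> n \<and> n \<le> z}"
  have "recip_sum A x * recip_sum B z = (\<Sum>(a, b)\<in>?A \<times> ?B. 1 / real (a * b))"
    unfolding recip_sum_def by (subst sum_product) (auto simp: sum.cartesian_product)
  also have "\<dots> = (\<Sum>n\<in>(\<lambda>(a, b). a * b) ` (?A \<times> ?B). 1 / real n)"
  proof (subst sum.reindex)
    show "inj_on (\<lambda>(a, b). a * b) (?A \<times> ?B)"
    proof (rule inj_onI, clarify)
      fix a b a' b'
      assume ab: "a \<in> A" "b \<in> B" "a' \<in> A" "b' \<in> B" "a * b = a' * b'" "1 \<le> a"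
      have co: "coprime a b'" "coprime a' b" using ab assms(1) by auto
      have "a dvd a' * b'" "a' dvd a * b" using ab(5) by (metis dvd_triv_left)+
      then have "a dvd a'" "a' dvd a"
        using co by (simp_all add: coprime_dvd_mult_left_iff)
      then have "a = a'" by (simp add: dvd_antisym)
      then show "a = a' \<and> b = b'" using ab(5,6) by simp
    qed
  qed (auto simp: case_prod_unfold)
  also have "\<dots> \<le> recip_sum UNIV (x * z)"
    unfolding recip_sum_def by (intro sum_mono2) (auto simp: mult_le_mono Suc_le_eq)
  finally show ?thesis .
qed

lemma recip_sum_UNIV_le_mult:
  "recip_sum UNIV x \<le> recip_sum (composed_of P) x * recip_sum (composed_of (\<lambda>p. \<not> P p)) x"
proof -
  let ?A = "{n. n \<in> composed_of P \<and> 1 \<le> n \<and> n \<le> x}"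
    and ?B = "{n. n \<in> composed_of (\<lambda>p. \<not> P p) \<and> 1 \<le> n \<and> n \<le> x}"
  have "recip_sum UNIV x \<le> (\<Sum>(a, b)\<in>?A \<times> ?B. 1 / real (a * b))"
    unfolding recip_sum_def
  proof (rule sum_le_included[where i = "\<lambda>(a, b). a * b"])
    show "\<forall>n\<in>{n. n \<in> UNIV \<and> 1 \<le> n \<and> n \<le> x}. \<exists>y\<in>?A \<times> ?B. (case y of (a, b) \<Rightarrow> a * b) = n \<and> 1 / real n \<le> (case y of (a, b) \<Rightarrow> 1 / real (a * b))"
    proof
      fix n assume "n \<in> {n. n \<in> UNIV \<and> 1 \<le> n \<and> n \<le> x}"
      then have n: "n > 0" "n \<le> x" by auto
      obtain a b where ab: "n = a * b" "a \<in> composed_of P" "b \<in> composed_of (\<lambda>p. \<not> P p)"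
        using composed_of_factor[OF n(1)] by blast
      have "a \<ge> 1" "b \<ge> 1" using ab n(1) by (auto simp: Suc_le_eq)
      moreover have "a \<le> n" "b \<le> n" unfolding ab(1) using calculation by simp_all
      ultimately have "a \<le> x" "b \<le> x" "a \<ge> 1" "b \<ge> 1" using n(2) by auto
      then show "\<exists>y\<in>?A \<times> ?B. (case y of (a, b) \<Rightarrow> a * b) = n \<and> 1 / real n \<le> (case y of (a, b) \<Rightarrow> 1 / real (a * b))"
        using ab by (intro bexI[of _ "(a, b)"]) auto
    qed
  qed (auto intro: finite_cartesian_product)
  also have "\<dots> = recip_sum (composed_of P) x * recip_sum (composed_of (\<lambda>p. \<not> P p)) x"
    unfolding recip_sum_def by (subst sum_product) (auto simp: sum.cartesian_product)
  finally show ?thesis .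
qed

text \<open>Passes from logarithmic to natural density, via $\log n = \sum_{d \mid n} \Lambda(d)$.\<close>

lemma card_ln_le_recip_sum:
  assumes "\<And>n d. n \<in> A \<Longrightarrow> d dvd n \<Longrightarrow> d \<in> A" "W \<ge> 1"
  shows "real (card {n. n \<in> A \<and> 1 \<le> n \<and> n \<le> W}) * ln (real W) \<le> 6 * real W * recip_sum A W"
proof -
  let ?S = "{n. n \<in> A \<and> 1 \<le> n \<and> n \<le> W}"
  define f where "f n = (if n \<in> A then 1 else 0 :: real)" for n
  have S: "(\<Sum>n\<in>?S. h n) = (\<Sum>n = 1..W. f n * h n)" for h :: "nat \<Rightarrow> real"
    unfolding f_def by (rule sum.mono_neutral_cong_left) auto
  have "real (card ?S) * ln (real W) = (\<Sum>n\<in>?S. ln (real W / real n) + ln (real n))"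
    using assms(2) by (simp add: ln_div)
  also have "\<dots> = (\<Sum>n\<in>?S. ln (real W / real n)) + (\<Sum>n\<in>?S. ln (real n))" by (rule sum.distrib)
  also have "(\<Sum>n\<in>?S. ln (real W / real n)) \<le> (\<Sum>n\<in>?S. real W * (1 / real n))"
  proof (rule sum_mono)
    fix n assume n: "n \<in> ?S"
    then have "ln (real W / real n) \<le> real W / real n - 1"
      using assms(2) by (intro ln_le_minus_one) auto
    then show "ln (real W / real n) \<le> real W * (1 / real n)" by simp
  qed
  also have "\<dots> = real W * recip_sum A W" by (simp add: recip_sum_def sum_distrib_left)
  also have "(\<Sum>n\<in>?S. ln (real n)) = (\<Sum>n = 1..W. f n * (\<Sum>d | d dvd n. mangoldt d))"
    unfolding S by (intro sum.cong refl) (subst mangoldt_sum, auto)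
  also have "\<dots> \<le> (\<Sum>n = 1..W. \<Sum>d | d dvd n. mangoldt d * f (n div d))"
  proof (rule sum_mono)
    fix n assume n: "n \<in> {1..W}"
    show "f n * (\<Sum>d | d dvd n. mangoldt d) \<le> (\<Sum>d | d dvd n. mangoldt d * f (n div d))"
      unfolding sum_distrib_left
    proof (rule sum_mono)
      fix d assume "d \<in> {d. d dvd n}"
      then have "n \<in> A \<Longrightarrow> n div d \<in> A" using assms(1)[of n "n div d"] by (auto elim!: dvdE)
      then show "f n * mangoldt d \<le> mangoldt d * f (n div d)"
        by (auto simp: f_def mangoldt_nonneg)
    qed
  qed
  also have "\<dots> = (\<Sum>n = 1..W. \<Sum>d | d dvd n. f d * mangoldt (n div d))"
  proof (rule sum.cong[OF refl])
    fix n assume "n \<in> {1..W}"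
    then have n: "n > 0" by auto
    show "(\<Sum>d | d dvd n. mangoldt d * f (n div d)) = (\<Sum>d | d dvd n. f d * mangoldt (n div d))"
      using n by (intro sum.reindex_bij_witness[of _ "\<lambda>d. n div d" "\<lambda>d. n div d"])
                 (auto simp: algebra_simps elim!: dvdE)
  qed
  also have "\<dots> = (\<Sum>m = 1..W. f m * psi (W div m))"
    unfolding psi_def by (rule sum_over_multiples)
  also have "\<dots> = (\<Sum>m\<in>?S. psi (W div m))" by (rule S[symmetric])
  also have "\<dots> \<le> (\<Sum>m\<in>?S. 5 * (real W * (1 / real m)))"
  proof (rule sum_mono)
    fix m assume "m \<in> ?S"
    have "psi (W div m) \<le> 5 * real (W div m)" by (rule psi_le)
    also have "real (W div m) \<le> real W / real m" by (rule of_nat_div_le_of_nat)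
    finally show "psi (W div m) \<le> 5 * (real W * (1 / real m))" by simp
  qed
  also have "\<dots> = 5 * (real W * recip_sum A W)" by (simp add: recip_sum_def sum_distrib_left)
  finally show ?thesis by simp
qed

text \<open>An upper bound sieve from reciprocal sums alone. An integer free of primes in [D, Z] is
  coprime to every b \<le> Z built from primes \<ge> D, so the product of the two reciprocal sums is
  O(log W). The second sum, \<open>G\<close>, is at least (log Z)/(2E), since every integer splits
  into a D-smooth part and a part like b. Hence the free integers have reciprocal sum O(E log W /
  log Z), and \<open>card_ln_le_recip_sum\<close> converts this into a count.\<close>

lemma card_free_le:
  assumes E: "\<And>x. recip_sum (composed_of (\<lambda>p. real p < D)) x \<le> E" "E > 0"
    and Z: "Z \<ge> 1" "1 \<le> ln (real W)" "ln Z \<le> 2 * ln (real W)"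
  shows "real (card {n. n \<in> composed_of (\<lambda>p. \<not> (D \<le> real p \<and> real p \<le> Z)) \<and> 1 \<le> n \<and> n \<le> W}) * ln Z
         \<le> 60 * E * real W"
proof -
  let ?F = "composed_of (\<lambda>p. \<not> (D \<le> real p \<and> real p \<le> Z))"
  define z where "z = nat \<lfloor>Z\<rfloor>"
  have z: "z \<ge> 1" "real z \<le> Z" "Z < real z + 1" using Z by (auto simp: z_def le_nat_floor)
  have W: "W \<ge> 1" using Z by (cases W) auto
  let ?B = "{n \<in> composed_of (\<lambda>p. \<not> real p < D). n \<le> z}"
  define G where "G = recip_sum (composed_of (\<lambda>p. \<not> real p < D)) z"
  have G: "G = recip_sum ?B z"
    unfolding G_def recip_sum_def by (rule sum.cong) auto
  have "recip_sum ?F W * G \<le> recip_sum UNIV (W * z)"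
    unfolding G
  proof (rule recip_sum_mult_le)
    fix a b assume a: "a \<in> ?F" and b: "b \<in> ?B"
    have "b \<in> composed_of (\<lambda>p. D \<le> real p \<and> real p \<le> Z)"
    proof -
      have "real p \<le> Z" if "p dvd b" for p
      proof -
        have "p \<le> b" using that b composed_of_pos by (intro dvd_imp_le) auto
        also have "b \<le> z" using b by auto
        finally show ?thesis using z by linarith
      qed
      then show ?thesis using b by (auto simp: composed_of_def)
    qed
    then show "coprime a b" using a by (auto intro: coprime_composed_of)
  qed (use W z in auto)
  also have "\<dots> \<le> 1 + ln (real (W * z))" using W z by (intro recip_sum_UNIV_le) (auto simp: Suc_le_eq)
  also have "\<dots> = 1 + ln (real W) + ln (real z)" using W z by (simp add: ln_mult)
  also have "ln (real z) \<le> ln Z" using z by simp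
  finally have FG: "recip_sum ?F W * G \<le> 4 * ln (real W)" using Z by simp
  have "ln Z \<le> 1 + ln (real z)"
  proof -
    have "Z \<le> 2 * real z" using z by linarith
    then have "ln Z \<le> ln (2 * real z)" using Z by simp
    also have "\<dots> = ln 2 + ln (real z)" using z by (simp add: ln_mult)
    finally show ?thesis using ln2_le_25_over_36 by simp
  qed
  moreover have "ln (real z) \<le> E * G" "1 \<le> E * G"
  proof -
    have "recip_sum UNIV z \<le> recip_sum (composed_of (\<lambda>p. real p < D)) z * G"
      unfolding G_def by (rule recip_sum_UNIV_le_mult)
    also have "\<dots> \<le> E * G" unfolding G_def by (intro mult_right_mono E recip_sum_nonneg)
    finally have *: "recip_sum UNIV z \<le> E * G" .
    then show "ln (real z) \<le> E * G" using recip_sum_UNIV_ge[of z] by linarith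
    have "recip_sum UNIV 1 \<le> recip_sum UNIV z" by (intro recip_sum_mono) (use z in auto)
    moreover have "recip_sum UNIV 1 = 1"
    proof -
      have "{n::nat. n \<in> UNIV \<and> 1 \<le> n \<and> n \<le> 1} = {1}" by auto
      then show ?thesis unfolding recip_sum_def by simp
    qed
    ultimately show "1 \<le> E * G" using * by simp
  qed
  ultimately have lnZ: "ln Z \<le> 2 * (E * G)" by simp
  let ?c = "real (card {n. n \<in> ?F \<and> 1 \<le> n \<and> n \<le> W})"
  have "?c * ln (real W) \<le> 6 * real W * recip_sum ?F W"
    by (rule card_ln_le_recip_sum) (use W composed_of_dvd in auto)
  then have "?c * ln (real W) * ln Z \<le> 6 * real W * recip_sum ?F W * (2 * (E * G))"
    using lnZ Z by (intro mult_mono[OF _ lnZ]) (auto intro!: mult_nonneg_nonneg recip_sum_nonneg)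
  also have "\<dots> = 12 * real W * E * (recip_sum ?F W * G)" by simp
  also have "\<dots> \<le> 12 * real W * E * (4 * ln (real W))"
    using FG E by (intro mult_left_mono) auto
  finally have "ln (real W) * (?c * ln Z) \<le> ln (real W) * (48 * E * real W)" by (simp add: algebra_simps)
  then have "?c * ln Z \<le> 48 * E * real W" using Z by simp
  also have "\<dots> \<le> 60 * E * real W" using E by simp
  finally show ?thesis .
qed

section \<open>Reduced approximations\<close>


lemma card_separated_le:
  fixes S :: "real set"
  assumes "S \<subseteq> {a..b}" "s > 0" "\<And>x y. x \<in> S \<Longrightarrow> y \<in> S \<Longrightarrow> x \<noteq> y \<Longrightarrow> \<bar>x - y\<bar> \<ge> s" "a \<le> b"
  shows "finite S" "real (card S) \<le> 1 + (b - a) / s"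
proof -
  define f where "f x = nat \<lfloor>(x - a) / s\<rfloor>" for x
  have inj: "inj_on f S"
  proof (rule inj_onI, rule ccontr)
    fix x y assume xy: "x \<in> S" "y \<in> S" "f x = f y" "x \<noteq> y"
    have "0 \<le> (x - a) / s" "0 \<le> (y - a) / s" using xy assms(1,2) by auto
    then have "\<lfloor>(x - a) / s\<rfloor> = \<lfloor>(y - a) / s\<rfloor>" using xy(3) unfolding f_def
      by (simp add: eq_nat_nat_iff)
    then have "\<bar>(x - a) / s - (y - a) / s\<bar> < 1" by linarith
    moreover have "(x - a) / s - (y - a) / s = (x - y) / s" by (simp add: diff_divide_distrib)
    ultimately have "\<bar>x - y\<bar> < s" using assms(2) by (simp add: abs_divide)
    then show False using assms(3)[of x y] xy by auto
  qed
  have sub: "f ` S \<subseteq> {..nat \<lfloor>(b - a) / s\<rfloor>}"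
    using assms(1,2) unfolding f_def by (auto intro!: nat_mono floor_mono divide_right_mono)
  show "finite S" using inj_on_finite[OF inj sub] by simp
  have "card S \<le> card {..nat \<lfloor>(b - a) / s\<rfloor>}" by (rule card_inj_on_le[OF inj sub]) simp
  also have "\<dots> = 1 + nat \<lfloor>(b - a) / s\<rfloor>" by simp
  finally have "real (card S) \<le> 1 + real (nat \<lfloor>(b - a) / s\<rfloor>)" by linarith
  also have "real (nat \<lfloor>(b - a) / s\<rfloor>) \<le> (b - a) / s" using assms(2,4) by simp
  finally show "real (card S) \<le> 1 + (b - a) / s" by simp
qed

text \<open>Denominators of reduced fractions b/k within \<delta>/k of \<theta>. If k = uq, then b
  is also coprime to u, so for fixed q a condition on uq becomes one of the same kind on u, with
  \<theta> replaced by \<theta> q.\<close>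

definition reduced_approx :: "real \<Rightarrow> real \<Rightarrow> nat set" where
  "reduced_approx \<theta> \<delta> = {k. k \<ge> 1 \<and> (\<exists>b::int. coprime b (int k) \<and> \<bar>\<theta> * real k - of_int b\<bar> \<le> \<delta>)}"

lemma reduced_approx_factor:
  assumes "u * q \<in> reduced_approx \<theta> \<delta>"
  shows "u \<in> reduced_approx (\<theta> * real q) \<delta>"
  using assms unfolding reduced_approx_def
  by (auto simp: mult_ac Suc_le_eq coprime_mult_right_iff)

text \<open>Reducedness is essential: multiples of one very good denominator would otherwise spoil the bound.\<close>

lemma card_reduced_approx_le:
  assumes "\<delta> \<ge> 0" "L \<ge> 0"
  shows "real (card {k \<in> reduced_approx \<beta> \<delta>. real k \<le> L}) \<le> 1 + 12 * L * \<delta>"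
proof -
  define B where "B k = (SOME b::int. coprime b (int k) \<and> \<bar>\<beta> * real k - of_int b\<bar> \<le> \<delta>)" for k
  have B: "coprime (B k) (int k)" "\<bar>\<beta> * real k - of_int (B k)\<bar> \<le> \<delta>" "k \<ge> 1"
    if "k \<in> reduced_approx \<beta> \<delta>" for k
    using that someI_ex[of "\<lambda>b. coprime b (int k) \<and> \<bar>\<beta> * real k - of_int b\<bar> \<le> \<delta>"]
    unfolding B_def reduced_approx_def by auto
  \<comment> \<open>Reduced fractions with different denominators are different, so this determinant
    is a nonzero integer, while \<open>det_le\<close> makes it small when both fractions are close
    to \<beta>.\<close>
  have det: "\<bar>B k * int l - B l * int k\<bar> \<ge> 1"
    if kl: "k \<in> reduced_approx \<beta> \<delta>" "l \<in> reduced_approx \<beta> \<delta>" "k \<noteq> l" for k l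
  proof (rule ccontr)
    assume "\<not> ?thesis"
    then have eq: "B k * int l = B l * int k" by linarith
    have "int k dvd B k * int l" unfolding eq by simp
    then have "int k dvd int l" using B(1)[OF kl(1)] by (simp add: coprime_commute coprime_dvd_mult_right_iff)
    moreover have "int l dvd B l * int k" unfolding eq[symmetric] by simp
    then have "int l dvd int k" using B(1)[OF kl(2)] by (simp add: coprime_commute coprime_dvd_mult_right_iff)
    ultimately show False using kl(3) by (simp add: dvd_antisym)
  qed
  have det_le: "real_of_int \<bar>B k * int l - B l * int k\<bar> \<le> (real k + real l) * \<delta>"
    if kl: "k \<in> reduced_approx \<beta> \<delta>" "l \<in> reduced_approx \<beta> \<delta>" for k l
  proof -
    have "real_of_int (B k * int l - B l * int k)
        = (\<beta> * real l - of_int (B l)) * real k - (\<beta> * real k - of_int (B k)) * real l"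
      by (simp add: algebra_simps)
    then have "real_of_int \<bar>B k * int l - B l * int k\<bar>
        \<le> \<bar>\<beta> * real l - of_int (B l)\<bar> * real k + \<bar>\<beta> * real k - of_int (B k)\<bar> * real l"
      using abs_triangle_ineq4[of "(\<beta> * real l - of_int (B l)) * real k" "(\<beta> * real k - of_int (B k)) * real l"]
      by (simp add: abs_mult)
    also have "\<dots> \<le> \<delta> * real k + \<delta> * real l"
      using B(2)[OF kl(1)] B(2)[OF kl(2)] by (intro add_mono mult_right_mono) auto
    finally show ?thesis by (simp add: algebra_simps)
  qed
  \<comment> \<open>For denominators in (L/2, L] the fractions are spaced by at least 1/L^2 and
    confined to an interval of length 4\<delta>/L around \<beta>.\<close>
  have block: "real (card {k \<in> reduced_approx \<beta> \<delta>. L / 2 < real k \<and> real k \<le> L}) \<le> 1 + 4 * L * \<delta>"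
    if "L > 0" for L :: real
  proof -
    let ?K = "{k \<in> reduced_approx \<beta> \<delta>. L / 2 < real k \<and> real k \<le> L}"
    let ?x = "\<lambda>k. of_int (B k) / real k :: real"
    have sep: "\<bar>?x k - ?x l\<bar> \<ge> 1 / L\<^sup>2" if kl: "k \<in> ?K" "l \<in> ?K" "k \<noteq> l" for k l
    proof -
      have pos: "real k > 0" "real l > 0" using kl B(3) by (auto simp: Suc_le_eq)
      have "1 / L\<^sup>2 \<le> 1 / (real k * real l)"
        using kl pos \<open>L > 0\<close> by (intro divide_left_mono) (auto simp: power2_eq_square intro!: mult_mono)
      also have "\<dots> \<le> real_of_int \<bar>B k * int l - B l * int k\<bar> / (real k * real l)"
      proof (intro divide_right_mono)
        have "1 \<le> \<bar>B k * int l - B l * int k\<bar>" using det[of k l] kl by auto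
        then show "1 \<le> real_of_int \<bar>B k * int l - B l * int k\<bar>" by linarith
      qed (use pos in auto)
      also have "\<dots> = \<bar>(real_of_int (B k) * real l - real_of_int (B l) * real k) / (real k * real l)\<bar>"
        by (simp add: abs_divide abs_mult)
      also have "(real_of_int (B k) * real l - real_of_int (B l) * real k) / (real k * real l) = ?x k - ?x l"
        using pos by (simp add: field_simps)
      finally show ?thesis .
    qed
    have inj: "inj_on ?x ?K"
    proof (rule inj_onI, rule ccontr)
      fix k l assume "k \<in> ?K" "l \<in> ?K" "?x k = ?x l" "k \<noteq> l"
      then show False using sep[of k l] \<open>L > 0\<close> by (simp add: divide_le_0_iff)
    qed
    have sub: "?x ` ?K \<subseteq> {\<beta> - 2 * \<delta> / L..\<beta> + 2 * \<delta> / L}"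
    proof
      fix x assume "x \<in> ?x ` ?K"
      then obtain k where k: "k \<in> ?K" "x = ?x k" by auto
      have pos: "real k > 0" using k B(3) by (auto simp: Suc_le_eq)
      have "\<bar>\<beta> - x\<bar> = \<bar>\<beta> * real k - of_int (B k)\<bar> / real k"
      proof -
        have "\<beta> * real k - of_int (B k) = (\<beta> - x) * real k" using pos k(2) by (simp add: left_diff_distrib)
        then show ?thesis using pos by (simp add: abs_mult)
      qed
      also have "\<dots> \<le> \<delta> / real k" using B(2)[of k] k pos by (intro divide_right_mono) auto
      also have "\<dots> \<le> \<delta> / (L / 2)" using k pos \<open>L > 0\<close> assms(1) by (intro divide_left_mono) auto
      also have "\<dots> = 2 * \<delta> / L" by simp
      finally show "x \<in> {\<beta> - 2 * \<delta> / L..\<beta> + 2 * \<delta> / L}" by auto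
    qed
    have "card ?K = card (?x ` ?K)" using card_image[OF inj] by simp
    also have "real (card (?x ` ?K)) \<le> 1 + ((\<beta> + 2 * \<delta> / L) - (\<beta> - 2 * \<delta> / L)) / (1 / L\<^sup>2)"
      by (rule card_separated_le(2)[OF sub]) (use sep \<open>L > 0\<close> assms(1) in auto)
    also have "\<dots> = 1 + 4 * L * \<delta>" using \<open>L > 0\<close> by (simp add: field_simps power2_eq_square)
    finally show ?thesis .
  qed
  show ?thesis using assms(2)
  proof (induction "nat \<lfloor>L\<rfloor>" arbitrary: L rule: less_induct)
    case (less L)
    let ?S = "\<lambda>L. {k \<in> reduced_approx \<beta> \<delta>. real k \<le> L}"
    have fin: "finite (?S L)" for L :: real
      by (rule finite_subset[of _ "{..nat \<lfloor>L\<rfloor>}"]) (auto simp: le_nat_floor)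
    \<comment> \<open>Each halving of L adds a 1, which over all dyadic blocks would amount to log
      L. As long as 2L\<delta> \<ge> 1, the linear term pays for that 1; once 2L\<delta> < 1, the
      determinant leaves room for only one denominator.\<close>
    consider "L < 1" | "L \<ge> 1" "2 * L * \<delta> < 1" | "L \<ge> 1" "2 * L * \<delta> \<ge> 1" by linarith
    then show ?case
    proof cases
      case 1
      then have e: "?S L = {}" using B(3) by fastforce
      have "real (card (?S L)) = 0" unfolding e by simp
      moreover have "0 \<le> 12 * L * \<delta>" using less.prems assms by simp
      ultimately show ?thesis by linarith
    next
      case 2
      have "card (?S L) \<le> 1"
      proof (rule ccontr)
        assume "\<not> card (?S L) \<le> 1"
        then obtain k l where kl: "k \<in> ?S L" "l \<in> ?S L" "k \<noteq> l"
          using card_le_Suc0_iff_eq[OF fin[of L]] by (auto simp: One_nat_def)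
        have "1 \<le> \<bar>B k * int l - B l * int k\<bar>" using det[of k l] kl by auto
        then have "1 \<le> real_of_int \<bar>B k * int l - B l * int k\<bar>" by linarith
        also have "\<dots> \<le> (real k + real l) * \<delta>" using det_le kl by auto
        also have "\<dots> \<le> (L + L) * \<delta>" using kl assms by (intro mult_right_mono) auto
        finally show False using 2 by simp
      qed
      then show ?thesis using assms less.prems of_nat_mono[of _ 1, where ?'a = real] by (simp add: add_increasing2)
    next
      case 3
      have "?S L \<subseteq> ?S (L / 2) \<union> {k \<in> reduced_approx \<beta> \<delta>. L / 2 < real k \<and> real k \<le> L}" by auto
      then have "card (?S L) \<le> card (?S (L / 2) \<union> {k \<in> reduced_approx \<beta> \<delta>. L / 2 < real k \<and> real k \<le> L})"
        by (intro card_mono) (auto intro: fin finite_subset[OF _ fin[of L]])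
      also have "\<dots> \<le> card (?S (L / 2)) + card {k \<in> reduced_approx \<beta> \<delta>. L / 2 < real k \<and> real k \<le> L}"
        by (rule card_Un_le)
      finally have "real (card (?S L)) \<le> real (card (?S (L / 2))) + real (card {k \<in> reduced_approx \<beta> \<delta>. L / 2 < real k \<and> real k \<le> L})"
        by linarith
      also have "real (card (?S (L / 2))) \<le> 1 + 12 * (L / 2) * \<delta>"
      proof (rule less.hyps)
        have "\<lfloor>L\<rfloor> \<ge> 1" using 3 by simp
        moreover have "\<lfloor>L / 2\<rfloor> < \<lfloor>L\<rfloor>"
          using of_int_floor_le[of "L / 2"] floor_correct[of L] \<open>\<lfloor>L\<rfloor> \<ge> 1\<close> by linarith
        ultimately show "nat \<lfloor>L / 2\<rfloor> < nat \<lfloor>L\<rfloor>" by linarith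
      qed (use 3 in simp)
      also have "real (card {k \<in> reduced_approx \<beta> \<delta>. L / 2 < real k \<and> real k \<le> L}) \<le> 1 + 4 * L * \<delta>"
        using 3 by (intro block) auto
      finally show ?thesis using 3 by simp
    qed
  qed
qed

section \<open>Moving prime factors\<close>


text \<open>Replacing $(u, q)$ by $(up, q/p)$ for a prime $p \mid q$ keeps $uq$ and reaches a region where the pairs are
  easy to count. The weight $1/(\omega(u) + 1) \le 1/\omega(up)$ compensates for the multiplicity of this map.\<close>

lemma sum_factor_moves_le:
  fixes I :: "nat set" and G :: "nat set" and U V :: nat
  assumes I: "finite I" "\<And>p. p \<in> I \<Longrightarrow> prime p"
  defines "\<omega> \<equiv> \<lambda>n. card {p \<in> I. p dvd n}"
  defines "T \<equiv> {(u, q). 1 \<le> u \<and> u \<le> U \<and> 1 \<le> q \<and> q \<le> V \<and> u * q \<in> G}"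
  defines "S \<equiv> {(u, q). 1 \<le> u \<and> 1 \<le> q \<and> u * q \<in> G \<and> (\<exists>p\<in>I. u \<le> p * U \<and> p * q \<le> V)}"
  shows "(\<Sum>(u, q)\<in>T. real (\<omega> q) / (real (\<omega> u) + 1)) \<le> real (card S)"
proof -
  have finT: "finite T" unfolding T_def by (rule finite_subset[of _ "{..U} \<times> {..V}"]) auto
  have finS: "finite S" unfolding S_def
  proof (rule finite_subset[of _ "{..V * U} \<times> {..V}"])
    show "{(u, q). 1 \<le> u \<and> 1 \<le> q \<and> u * q \<in> G \<and> (\<exists>p\<in>I. u \<le> p * U \<and> p * q \<le> V)} \<subseteq> {..V * U} \<times> {..V}"
    proof clarify
      fix u q p assume h: "1 \<le> u" "1 \<le> q" "p \<in> I" "u \<le> p * U" "p * q \<le> V"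
      have "p > 0" using h I(2)[of p] by (simp add: prime_gt_0_nat)
      then have "p \<le> p * q" "q \<le> p * q" using h by simp_all
      then have "p \<le> V" "q \<le> V" using h(5) by linarith+
      then show "u \<in> {..V * U} \<and> q \<in> {..V}" using le_trans[OF h(4) mult_le_mono1[OF \<open>p \<le> V\<close>]] by simp
    qed
  qed simp
  have finI: "finite {p \<in> I. p dvd n}" for n using I(1) by auto
  have "(\<Sum>(u, q)\<in>T. real (\<omega> q) / (real (\<omega> u) + 1)) = (\<Sum>x\<in>T. \<Sum>p\<in>{p \<in> I. p dvd snd x}. 1 / (real (\<omega> (fst x)) + 1))"
    by (intro sum.cong) (auto simp: \<omega>_def)
  also have "\<dots> = (\<Sum>(x, p)\<in>Sigma T (\<lambda>x. {p \<in> I. p dvd snd x}). 1 / (real (\<omega> (fst x)) + 1))"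
    by (subst sum.Sigma) (auto simp: finT finI)
  also have "\<dots> \<le> (\<Sum>(x, p)\<in>Sigma S (\<lambda>x. {p \<in> I. p dvd fst x}). 1 / real (\<omega> (fst x)))"
  \<comment> \<open>The witness undoes the move: with p recorded, the pair (u, q) comes from (u/p,
    qp), so no two moves collide.\<close>
  proof (rule sum_le_included[where i = "\<lambda>((u, q), p). ((u div p, q * p), p)"])
    show "finite (Sigma T (\<lambda>x. {p \<in> I. p dvd snd x}))" "finite (Sigma S (\<lambda>x. {p \<in> I. p dvd fst x}))"
      using finT finS finI by auto
    show "\<forall>y\<in>Sigma S (\<lambda>x. {p \<in> I. p dvd fst x}). 0 \<le> (case y of (x, p) \<Rightarrow> 1 / real (\<omega> (fst x)))" by auto
    show "\<forall>x\<in>Sigma T (\<lambda>x. {p \<in> I. p dvd snd x}).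
       \<exists>y\<in>Sigma S (\<lambda>x. {p \<in> I. p dvd fst x}).
          (case y of (x, xa) \<Rightarrow> (case x of (u, q) \<Rightarrow> \<lambda>p. ((u div p, q * p), p)) xa) = x \<and>
          (case x of (x, p) \<Rightarrow> 1 / (real (\<omega> (fst x)) + 1)) \<le> (case y of (x, p) \<Rightarrow> 1 / real (\<omega> (fst x)))"
    proof
      fix x assume "x \<in> Sigma T (\<lambda>x. {p \<in> I. p dvd snd x})"
      then obtain u q p where x: "x = ((u, q), p)" "(u, q) \<in> T" "p \<in> I" "p dvd q" by auto
      then obtain r where r: "q = p * r" by auto
      have p: "prime p" "p > 0" using I(2) x(3) by (auto simp: prime_gt_0_nat)
      have uq: "1 \<le> u" "u \<le> U" "1 \<le> q" "q \<le> V" "u * q \<in> G" using x(2) by (auto simp: T_def)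
      have "r \<ge> 1" using uq r by (auto simp: Suc_le_eq)
      have "(u * p) * r \<in> G" using uq r by (simp add: mult_ac)
      then have S: "(u * p, r) \<in> S"
        using uq r p \<open>r \<ge> 1\<close> x(3) by (auto simp: S_def mult_ac Suc_le_eq intro!: bexI[of _ p])
      have w1: "\<omega> (u * p) \<le> \<omega> u + 1"
      proof -
        have "{p' \<in> I. p' dvd u * p} \<subseteq> insert p {p' \<in> I. p' dvd u}"
        proof
          fix p' assume "p' \<in> {p' \<in> I. p' dvd u * p}"
          then have "p' \<in> I" "p' dvd u * p" "prime p'" using I(2) by auto
          then show "p' \<in> insert p {p' \<in> I. p' dvd u}"
            using p(1) by (auto simp: prime_dvd_mult_iff dest: primes_dvd_imp_eq)
        qed
        then have "card {p' \<in> I. p' dvd u * p} \<le> card (insert p {p' \<in> I. p' dvd u})"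
          using finI[of u] by (intro card_mono) auto
        also have "\<dots> \<le> card {p' \<in> I. p' dvd u} + 1" using finI[of u] by (simp add: card_insert_if)
        finally show ?thesis unfolding \<omega>_def .
      qed
      have "p \<in> {p' \<in> I. p' dvd u * p}" using x(3) by auto
      then have w2: "\<omega> (u * p) > 0" unfolding \<omega>_def using finI[of "u * p"] by (auto simp: card_gt_0_iff)
      have "1 / (real (\<omega> u) + 1) \<le> 1 / real (\<omega> (u * p))"
        using w1 w2 by (intro divide_left_mono) auto
      then show "\<exists>y\<in>Sigma S (\<lambda>x. {p \<in> I. p dvd fst x}).
          (case y of (x, xa) \<Rightarrow> (case x of (u, q) \<Rightarrow> \<lambda>p. ((u div p, q * p), p)) xa) = x \<and>
          (case x of (x, p) \<Rightarrow> 1 / (real (\<omega> (fst x)) + 1)) \<le> (case y of (x, p) \<Rightarrow> 1 / real (\<omega> (fst x)))"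
        using S x r p by (intro bexI[of _ "((u * p, r), p)"]) (auto simp: mult_ac)
    qed
  qed
  also have "\<dots> = (\<Sum>x\<in>S. \<Sum>p\<in>{p \<in> I. p dvd fst x}. 1 / real (\<omega> (fst x)))"
    by (subst sum.Sigma) (auto simp: finS finI)
  \<comment> \<open>A pair receives \<omega>(u) weights 1/\<omega>(u), which total 1, or 0 when
    \<omega>(u) = 0.\<close>
  also have "\<dots> \<le> (\<Sum>x\<in>S. 1)"
    by (intro sum_mono) (auto simp: \<omega>_def)
  finally show ?thesis by simp
qed

text \<open>Moving primes in both directions suffices, since one of $\omega(q)/(\omega(u)+1)$ and
  $\omega(u)/(\omega(q)+1)$ is at least $1/2$ unless $\omega(u) = \omega(q) = 0$.\<close>

lemma card_factor_moves_le:
  fixes I :: "nat set" and G :: "nat set" and U V :: nat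
  assumes I: "finite I" "\<And>p. p \<in> I \<Longrightarrow> prime p"
  defines "T \<equiv> {(u, q). 1 \<le> u \<and> u \<le> U \<and> 1 \<le> q \<and> q \<le> V \<and> u * q \<in> G}"
  shows "real (card {(u, q) \<in> T. \<exists>p\<in>I. p dvd u \<or> p dvd q})
    \<le> 2 * real (card {(u, q). 1 \<le> u \<and> 1 \<le> q \<and> u * q \<in> G \<and> (\<exists>p\<in>I. u \<le> p * U \<and> p * q \<le> V)})
     + 2 * real (card {(u, q). 1 \<le> u \<and> 1 \<le> q \<and> u * q \<in> G \<and> (\<exists>p\<in>I. u \<le> p * V \<and> p * q \<le> U)})"
    (is "real (card ?T0) \<le> 2 * real (card ?S1) + 2 * real (card ?S2)")
proof -
  define \<omega> where "\<omega> n = card {p \<in> I. p dvd n}" for n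
  have finT: "finite T" unfolding T_def by (rule finite_subset[of _ "{..U} \<times> {..V}"]) auto
  have 1: "(\<Sum>(u, q)\<in>T. real (\<omega> q) / (real (\<omega> u) + 1)) \<le> real (card ?S1)"
    unfolding T_def \<omega>_def by (rule sum_factor_moves_le[OF I])
  have "(\<Sum>(u, q)\<in>T. real (\<omega> u) / (real (\<omega> q) + 1))
      = (\<Sum>(u, q)\<in>{(u, q). 1 \<le> u \<and> u \<le> V \<and> 1 \<le> q \<and> q \<le> U \<and> u * q \<in> G}. real (\<omega> q) / (real (\<omega> u) + 1))"
    unfolding T_def
    by (rule sum.reindex_bij_witness[of _ prod.swap prod.swap]) (auto simp: mult.commute)
  also have "\<dots> \<le> real (card ?S2)"
    unfolding \<omega>_def by (rule sum_factor_moves_le[OF I])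
  finally have 2: "(\<Sum>(u, q)\<in>T. real (\<omega> u) / (real (\<omega> q) + 1)) \<le> real (card ?S2)" .
  have "real (card ?T0) = (\<Sum>x\<in>?T0. 1)" by simp
  also have "\<dots> \<le> (\<Sum>(u, q)\<in>?T0. 2 * (real (\<omega> q) / (real (\<omega> u) + 1)) + 2 * (real (\<omega> u) / (real (\<omega> q) + 1)))"
  proof (rule sum_mono, clarify)
    fix u q p assume "p \<in> I" "p dvd u \<or> p dvd q"
    then have "\<omega> u > 0 \<or> \<omega> q > 0" unfolding \<omega>_def using I(1) by (auto simp: card_gt_0_iff)
    then consider "\<omega> u \<le> \<omega> q" "\<omega> q \<ge> 1" | "\<omega> q \<le> \<omega> u" "\<omega> u \<ge> 1" by linarith
    then show "1 \<le> 2 * (real (\<omega> q) / (real (\<omega> u) + 1)) + 2 * (real (\<omega> u) / (real (\<omega> q) + 1))"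
    proof cases
      case 1
      then have "1 \<le> 2 * (real (\<omega> q) / (real (\<omega> u) + 1))" by (simp add: field_simps)
      then show ?thesis by (simp add: add_increasing2)
    next
      case 2
      then have "1 \<le> 2 * (real (\<omega> u) / (real (\<omega> q) + 1))" by (simp add: field_simps)
      then show ?thesis by (simp add: add_increasing)
    qed
  qed
  also have "\<dots> \<le> (\<Sum>(u, q)\<in>T. 2 * (real (\<omega> q) / (real (\<omega> u) + 1)) + 2 * (real (\<omega> u) / (real (\<omega> q) + 1)))"
    using finT by (intro sum_mono2) auto
  also have "\<dots> = 2 * (\<Sum>(u, q)\<in>T. real (\<omega> q) / (real (\<omega> u) + 1)) + 2 * (\<Sum>(u, q)\<in>T. real (\<omega> u) / (real (\<omega> q) + 1))"
    by (simp add: case_prod_unfold sum.distrib sum_distrib_left)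
  finally show ?thesis using 1 2 by simp
qed

text \<open>The cap Z takes over for q \<le> V/Z, so the harmonic part runs over V/Z < q \<le> V
  only and contributes log Z rather than log V. This is why moving primes costs only the logarithm
  of the largest prime moved.\<close>

lemma sum_min_over_le:
  fixes Z :: real and V n :: nat
  assumes "Z \<ge> 1" "n \<le> V"
  shows "(\<Sum>q = 1..n. min Z (real V / real q)) \<le> real V * (2 + ln Z)"
proof (cases "V = 0")
  case False
  define m where "m = nat \<lfloor>real V / Z\<rfloor>"
  have m: "real m \<le> real V / Z" "real V / Z < real m + 1"
    using assms by (auto simp: m_def of_nat_floor)
  have "real V / Z \<le> real V / 1" using assms by (intro divide_left_mono) auto
  then have mV: "m \<le> V" using m by linarith
  have "(\<Sum>q = 1..n. min Z (real V / real q)) \<le> (\<Sum>q = 1..V. min Z (real V / real q))"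
    using assms by (intro sum_mono2) auto
  also have "\<dots> = (\<Sum>q = 1..m. min Z (real V / real q)) + (\<Sum>q = Suc m..V. min Z (real V / real q))"
    using mV by (subst sum.union_disjoint[symmetric]) (auto intro!: sum.cong)
  also have "\<dots> \<le> (\<Sum>q = 1..m. Z) + (\<Sum>q = Suc m..V. real V * inverse (real q))"
    by (intro add_mono sum_mono) (auto simp: divide_inverse)
  also have "(\<Sum>q = 1..m. Z) \<le> real V" using m(1) assms by (simp add: field_simps)
  also have "(\<Sum>q = Suc m..V. real V * inverse (real q)) = real V * (harm V - harm m)"
  proof -
    have "harm V = harm m + (\<Sum>q = Suc m..V. inverse (real q))"
      unfolding harm_def using mV by (subst sum.union_disjoint[symmetric]) (auto intro!: sum.cong)
    then show ?thesis by (simp add: sum_distrib_left)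
  qed
  also have "harm V - harm m \<le> 1 + ln Z"
  proof (cases "m = 0")
    case True
    then have "real V \<le> Z" using m assms by (simp add: field_simps)
    then have "ln (real V) \<le> ln Z" using False assms by simp
    then show ?thesis using euler_mascheroni_sequence_decreasing[of 1 V] True False by (simp add: harm_def)
  next
    case 0: False
    then have "harm V - harm m \<le> ln (real V) - ln (real m)"
      using euler_mascheroni_sequence_decreasing[of m V] mV by simp
    also have "\<dots> = ln (real V / real m)" using 0 False by (simp add: ln_div)
    also have "\<dots> \<le> ln (2 * Z)"
    proof (subst ln_le_cancel_iff)
      have "real V / Z \<le> 2 * real m" using m 0 by linarith
      then show "real V / real m \<le> 2 * Z" using 0 assms by (simp add: field_simps)
    qed (use 0 False assms in auto)
    also have "\<dots> \<le> 1 + ln Z" using assms ln2_le_25_over_36 by (simp add: ln_mult)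
    finally show ?thesis .
  qed
  finally have "(\<Sum>q = 1..n. min Z (real V / real q)) \<le> real V + real V * (1 + ln Z)"
    by (simp add: mult_left_mono)
  then show ?thesis by (simp add: algebra_simps)
qed (use assms in simp)

text \<open>After the move, p \<ge> D forces q \<le> V/D, and p \<le> min(Z, V/q) bounds u by U
  min(Z, V/q). For fixed q the u are counted by \<open>card_reduced_approx_le\<close>: the 1 per q
  adds up to V/D only, and the terms proportional to length add up to O(\<delta> U V (2 + log
  Z)).\<close>

lemma card_moved_le:
  fixes U V :: nat and D Z \<delta> :: real
  assumes I: "\<And>p. p \<in> I \<Longrightarrow> D \<le> real p \<and> real p \<le> Z" and D: "D \<ge> 1" and Z: "Z \<ge> 1" and \<delta>: "\<delta> \<ge> 0"
  shows "real (card {(u, q). 1 \<le> u \<and> 1 \<le> q \<and> u * q \<in> reduced_approx \<theta> \<delta> \<and> (\<exists>p\<in>I. u \<le> p * U \<and> p * q \<le> V)})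
     \<le> real V / D + 12 * \<delta> * real U * real V * (2 + ln Z)"
    (is "real (card ?S) \<le> _")
proof -
  define n where "n = nat \<lfloor>real V / D\<rfloor>"
  have n: "real n \<le> real V / D" using D by (simp add: n_def)
  have "real V / D \<le> real V / 1" using D by (intro divide_left_mono) auto
  then have nV: "n \<le> V" using n by linarith
  define L where "L q = real U * min Z (real V / real q)" for q :: nat
  have L0: "L q \<ge> 0" for q using Z by (simp add: L_def)
  let ?R = "\<lambda>q. {u \<in> reduced_approx (\<theta> * real q) \<delta>. real u \<le> L q}"
  have finR: "finite (?R q)" for q
    by (rule finite_subset[of _ "{..nat \<lfloor>L q\<rfloor>}"]) (auto simp: le_nat_floor)
  have sub: "?S \<subseteq> (\<lambda>(q, u). (u, q)) ` (SIGMA q:{1..n}. ?R q)"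
  proof clarify
    fix u q p assume h: "1 \<le> u" "1 \<le> q" "u * q \<in> reduced_approx \<theta> \<delta>" "p \<in> I" "u \<le> p * U" "p * q \<le> V"
    have pq: "real p * real q \<le> real V" using h(6) by (metis of_nat_le_iff of_nat_mult)
    have up: "real u \<le> real p * real U" using h(5) by (metis of_nat_le_iff of_nat_mult)
    have "D * real q \<le> real p * real q" using I[OF h(4)] by (intro mult_right_mono) auto
    then have "real q \<le> real V / D" using pq D by (simp add: field_simps)
    then have "q \<le> n" unfolding n_def by (simp add: le_nat_floor)
    moreover have "real u \<le> L q"
    proof -
      have "real p \<le> min Z (real V / real q)" using I[OF h(4)] pq h(2) by (simp add: field_simps)
      then have "real U * real p \<le> L q" unfolding L_def by (intro mult_left_mono) auto
      then show ?thesis using up by (simp add: mult.commute)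
    qed
    ultimately have "(q, u) \<in> (SIGMA q:{1..n}. ?R q)"
      using reduced_approx_factor[OF h(3)] h by auto
    then show "(u, q) \<in> (\<lambda>(q, u). (u, q)) ` (SIGMA q:{1..n}. ?R q)"
      by (intro image_eqI[where x = "(q, u)"]) simp_all
  qed
  have "card ?S \<le> card (SIGMA q:{1..n}. ?R q)"
    by (rule surj_card_le[OF _ sub]) (auto simp: finR)
  also have "\<dots> = (\<Sum>q = 1..n. card (?R q))" using finR by (subst card_SigmaI) auto
  finally have "card ?S \<le> (\<Sum>q = 1..n. card (?R q))" .
  then have "real (card ?S) \<le> real (\<Sum>q = 1..n. card (?R q))" by (rule of_nat_mono)
  also have "\<dots> = (\<Sum>q = 1..n. real (card (?R q)))" by (rule of_nat_sum)
  also have "\<dots> \<le> (\<Sum>q = 1..n. 1 + 12 * L q * \<delta>)"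
    by (intro sum_mono card_reduced_approx_le \<delta> L0)
  also have "\<dots> = real n + 12 * \<delta> * real U * (\<Sum>q = 1..n. min Z (real V / real q))"
    by (simp add: L_def sum.distrib sum_distrib_left algebra_simps)
  also have "\<dots> \<le> real V / D + 12 * \<delta> * real U * (real V * (2 + ln Z))"
    using n \<delta> by (intro add_mono mult_left_mono sum_min_over_le Z nV) auto
  finally show ?thesis by (simp add: algebra_simps)
qed

section \<open>Divisor sums\<close>


definition ndiv :: "nat \<Rightarrow> nat" where
  "ndiv n = card {d. d dvd n}"

lemma ndiv_pos: "n > 0 \<Longrightarrow> ndiv n \<ge> 1"
  unfolding ndiv_def by (auto simp: Suc_le_eq card_gt_0_iff intro!: exI[of _ 1])

lemma ndiv_mult_le:
  assumes "a > 0" "b > 0"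
  shows "ndiv (a * b) \<le> ndiv a * ndiv b"
proof -
  have "{d. d dvd a * b} \<subseteq> (\<lambda>(x, y). x * y) ` ({d. d dvd a} \<times> {d. d dvd b})"
  proof
    fix d assume "d \<in> {d. d dvd a * b}"
    then obtain x y where "d = x * y" "x dvd a" "y dvd b" using division_decomp[of d a b] by auto
    then show "d \<in> (\<lambda>(x, y). x * y) ` ({d. d dvd a} \<times> {d. d dvd b})" by auto
  qed
  then have "card {d. d dvd a * b} \<le> card ({d. d dvd a} \<times> {d. d dvd b})"
    using assms by (intro surj_card_le) auto
  then show ?thesis unfolding ndiv_def by (simp add: card_cartesian_product)
qed

lemma ndiv_prime: "prime p \<Longrightarrow> ndiv p = 2"
proof -
  assume p: "prime p"
  have "{d. d dvd p} = {1, p}" using p by (auto simp: prime_nat_iff)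
  moreover have "p \<noteq> 1" using p by auto
  ultimately show ?thesis unfolding ndiv_def by simp
qed

text \<open>Removing one prime at a time divides by at most x, so the descent from n cannot jump
  over the interval [x, x^2].\<close>

lemma smooth_has_divisor_between:
  fixes x :: real and n :: nat
  assumes "n > 0" "x \<ge> 1" "\<And>p. prime p \<Longrightarrow> p dvd n \<Longrightarrow> real p \<le> x" "x \<le> real n"
  shows "\<exists>d. d dvd n \<and> x \<le> real d \<and> real d \<le> x\<^sup>2"
  using assms
proof (induction n rule: less_induct)
  case (less n)
  show ?case
  proof (cases "real n \<le> x\<^sup>2")
    case True
    then show ?thesis using less.prems(4) by (intro exI[of _ n]) simp
  next
    case False
    have "x \<le> x\<^sup>2" using less.prems(2) by (simp add: power2_eq_square)
    then have "n \<noteq> 1" using False less.prems(2) by (intro notI) simp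
    then obtain p where p: "prime p" "p dvd n" using prime_factor_nat by blast
    then obtain m where m: "n = p * m" by auto
    have px: "real p \<le> x" using p by (rule less.prems(3))
    have m0: "m > 0" using m less.prems(1) by auto
    have "x * x < real p * real m" using False m by (simp add: power2_eq_square)
    also have "\<dots> \<le> x * real m" using px by (intro mult_right_mono) auto
    finally have xm: "x \<le> real m" using less.prems(2) by simp
    have mn: "m < n" using m m0 prime_gt_1_nat[OF p(1)] by simp
    have "real p' \<le> x" if "prime p'" "p' dvd m" for p'
      using less.prems(3)[OF that(1)] that(2) unfolding m by simp
    then obtain d where d: "d dvd m" "x \<le> real d" "real d \<le> x\<^sup>2"
      using less.IH[OF mn m0 less.prems(2) _ xm] by blast
    have "d dvd n" unfolding m using d(1) by simp
    then show ?thesis using d(2,3) by blast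
  qed
qed

text \<open>An inequality of Landreau type. Peel off a prime above x or, if there is none, a divisor
  between x and x^2; each removal divides n by at least x, so m rounds suffice. By
  submultiplicativity \<open>ndiv n\<close> is at most the product over the pieces, and a piece with
  the most divisors serves as d. The 2 in \<open>2 * ndiv d\<close> pays for the peeled primes,
  which may exceed x^2.\<close>

lemma ndiv_le_small_divisor:
  fixes x :: real
  assumes "x \<ge> 1"
  shows "n > 0 \<Longrightarrow> real n \<le> x ^ m \<Longrightarrow> \<exists>d. d dvd n \<and> real d \<le> x\<^sup>2 \<and> ndiv n \<le> (2 * ndiv d) ^ m"
proof (induction m arbitrary: n)
  case 0
  then have "n = 1" by auto
  then show ?case using assms by (intro exI[of _ 1]) (auto simp: ndiv_def)
next
  case (Suc m)
  consider (small) "real n \<le> x" | (prime) p where "real n > x" "prime p" "p dvd n" "real p > x"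
    | (smooth) "real n > x" "\<And>p. prime p \<Longrightarrow> p dvd n \<Longrightarrow> real p \<le> x"
    by (meson not_le)
  then show ?case
  proof cases
    case small
    have "x \<le> x\<^sup>2" using assms by (simp add: power2_eq_square)
    moreover have "ndiv n * 1 \<le> (2 * ndiv n) * (2 * ndiv n) ^ m"
      using ndiv_pos[OF Suc.prems(1)] by (intro mult_le_mono) auto
    ultimately show ?thesis using small by (intro exI[of _ n]) auto
  next
    case (prime p)
    then obtain k where k: "n = p * k" by auto
    have k0: "k > 0" using k Suc.prems by auto
    have "x * real k \<le> real p * real k" using prime by (intro mult_right_mono) auto
    also have "\<dots> \<le> x * x ^ m" using Suc.prems k by simp
    finally have "real k \<le> x ^ m" using assms by simp
    then obtain d where d: "d dvd k" "real d \<le> x\<^sup>2" "ndiv k \<le> (2 * ndiv d) ^ m" using Suc.IH[OF k0] by auto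
    have "d > 0" using d k0 by (auto intro: Nat.gr0I)
    have "ndiv n \<le> ndiv p * ndiv k" unfolding k using k0 prime by (intro ndiv_mult_le) (auto simp: prime_gt_0_nat)
    also have "\<dots> \<le> (2 * ndiv d) * (2 * ndiv d) ^ m"
      using d ndiv_prime[OF prime(2)] ndiv_pos[OF \<open>d > 0\<close>] by (intro mult_le_mono) auto
    finally show ?thesis using d k by (intro exI[of _ d]) auto
  next
    case smooth
    obtain e where e: "e dvd n" "x \<le> real e" "real e \<le> x\<^sup>2"
      using smooth_has_divisor_between[OF Suc.prems(1) assms smooth(2) less_imp_le[OF smooth(1)]] by blast
    then obtain k where k: "n = e * k" by auto
    have k0: "k > 0" "e > 0" using k Suc.prems by auto
    have "x * real k \<le> real e * real k" using e by (intro mult_right_mono) auto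
    also have "\<dots> \<le> x * x ^ m" using Suc.prems k by simp
    finally have "real k \<le> x ^ m" using assms by simp
    then obtain d where d: "d dvd k" "real d \<le> x\<^sup>2" "ndiv k \<le> (2 * ndiv d) ^ m" using Suc.IH[OF k0(1)] by auto
    have nn: "ndiv n \<le> ndiv e * ndiv k" unfolding k using k0 by (intro ndiv_mult_le) auto
    show ?thesis
    proof (cases "ndiv e \<le> ndiv d")
      case True
      then have "ndiv e * ndiv k \<le> (2 * ndiv d) * (2 * ndiv d) ^ m"
        using d by (intro mult_le_mono) auto
      with nn have "ndiv n \<le> (2 * ndiv d) * (2 * ndiv d) ^ m" by (rule le_trans)
      then show ?thesis using d k by (intro exI[of _ d]) simp
    next
      case False
      then have "(2 * ndiv d) ^ m \<le> (2 * ndiv e) ^ m" by (intro power_mono) auto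
      with d(3) have "ndiv k \<le> (2 * ndiv e) ^ m" by (rule le_trans)
      then have "ndiv e * ndiv k \<le> (2 * ndiv e) * (2 * ndiv e) ^ m"
        by (intro mult_le_mono) simp_all
      with nn have "ndiv n \<le> (2 * ndiv e) * (2 * ndiv e) ^ m" by (rule le_trans)
      then show ?thesis using e by (intro exI[of _ e]) simp
    qed
  qed
qed

text \<open>One factor \<open>ndiv n\<close> is spent as a sum over factorizations n = ab and the
  others are split by submultiplicativity. Thus moment m + 1 is at most the square of moment m,
  whence the exponent 2^m.\<close>

lemma sum_ndiv_power_le:
  assumes "\<And>n d. n \<in> A \<Longrightarrow> d dvd n \<Longrightarrow> d \<in> A"
  shows "(\<Sum>n | n \<in> A \<and> 1 \<le> n \<and> n \<le> x. real (ndiv n) ^ m / real n) \<le> recip_sum A x ^ (2 ^ m)"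
proof (induction m)
  case 0
  then show ?case by (simp add: recip_sum_def)
next
  case (Suc m)
  let ?S = "{n. n \<in> A \<and> 1 \<le> n \<and> n \<le> x}"
  let ?f = "\<lambda>n. real (ndiv n) ^ m / real n"
  have "(\<Sum>n\<in>?S. real (ndiv n) ^ Suc m / real n) = (\<Sum>n\<in>?S. \<Sum>d | d dvd n. ?f n)"
    by (simp add: ndiv_def)
  also have "\<dots> = (\<Sum>(n, d)\<in>(SIGMA n:?S. {d. d dvd n}). ?f n)"
    by (subst sum.Sigma) auto
  also have "\<dots> \<le> (\<Sum>(a, b)\<in>?S \<times> ?S. ?f a * ?f b)"
  proof (rule sum_le_included[where i = "\<lambda>(a, b). (a * b, a)"])
    show "finite (SIGMA n:?S. {d. d dvd n})" by (intro finite_SigmaI) auto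
    show "\<forall>y\<in>?S \<times> ?S. 0 \<le> (case y of (a, b) \<Rightarrow> ?f a * ?f b)" by auto
    show "\<forall>z\<in>(SIGMA n:?S. {d. d dvd n}). \<exists>y\<in>?S \<times> ?S. (case y of (a, b) \<Rightarrow> (a * b, a)) = z
       \<and> (case z of (n, d) \<Rightarrow> ?f n) \<le> (case y of (a, b) \<Rightarrow> ?f a * ?f b)"
    proof
      fix z assume "z \<in> (SIGMA n:?S. {d. d dvd n})"
      then obtain n a where z: "z = (n, a)" "n \<in> A" "1 \<le> n" "n \<le> x" "a dvd n" by auto
      then obtain b where b: "n = a * b" by auto
      have ab: "a > 0" "b > 0" using z(3) b by auto
      have "a \<le> n" "b \<le> n" unfolding b using ab by auto
      then have "a \<le> x" "b \<le> x" using z(4) by linarith+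
      then have in_S: "a \<in> ?S" "b \<in> ?S" using z b ab assms[of n a] assms[of n b] by (auto simp: Suc_le_eq)
      have "real (ndiv n) ^ m \<le> (real (ndiv a) * real (ndiv b)) ^ m"
        using ndiv_mult_le[OF ab] unfolding b by (intro power_mono) (auto simp flip: of_nat_mult)
      then have "?f n \<le> (real (ndiv a) * real (ndiv b)) ^ m / real n"
        by (intro divide_right_mono) auto
      also have "\<dots> = ?f a * ?f b" unfolding b by (simp add: power_mult_distrib)
      finally show "\<exists>y\<in>?S \<times> ?S. (case y of (a, b) \<Rightarrow> (a * b, a)) = z
       \<and> (case z of (n, d) \<Rightarrow> ?f n) \<le> (case y of (a, b) \<Rightarrow> ?f a * ?f b)"
        using in_S z b by (intro bexI[of _ "(a, b)"]) auto
    qed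
  qed auto
  also have "\<dots> = (\<Sum>n\<in>?S. ?f n) * (\<Sum>n\<in>?S. ?f n)"
    by (subst sum_product) (auto simp: sum.cartesian_product)
  also have "\<dots> \<le> recip_sum A x ^ (2 ^ m) * recip_sum A x ^ (2 ^ m)"
    by (intro mult_mono Suc.IH sum_nonneg) (auto intro: recip_sum_nonneg zero_le_power)
  finally show ?case by (simp add: power_add[symmetric] mult_2)
qed

text \<open>Trading \<open>ndiv k\<close> for a sum over divisors d \<le> x^2 reduces the task to
  counting the k divisible by d. Then k = jd with j a reduced denominator for \<theta> d, so there
  are at most 1 + O(\<delta> K/d) of them. Because d \<le> x^2, the 1 is at most x^2/d, and a moment
  of \<open>ndiv\<close> with weights 1/d remains.\<close>

lemma sum_ndiv_reduced_approx_le: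
  fixes x :: real
  assumes "x \<ge> 1" "real K \<le> x ^ m" "\<delta> \<ge> 0"
    and E: "\<And>z. recip_sum (composed_of P) z \<le> E"
  shows "(\<Sum>k | k \<in> reduced_approx \<theta> \<delta> \<inter> composed_of P \<and> k \<le> K. real (ndiv k))
     \<le> 2 ^ m * (x\<^sup>2 + 12 * \<delta> * real K) * E ^ (2 ^ m)"
proof -
  define z where "z = nat \<lfloor>x\<^sup>2\<rfloor>"
  let ?S = "{k. k \<in> reduced_approx \<theta> \<delta> \<inter> composed_of P \<and> k \<le> K}"
  let ?D = "{d. d \<in> composed_of P \<and> 1 \<le> d \<and> d \<le> z}"
  let ?g = "\<lambda>d. (2 * real (ndiv d)) ^ m"
  have z: "real z \<le> x\<^sup>2" by (simp add: z_def)
  have finS: "finite ?S" by (rule finite_subset[of _ "{..K}"]) auto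
  have fin: "finite {k \<in> ?S. d dvd k}" for d using finS by auto
  have "(\<Sum>k\<in>?S. real (ndiv k)) \<le> (\<Sum>k\<in>?S. \<Sum>d\<in>{d \<in> ?D. d dvd k}. ?g d)"
  proof (rule sum_mono)
    fix k assume k: "k \<in> ?S"
    then have k0: "k > 0" using composed_of_pos by auto
    have "real k \<le> x ^ m" using k assms(2) by (auto intro: order_trans[of _ "real K"])
    then obtain d where d: "d dvd k" "real d \<le> x\<^sup>2" "ndiv k \<le> (2 * ndiv d) ^ m"
      using ndiv_le_small_divisor[OF assms(1) k0] by blast
    have "d > 0" using d k0 by (auto intro: Nat.gr0I)
    then have "d \<in> {d \<in> ?D. d dvd k}"
      using d k composed_of_dvd by (auto simp: z_def le_nat_floor Suc_le_eq)
    then have "?g d \<le> (\<Sum>d\<in>{d \<in> ?D. d dvd k}. ?g d)" by (intro member_le_sum) auto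
    moreover have "real (ndiv k) \<le> ?g d" using of_nat_mono[OF d(3), where ?'a = real] by simp
    ultimately show "real (ndiv k) \<le> (\<Sum>d\<in>{d \<in> ?D. d dvd k}. ?g d)" by linarith
  qed
  also have "\<dots> = (\<Sum>d\<in>?D. \<Sum>k\<in>{k \<in> ?S. d dvd k}. ?g d)"
    by (rule sum.swap_restrict) (use finS in auto)
  also have "\<dots> = (\<Sum>d\<in>?D. real (card {k \<in> ?S. d dvd k}) * ?g d)" by simp
  also have "\<dots> \<le> (\<Sum>d\<in>?D. (x\<^sup>2 + 12 * \<delta> * real K) / real d * ?g d)"
  proof (intro sum_mono mult_right_mono)
    fix d assume d: "d \<in> ?D"
    then have d0: "real d > 0" by auto
    have "real d \<le> real z" using d by simp
    then have d1: "real d \<le> x\<^sup>2" using z by linarith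
    let ?L = "real K / real d"
    let ?R = "{k \<in> reduced_approx (\<theta> * real d) \<delta>. real k \<le> ?L}"
    have finR: "finite ?R" by (rule finite_subset[of _ "{..nat \<lfloor>?L\<rfloor>}"]) (auto simp: le_nat_floor)
    have "{k \<in> ?S. d dvd k} \<subseteq> (\<lambda>j. j * d) ` ?R"
    proof
      fix k assume k: "k \<in> {k \<in> ?S. d dvd k}"
      then have "d dvd k" by simp
      then obtain j where j: "k = j * d" by (metis dvd_def mult.commute)
      then have "j \<in> reduced_approx (\<theta> * real d) \<delta>" using k reduced_approx_factor[of j d] by auto
      moreover have "real (j * d) \<le> real K" using k j by (intro of_nat_mono) simp
      then have "real j \<le> ?L" using d0 by (simp add: field_simps)
      ultimately show "k \<in> (\<lambda>j. j * d) ` ?R" using j by auto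
    qed
    then have "card {k \<in> ?S. d dvd k} \<le> card ?R" by (rule surj_card_le[OF finR])
    then have "real (card {k \<in> ?S. d dvd k}) \<le> real (card ?R)" by simp
    also have "\<dots> \<le> 1 + 12 * ?L * \<delta>" using assms(3) d0 by (intro card_reduced_approx_le) auto
    also have "\<dots> \<le> (x\<^sup>2 + 12 * \<delta> * real K) / real d" using d0 d1 by (simp add: field_simps)
    finally show "real (card {k \<in> ?S. d dvd k}) \<le> (x\<^sup>2 + 12 * \<delta> * real K) / real d" .
  qed auto
  also have "\<dots> = 2 ^ m * (x\<^sup>2 + 12 * \<delta> * real K) * (\<Sum>d\<in>?D. real (ndiv d) ^ m / real d)"
    unfolding sum_distrib_left by (intro sum.cong refl) (simp add: power_mult_distrib)
  also have "\<dots> \<le> 2 ^ m * (x\<^sup>2 + 12 * \<delta> * real K) * recip_sum (composed_of P) z ^ (2 ^ m)"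
    using assms by (intro mult_left_mono sum_ndiv_power_le) (auto intro: composed_of_dvd)
  also have "\<dots> \<le> 2 ^ m * (x\<^sup>2 + 12 * \<delta> * real K) * E ^ (2 ^ m)"
    using assms by (intro mult_left_mono power_mono E recip_sum_nonneg) auto
  finally show ?thesis .
qed

section \<open>Pairs with a good approximation\<close>


definition approx_pairs :: "real \<Rightarrow> real \<Rightarrow> nat \<Rightarrow> nat \<Rightarrow> (nat \<times> nat) set" where
  "approx_pairs \<theta> \<delta> U V = {(u, q). 1 \<le> u \<and> u \<le> U \<and> 1 \<le> q \<and> q \<le> V \<and> u * q \<in> reduced_approx \<theta> \<delta>}"

lemma finite_approx_pairs: "finite (approx_pairs \<theta> \<delta> U V)"
  unfolding approx_pairs_def by (rule finite_subset[of _ "{..U} \<times> {..V}"]) auto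

lemma card_approx_pairs_swap: "card (approx_pairs \<theta> \<delta> U V \<inter> (A \<times> A)) = card (approx_pairs \<theta> \<delta> V U \<inter> (A \<times> A))"
  unfolding approx_pairs_def
  by (rule bij_betw_same_card[of prod.swap], rule bij_betw_byWitness[where f' = prod.swap])
     (auto simp: mult.commute)

text \<open>Pairs in which some entry has a prime in [D, Z] are disposed of by moving primes in both
  directions. The pairs with both entries in \<open>F\<close> are kept aside because their treatment
  depends on the size of r.\<close>

lemma card_approx_pairs_le:
  fixes D Z \<delta> :: real
  assumes D: "D \<ge> 1" and Z: "Z \<ge> 1" and \<delta>: "\<delta> \<ge> 0"
  defines "F \<equiv> composed_of (\<lambda>p. \<not> (D \<le> real p \<and> real p \<le> Z))"
  shows "real (card (approx_pairs \<theta> \<delta> U V)) \<le> real (card (approx_pairs \<theta> \<delta> U V \<inter> (F \<times> F)))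
     + 2 * (real U + real V) / D + 48 * \<delta> * real U * real V * (2 + ln Z)"
proof -
  let ?I = "{p. prime p \<and> D \<le> real p \<and> real p \<le> Z}"
  let ?T = "approx_pairs \<theta> \<delta> U V"
  let ?B = "{(u, q) \<in> ?T. \<exists>p\<in>?I. p dvd u \<or> p dvd q}"
  have finI: "finite ?I" by (rule finite_subset[of _ "{..nat \<lfloor>Z\<rfloor>}"]) (auto simp: le_nat_floor)
  have "?T \<subseteq> (?T \<inter> (F \<times> F)) \<union> ?B"
    by (fastforce simp: F_def composed_of_def approx_pairs_def)
  then have "card ?T \<le> card ((?T \<inter> (F \<times> F)) \<union> ?B)"
    by (intro card_mono) (auto intro: finite_subset[OF _ finite_approx_pairs])
  also have "\<dots> \<le> card (?T \<inter> (F \<times> F)) + card ?B" by (rule card_Un_le)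
  finally have split: "real (card ?T) \<le> real (card (?T \<inter> (F \<times> F))) + real (card ?B)" by linarith
  have "real (card ?B)
     \<le> 2 * real (card {(u, q). 1 \<le> u \<and> 1 \<le> q \<and> u * q \<in> reduced_approx \<theta> \<delta> \<and> (\<exists>p\<in>?I. u \<le> p * U \<and> p * q \<le> V)})
     + 2 * real (card {(u, q). 1 \<le> u \<and> 1 \<le> q \<and> u * q \<in> reduced_approx \<theta> \<delta> \<and> (\<exists>p\<in>?I. u \<le> p * V \<and> p * q \<le> U)})"
    unfolding approx_pairs_def by (rule card_factor_moves_le) (use finI in auto)
  also have "\<dots> \<le> 2 * (real V / D + 12 * \<delta> * real U * real V * (2 + ln Z))
      + 2 * (real U / D + 12 * \<delta> * real V * real U * (2 + ln Z))"
    by (intro add_mono mult_left_mono card_moved_le) (use D Z \<delta> in auto)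
  also have "\<dots> = 2 * (real U + real V) / D + 48 * \<delta> * real U * real V * (2 + ln Z)"
    by (simp add: algebra_simps add_divide_distrib)
  finally show ?thesis using split by linarith
qed

lemma card_approx_pairs_free_le:
  assumes "\<delta> \<ge> 0"
  shows "real (card (approx_pairs \<theta> \<delta> U V \<inter> (F \<times> F)))
     \<le> real (card {n. n \<in> F \<and> 1 \<le> n \<and> n \<le> V}) * (1 + 12 * real U * \<delta>)"
proof -
  let ?S = "{n. n \<in> F \<and> 1 \<le> n \<and> n \<le> V}"
  let ?R = "\<lambda>q. {u \<in> reduced_approx (\<theta> * real q) \<delta>. real u \<le> real U}"
  have finR: "finite (?R q)" for q by (rule finite_subset[of _ "{..U}"]) auto
  have sub: "approx_pairs \<theta> \<delta> U V \<inter> (F \<times> F) \<subseteq> (\<lambda>(q, u). (u, q)) ` (SIGMA q:?S. ?R q)"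
  proof
    fix z assume z: "z \<in> approx_pairs \<theta> \<delta> U V \<inter> (F \<times> F)"
    obtain u q where uq: "z = (u, q)" by (cases z)
    have "u \<in> reduced_approx (\<theta> * real q) \<delta>"
      using z uq by (intro reduced_approx_factor) (auto simp: approx_pairs_def)
    then have "(q, u) \<in> (SIGMA q:?S. ?R q)" using z uq by (auto simp: approx_pairs_def)
    then show "z \<in> (\<lambda>(q, u). (u, q)) ` (SIGMA q:?S. ?R q)"
      by (intro image_eqI[where x = "(q, u)"]) (simp_all add: uq)
  qed
  have "card (approx_pairs \<theta> \<delta> U V \<inter> (F \<times> F)) \<le> card (SIGMA q:?S. ?R q)"
    by (rule surj_card_le[OF _ sub]) (auto simp: finR)
  also have "\<dots> = (\<Sum>q\<in>?S. card (?R q))" using finR by (subst card_SigmaI) auto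
  finally have "real (card (approx_pairs \<theta> \<delta> U V \<inter> (F \<times> F))) \<le> real (\<Sum>q\<in>?S. card (?R q))"
    by (rule of_nat_mono)
  also have "\<dots> = (\<Sum>q\<in>?S. real (card (?R q)))" by (rule of_nat_sum)
  also have "\<dots> \<le> (\<Sum>q\<in>?S. 1 + 12 * real U * \<delta>)"
    by (intro sum_mono card_reduced_approx_le assms) auto
  finally show ?thesis by simp
qed

lemma card_approx_pairs_le_sum_ndiv:
  assumes "A \<subseteq> composed_of P"
  shows "real (card (approx_pairs \<theta> \<delta> U V \<inter> (A \<times> A)))
     \<le> (\<Sum>k | k \<in> reduced_approx \<theta> \<delta> \<inter> composed_of P \<and> k \<le> U * V. real (ndiv k))"
proof -
  let ?S = "{k. k \<in> reduced_approx \<theta> \<delta> \<inter> composed_of P \<and> k \<le> U * V}"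
  have finS: "finite ?S" by (rule finite_subset[of _ "{..U * V}"]) auto
  have k0: "k > 0" if "k \<in> ?S" for k using that composed_of_pos by auto
  have sub: "approx_pairs \<theta> \<delta> U V \<inter> (A \<times> A) \<subseteq> (\<lambda>(k, u). (u, k div u)) ` (SIGMA k:?S. {d. d dvd k})"
  proof
    fix z assume z: "z \<in> approx_pairs \<theta> \<delta> U V \<inter> (A \<times> A)"
    obtain u q where uq: "z = (u, q)" by (cases z)
    have h: "1 \<le> u" "u \<le> U" "q \<le> V" "u * q \<in> reduced_approx \<theta> \<delta>" "u \<in> composed_of P" "q \<in> composed_of P"
      using z uq assms by (auto simp: approx_pairs_def)
    have "u * q \<in> composed_of P" using h by (intro composed_of_mult)
    moreover have "u * q \<le> U * V" using h by (intro mult_le_mono)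
    ultimately have "(u * q, u) \<in> (SIGMA k:?S. {d. d dvd k})" using h by auto
    then show "z \<in> (\<lambda>(k, u). (u, k div u)) ` (SIGMA k:?S. {d. d dvd k})"
      using h(1) by (intro image_eqI[where x = "(u * q, u)"]) (simp_all add: uq)
  qed
  have "card (approx_pairs \<theta> \<delta> U V \<inter> (A \<times> A)) \<le> card (SIGMA k:?S. {d. d dvd k})"
    by (rule surj_card_le[OF _ sub]) (use finS k0 in \<open>auto intro!: finite_SigmaI\<close>)
  also have "\<dots> = (\<Sum>k\<in>?S. card {d. d dvd k})"
    using finS k0 by (subst card_SigmaI) auto
  finally have "real (card (approx_pairs \<theta> \<delta> U V \<inter> (A \<times> A))) \<le> real (\<Sum>k\<in>?S. ndiv k)"
    unfolding ndiv_def by (rule of_nat_mono)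
  then show ?thesis by simp
qed

text \<open>Here $r^{3/4}$ is the logarithm of the largest prime moved: the pairs left over have an entry
  without prime factors between $r^2$ and $\exp(r^{3/4})$.\<close>

lemma card_approx_pairs_small_ratio:
  "\<exists>C > 0. \<forall>\<theta> \<delta> U V r N W.
     r \<ge> 1 \<longrightarrow> N \<ge> exp 2 \<longrightarrow> r powr (3/4) \<le> ln N \<longrightarrow> \<delta> \<ge> 0 \<longrightarrow> real U \<le> N \<longrightarrow> real V \<le> N \<longrightarrow>
     \<delta> * real U * real V \<le> N / r\<^sup>2 \<longrightarrow> (W = U \<or> W = V) \<longrightarrow> sqrt N \<le> real W \<longrightarrow> real W \<le> N / sqrt r \<longrightarrow>
     real (card (approx_pairs \<theta> \<delta> U V)) \<le> C * N * r powr (-9/8)"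
proof -
  \<comment> \<open>The exponent 1/32 keeps the total below -9/8: with D = r^2 the smooth sum costs
    r^(1/16), the sieve saves r^(-3/4) and the range W \<le> N / sqrt r saves r^(-1/2), together
    r^(-19/16).\<close>
  obtain CE where CE: "CE > 0" "\<And>y x. y \<ge> 1 \<Longrightarrow> recip_sum (composed_of (\<lambda>p. real p < y)) x \<le> CE * y powr (1/32)"
    using recip_sum_smooth_le[of "1/32"] by auto
  have "real (card (approx_pairs \<theta> \<delta> U V)) \<le> (780 * CE + 148) * N * r powr (-9/8)"
    if r: "r \<ge> 1" and N: "N \<ge> exp 2" and rN: "r powr (3/4) \<le> ln N" and \<delta>: "\<delta> \<ge> 0"
      and UV: "real U \<le> N" "real V \<le> N" "\<delta> * real U * real V \<le> N / r\<^sup>2"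
      and W: "W = U \<or> W = V" "sqrt N \<le> real W" "real W \<le> N / sqrt r"
    for \<theta> \<delta> U V r N W
  proof -
    define Z where "Z = exp (r powr (3/4))"
    define F where "F = composed_of (\<lambda>p. \<not> (r\<^sup>2 \<le> real p \<and> real p \<le> Z))"
    have lnZ: "ln Z = r powr (3/4)" "Z \<ge> 1" by (simp_all add: Z_def)
    have N0: "N > 0" using N exp_gt_zero[of "2::real"] by linarith
    have r2: "r\<^sup>2 \<ge> 1" using r by simp
    have lnN: "2 \<le> ln N" using N N0 by (simp add: ln_ge_iff)
    \<comment> \<open>The lower bound sqrt N on W yields log Z \<le> log N \<le> 2 log W, as the
      sieve bound demands.\<close>
    have "ln (sqrt N) \<le> ln (real W)" using W(2) N0 by (intro ln_mono) auto
    then have lnW: "ln N / 2 \<le> ln (real W)" using N0 by (simp add: ln_sqrt)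
    let ?E = "CE * r powr (1/16)"
    have rpow: "(r\<^sup>2) powr (1/32) = r powr (1/16)" using r by (simp add: powr_powr flip: powr_numeral)
    let ?c = "\<lambda>W. real (card {n. n \<in> F \<and> 1 \<le> n \<and> n \<le> W})"
    have "?c W * ln Z \<le> 60 * ?E * real W"
      unfolding F_def
    proof (rule card_free_le)
      show "recip_sum (composed_of (\<lambda>p. real p < r\<^sup>2)) x \<le> ?E" for x
        using CE(2)[OF r2, of x] rpow by simp
    qed (use CE r lnZ rN lnN lnW in auto)
    then have cW: "?c W \<le> 60 * CE * (r powr (1/16) * r powr (-3/4)) * real W"
      unfolding lnZ using r by (simp add: powr_minus field_simps)
    also have "r powr (1/16) * r powr (-3/4) = r powr (-11/16)" by (simp flip: powr_add)
    finally have cW: "?c W \<le> 60 * CE * r powr (-11/16) * real W" .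
    obtain W' where W': "(W, W') = (U, V) \<or> (W, W') = (V, U)" using W(1) by auto
    have \<delta>W: "\<delta> * real W' * real W \<le> N / r\<^sup>2" using W' UV(3) by (auto simp: mult_ac)
    have "real (card (approx_pairs \<theta> \<delta> U V \<inter> (F \<times> F))) = real (card (approx_pairs \<theta> \<delta> W' W \<inter> (F \<times> F)))"
      using W' card_approx_pairs_swap by auto
    also have "\<dots> \<le> ?c W * (1 + 12 * real W' * \<delta>)" by (rule card_approx_pairs_free_le[OF \<delta>])
    also have "\<dots> \<le> 60 * CE * r powr (-11/16) * real W * (1 + 12 * real W' * \<delta>)"
      using cW \<delta> by (intro mult_right_mono) auto
    also have "\<dots> = 60 * CE * r powr (-11/16) * (real W + 12 * (\<delta> * real W' * real W))"
      by (simp add: algebra_simps)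
    also have "\<dots> \<le> 60 * CE * r powr (-11/16) * (N / sqrt r + 12 * (N / sqrt r))"
    proof (intro mult_left_mono add_mono W(3))
      have "sqrt r \<le> r\<^sup>2" using r by (intro real_le_lsqrt) (auto intro: order_trans[OF _ power_increasing[of 1 4 r]] simp flip: power_mult)
      then have "N / r\<^sup>2 \<le> N / sqrt r" using r N0 by (intro divide_left_mono) auto
      then show "\<delta> * real W' * real W \<le> N / sqrt r" using \<delta>W by linarith
    qed (use CE in auto)
    also have "\<dots> = 780 * CE * N * (r powr (-11/16) * r powr (-1/2))"
      using r by (simp add: powr_half_sqrt powr_minus field_simps)
    also have "r powr (-11/16) * r powr (-1/2) = r powr (-19/16)" by (simp flip: powr_add)
    also have "780 * CE * N * r powr (-19/16) \<le> 780 * CE * N * r powr (-9/8)"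
      using r CE N0 by (intro mult_left_mono powr_mono) auto
    finally have free: "real (card (approx_pairs \<theta> \<delta> U V \<inter> (F \<times> F))) \<le> 780 * CE * N * r powr (-9/8)" .
    have "real (card (approx_pairs \<theta> \<delta> U V)) \<le> real (card (approx_pairs \<theta> \<delta> U V \<inter> (F \<times> F)))
       + 2 * (real U + real V) / r\<^sup>2 + 48 * \<delta> * real U * real V * (2 + ln Z)"
      unfolding F_def by (rule card_approx_pairs_le) (use r2 lnZ \<delta> in auto)
    also have "2 * (real U + real V) / r\<^sup>2 \<le> 4 * (N / r\<^sup>2)" using UV r by (simp add: divide_simps)
    also have "48 * \<delta> * real U * real V * (2 + ln Z) \<le> 48 * (N / r\<^sup>2) * (3 * r powr (3/4))"
    proof -
      have "1 \<le> r powr (3/4)" using r by (simp add: ge_one_powr_ge_zero)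
      then have "48 * (\<delta> * real U * real V) * (2 + ln Z) \<le> 48 * (N / r\<^sup>2) * (3 * r powr (3/4))"
        using UV(3) lnZ N0 r \<delta> by (intro mult_mono) auto
      then show ?thesis by (simp add: mult_ac)
    qed
    also have "48 * (N / r\<^sup>2) * (3 * r powr (3/4)) = 144 * N * (r powr (3/4) * r powr (-2))"
      using r by (simp add: powr_minus powr_numeral field_simps)
    also have "r powr (3/4) * r powr (-2) = r powr (-5/4)" by (simp flip: powr_add)
    also have "144 * N * r powr (-5/4) \<le> 144 * N * r powr (-9/8)"
      using r N0 by (intro mult_left_mono powr_mono) auto
    also have "4 * (N / r\<^sup>2) = 4 * N * r powr (-2)"
      using r by (simp add: powr_minus powr_numeral field_simps)
    also have "\<dots> \<le> 4 * N * r powr (-9/8)" using r N0 by (intro mult_left_mono powr_mono) auto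
    finally show ?thesis using free by (simp add: algebra_simps)
  qed
  then show ?thesis using CE(1) by (intro exI[of _ "780 * CE + 148"]) auto
qed

text \<open>All primes above $r^2$ can be moved here, at the cost of a factor $\log N$ that $r$ absorbs; what remains
  are the pairs with an $r^2$-smooth product.\<close>

lemma card_approx_pairs_large_ratio:
  "\<exists>C > 0. \<forall>\<theta> \<delta> U V r N.
     r \<ge> 1 \<longrightarrow> N \<ge> 1 \<longrightarrow> ln N \<le> r powr (3/4) \<longrightarrow> r \<le> N\<^sup>2 \<longrightarrow> \<delta> \<ge> 0 \<longrightarrow> real U \<le> N \<longrightarrow> real V \<le> N \<longrightarrow>
     \<delta> * real U * real V \<le> N / r\<^sup>2 \<longrightarrow>
     real (card (approx_pairs \<theta> \<delta> U V)) \<le> C * (N * r powr (-9/8) + N powr (1/5))"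
proof -
  \<comment> \<open>M = 2^40 is the power of E that the divisor sum produces for m = 40; \<eta> is
    chosen so that this power costs only r^(1/100).\<close>
  define M :: nat where "M = 2 ^ 40"
  have M0: "M > 0" by (simp add: M_def)
  define \<eta> where "\<eta> = 1 / (200 * real M)"
  have \<eta>: "\<eta> > 0" using M0 by (simp add: \<eta>_def)
  obtain CE where CE: "CE > 0" "\<And>y x. y \<ge> 1 \<Longrightarrow> recip_sum (composed_of (\<lambda>p. real p < y)) x \<le> CE * y powr \<eta>"
    using recip_sum_smooth_le[OF \<eta>] by auto
  define C where "C = 2 ^ 40 * CE ^ M"
  have C: "C > 0" using CE by (simp add: C_def)
  have "real (card (approx_pairs \<theta> \<delta> U V)) \<le> (12 * C + 148) * (N * r powr (-9/8) + N powr (1/5))"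
    if r: "r \<ge> 1" and N: "N \<ge> 1" and rN: "ln N \<le> r powr (3/4)" "r \<le> N\<^sup>2" and \<delta>: "\<delta> \<ge> 0"
      and UV: "real U \<le> N" "real V \<le> N" "\<delta> * real U * real V \<le> N / r\<^sup>2"
    for \<theta> \<delta> U V r N
  proof -
    define F where "F = composed_of (\<lambda>p. \<not> (r\<^sup>2 \<le> real p \<and> real p \<le> N))"
    have r2: "r\<^sup>2 \<ge> 1" using r by simp
    let ?P = "\<lambda>p. real p < r\<^sup>2"
    define A where "A = {n. n \<in> F \<and> 1 \<le> n \<and> real n \<le> N}"
    have AP: "A \<subseteq> composed_of ?P"
    proof
      fix n assume n: "n \<in> A"
      show "n \<in> composed_of ?P"
        unfolding composed_of_def
      proof (clarify, intro conjI allI impI)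
        fix p assume p: "prime p" "p dvd n"
        have "p \<le> n" using p n by (intro dvd_imp_le) (auto simp: A_def)
        then have "real p \<le> N" using n by (simp add: A_def)
        then show "real p < r\<^sup>2" using n p by (auto simp: A_def F_def composed_of_def)
      qed (use n in \<open>auto simp: A_def\<close>)
    qed
    have eq: "approx_pairs \<theta> \<delta> U V \<inter> (F \<times> F) = approx_pairs \<theta> \<delta> U V \<inter> (A \<times> A)"
      using UV by (auto simp: A_def approx_pairs_def)
    let ?E = "CE * (r\<^sup>2) powr \<eta>"
    have E: "?E ^ M = CE ^ M * r powr (1/100)"
      using r M0 by (simp add: power_mult_distrib powr_power powr_powr \<eta>_def flip: powr_numeral)
    \<comment> \<open>The divisor inequality is used with x = N^(1/20): x^40 = N^2 covers every
      product uq, and x^2 = N^(1/10) keeps the loss below N^(1/5).\<close>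
    have N20: "(N powr (1/20)) ^ 40 = N\<^sup>2" "(N powr (1/20))\<^sup>2 = N powr (1/10)"
      using N by (simp_all add: powr_power)
    have "real (U * V) \<le> N * N" unfolding of_nat_mult using UV N by (intro mult_mono) auto
    then have K: "real (U * V) \<le> (N powr (1/20)) ^ 40" unfolding N20(1) by (simp add: power2_eq_square)
    have "real (card (approx_pairs \<theta> \<delta> U V \<inter> (F \<times> F)))
       \<le> (\<Sum>k | k \<in> reduced_approx \<theta> \<delta> \<inter> composed_of ?P \<and> k \<le> U * V. real (ndiv k))"
      unfolding eq by (rule card_approx_pairs_le_sum_ndiv[OF AP])
    also have "\<dots> \<le> 2 ^ 40 * ((N powr (1/20))\<^sup>2 + 12 * \<delta> * real (U * V)) * ?E ^ (2 ^ 40)"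
      by (rule sum_ndiv_reduced_approx_le[OF _ K \<delta>])
         (use N CE(2)[OF r2] in \<open>auto simp: ge_one_powr_ge_zero\<close>)
    also have "\<dots> = C * (N powr (1/10) + 12 * (\<delta> * real U * real V)) * r powr (1/100)"
      unfolding N20 M_def[symmetric] E C_def by (simp add: mult_ac)
    also have "\<dots> \<le> C * (N powr (1/10) + 12 * (N * r powr (-2))) * r powr (1/100)"
      using UV(3) C r by (intro mult_right_mono mult_left_mono add_mono) (auto simp: powr_minus powr_numeral divide_simps)
    also have "\<dots> = C * (N powr (1/10) * r powr (1/100) + 12 * N * (r powr (-2) * r powr (1/100)))"
      by (simp add: algebra_simps)
    also have "r powr (-2) * r powr (1/100) = r powr (-199/100)" by (simp flip: powr_add)
    also have "C * (N powr (1/10) * r powr (1/100) + 12 * N * r powr (-199/100))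
       \<le> C * (N powr (1/5) + 12 * N * r powr (-9/8))"
    proof (intro mult_left_mono add_mono)
      have "r powr (1/100) \<le> (N\<^sup>2) powr (1/100)" using r rN(2) by (intro powr_mono2) auto
      also have "\<dots> = N powr (1/50)" using N by (simp add: powr_powr flip: powr_numeral)
      also have "\<dots> \<le> N powr (1/10)" using N by (intro powr_mono) auto
      finally have "N powr (1/10) * r powr (1/100) \<le> N powr (1/10) * N powr (1/10)"
        by (intro mult_left_mono) auto
      also have "\<dots> = N powr (1/5)" by (simp flip: powr_add)
      finally show "N powr (1/10) * r powr (1/100) \<le> N powr (1/5)" .
      show "r powr (-199/100) \<le> r powr (-9/8)" using r by (intro powr_mono) auto
    qed (use C N in auto)
    also have "\<dots> \<le> 12 * C * (N * r powr (-9/8) + N powr (1/5))"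
      using C by (simp add: algebra_simps)
    finally have free: "real (card (approx_pairs \<theta> \<delta> U V \<inter> (F \<times> F))) \<le> 12 * C * (N * r powr (-9/8) + N powr (1/5))" .
    have "real (card (approx_pairs \<theta> \<delta> U V)) \<le> real (card (approx_pairs \<theta> \<delta> U V \<inter> (F \<times> F)))
       + 2 * (real U + real V) / r\<^sup>2 + 48 * \<delta> * real U * real V * (2 + ln N)"
      unfolding F_def by (rule card_approx_pairs_le) (use r2 N \<delta> in auto)
    also have "2 * (real U + real V) / r\<^sup>2 \<le> 4 * (N / r\<^sup>2)" using UV r by (simp add: divide_simps)
    also have "48 * \<delta> * real U * real V * (2 + ln N) \<le> 48 * (N / r\<^sup>2) * (3 * r powr (3/4))"
    proof -
      have "1 \<le> r powr (3/4)" using r by (simp add: ge_one_powr_ge_zero)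
      then have "48 * (\<delta> * real U * real V) * (2 + ln N) \<le> 48 * (N / r\<^sup>2) * (3 * r powr (3/4))"
        using UV(3) rN N r \<delta> by (intro mult_mono) auto
      then show ?thesis by (simp add: mult_ac)
    qed
    also have "48 * (N / r\<^sup>2) * (3 * r powr (3/4)) = 144 * N * (r powr (3/4) * r powr (-2))"
      using r by (simp add: powr_minus powr_numeral field_simps)
    also have "r powr (3/4) * r powr (-2) = r powr (-5/4)" by (simp flip: powr_add)
    also have "144 * N * r powr (-5/4) \<le> 144 * N * r powr (-9/8)"
      using r N by (intro mult_left_mono powr_mono) auto
    also have "4 * (N / r\<^sup>2) = 4 * N * r powr (-2)"
      using r by (simp add: powr_minus powr_numeral field_simps)
    also have "\<dots> \<le> 4 * N * r powr (-9/8)" using r N by (intro mult_left_mono powr_mono) auto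
    finally have "real (card (approx_pairs \<theta> \<delta> U V)) \<le> 12 * C * (N * r powr (-9/8) + N powr (1/5)) + 148 * (N * r powr (-9/8))"
      using free by (simp add: algebra_simps)
    also have "\<dots> \<le> 12 * C * (N * r powr (-9/8) + N powr (1/5)) + 148 * (N * r powr (-9/8) + N powr (1/5))"
      by simp
    finally show ?thesis by (simp add: algebra_simps)
  qed
  then show ?thesis using C by (intro exI[of _ "12 * C + 148"]) auto
qed


text \<open>A single pair, with k = uq \<le> N^2/(rY), has approximation error at most Y/(rN), which
  must be at least (2k)^(-5/4)/\<kappa>. Solving for r gives r^(9/4) \<le> 4 \<kappa> N^(3/2); the
  square root is taken so that r^(9/8) matches the saving r^(-9/8). The 2k is there because \<theta>
  will be 2\<alpha>.\<close>

lemma ratio_le_if_approx_pairs_nonempty: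
  fixes N r Y \<kappa> \<delta> :: real
  assumes dioph: "\<And>(k::nat) (b::int). k \<ge> 1 \<Longrightarrow> \<bar>\<theta> * real k - of_int b\<bar> \<ge> (2 * real k) powr (-5/4) / \<kappa>"
    and \<kappa>: "\<kappa> > 0" and r: "r > 0" and N: "N > 0" and Y: "Y \<ge> 1"
    and \<delta>: "\<delta> = Y / (r * N)" and UV: "real U * real V \<le> N\<^sup>2 / (r * Y)"
    and ne: "approx_pairs \<theta> \<delta> U V \<noteq> {}"
  shows "r powr (9/8) \<le> 2 * sqrt \<kappa> * N powr (3/4)"
proof -
  obtain u q where uq: "1 \<le> u" "u \<le> U" "1 \<le> q" "q \<le> V" "u * q \<in> reduced_approx \<theta> \<delta>"
    using ne unfolding approx_pairs_def by auto
  define k where "k = u * q"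
  obtain b :: int where k: "k \<ge> 1" "\<bar>\<theta> * real k - of_int b\<bar> \<le> \<delta>"
    using uq(5) unfolding reduced_approx_def k_def by auto
  have k0: "real k > 0" using k(1) by simp
  have "real k \<le> real U * real V" unfolding k_def of_nat_mult using uq by (intro mult_mono) auto
  then have kN: "real k \<le> N\<^sup>2 / (r * Y)" using UV by linarith
  have "(2 * real k) powr (-5/4) / \<kappa> \<le> Y / (r * N)"
    using dioph[OF k(1), of b] k(2) \<delta> by linarith
  then have "(2 * real k) powr (-5/4) * (r * N) \<le> \<kappa> * Y"
    using \<kappa> r N by (simp add: field_simps)
  then have "(2 * real k) powr (5/4) * ((2 * real k) powr (-5/4) * (r * N)) \<le> (2 * real k) powr (5/4) * (\<kappa> * Y)"
    by (rule mult_left_mono) simp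
  also have "(2 * real k) powr (5/4) * ((2 * real k) powr (-5/4) * (r * N)) = r * N"
    using k0 by (simp add: powr_minus field_simps)
  also have "(2 * real k) powr (5/4) * (\<kappa> * Y) \<le> (2 * (N\<^sup>2 / (r * Y))) powr (5/4) * (\<kappa> * Y)"
    using kN \<kappa> Y by (intro mult_right_mono powr_mono2) auto
  also have "(2 * (N\<^sup>2 / (r * Y))) powr (5/4) = 2 powr (5/4) * N powr (5/2) * r powr (-5/4) * Y powr (-5/4)"
    using N r Y by (simp add: powr_mult powr_divide powr_minus field_simps powr_powr flip: powr_numeral)
  also have "\<dots> * (\<kappa> * Y) = 2 powr (5/4) * \<kappa> * N powr (5/2) * r powr (-5/4) * (Y powr (-5/4) * Y powr 1)"
    using Y by simp
  also have "Y powr (-5/4) * Y powr 1 = Y powr (-1/4)" by (subst powr_add[symmetric]) simp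
  also have "Y powr (-1/4) \<le> 1" using Y by (simp add: powr_minus field_simps ge_one_powr_ge_zero)
  also have "2 powr (5/4) * \<kappa> * N powr (5/2) * r powr (-5/4) * 1 \<le> 4 * \<kappa> * N powr (5/2) * r powr (-5/4) * 1"
  proof -
    have "2 powr (5/4) \<le> (2::real) powr 2" by (intro powr_mono) auto
    then show ?thesis using \<kappa> by (intro mult_right_mono) auto
  qed
  finally have "r * N \<le> 4 * \<kappa> * N powr (5/2) * r powr (-5/4)"
    using \<kappa> by (simp add: mult_left_mono)
  then have "r powr (5/4) * N powr (-1) * (r * N) \<le> r powr (5/4) * N powr (-1) * (4 * \<kappa> * N powr (5/2) * r powr (-5/4))"
    by (rule mult_left_mono) simp
  also have "r powr (5/4) * N powr (-1) * (4 * \<kappa> * N powr (5/2) * r powr (-5/4))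
      = 4 * \<kappa> * (N powr (-1) * N powr (5/2)) * (r powr (5/4) * r powr (-5/4))" by (simp only: mult_ac)
  also have "N powr (-1) * N powr (5/2) = N powr (3/2)" by (subst powr_add[symmetric]) simp
  also have "r powr (5/4) * r powr (-5/4) = 1" using r by (simp flip: powr_add)
  also have "r powr (5/4) * N powr (-1) * (r * N) = (r powr (5/4) * r powr 1) * (N powr (-1) * N powr 1)"
    using r N by simp
  also have "r powr (5/4) * r powr 1 = r powr (9/4)" by (subst powr_add[symmetric]) simp
  also have "N powr (-1) * N powr 1 = 1" using N by (subst powr_add[symmetric]) simp
  finally have "r powr (9/4) \<le> 4 * \<kappa> * N powr (3/2)" by simp
  then have "sqrt (r powr (9/4)) \<le> sqrt (4 * \<kappa> * N powr (3/2))" by (rule real_sqrt_le_mono)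
  then show ?thesis using r N by (simp add: real_sqrt_mult powr_half_sqrt[symmetric] powr_powr)
qed

text \<open>Merges the ranges of r below and above (log N)^(4/3). In the upper one the surplus
  N^(1/5) is multiplied by r^(9/8) * r^(-9/8), and r^(9/8) \<le> 2 sqrt \<kappa> N^(3/4) turns it
  into sqrt \<kappa> N^(19/20) r^(-9/8), up to a constant.\<close>

lemma card_approx_pairs_uniform:
  "\<exists>C > 0. \<exists>N\<^sub>0::nat. \<forall>\<theta> \<kappa> (N::nat) Y (g::nat) (i::nat).
     N \<ge> N\<^sub>0 \<longrightarrow> Y \<ge> 1 \<longrightarrow> Y\<^sup>2 \<le> ln (real N) \<longrightarrow> 1 \<le> g \<longrightarrow> g \<le> N \<longrightarrow> 2 ^ i \<le> N \<longrightarrow> \<kappa> > 0 \<longrightarrow>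
     (\<forall>(k::nat) (b::int). k \<ge> 1 \<longrightarrow> \<bar>\<theta> * real k - of_int b\<bar> \<ge> (2 * real k) powr (-5/4) / \<kappa>) \<longrightarrow>
     real (card (approx_pairs \<theta> (Y / (real g * 2 ^ i * real N)) (N div g) (nat \<lfloor>real N / (2 ^ i * Y)\<rfloor>)))
       \<le> C * (real N + sqrt \<kappa> * real N powr (19/20)) * (real g * 2 ^ i) powr (-9/8)"
proof -
  obtain C1 where C1: "C1 > 0" "\<And>\<theta> \<delta> U V r N W.
     r \<ge> 1 \<Longrightarrow> N \<ge> exp 2 \<Longrightarrow> r powr (3/4) \<le> ln N \<Longrightarrow> \<delta> \<ge> 0 \<Longrightarrow> real U \<le> N \<Longrightarrow> real V \<le> N \<Longrightarrow>
     \<delta> * real U * real V \<le> N / r\<^sup>2 \<Longrightarrow> W = U \<or> W = V \<Longrightarrow> sqrt N \<le> real W \<Longrightarrow> real W \<le> N / sqrt r \<Longrightarrow>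
     real (card (approx_pairs \<theta> \<delta> U V)) \<le> C1 * N * r powr (-9/8)"
    using card_approx_pairs_small_ratio by metis
  obtain C2 where C2: "C2 > 0" "\<And>\<theta> \<delta> U V r N.
     r \<ge> 1 \<Longrightarrow> N \<ge> 1 \<Longrightarrow> ln N \<le> r powr (3/4) \<Longrightarrow> r \<le> N\<^sup>2 \<Longrightarrow> \<delta> \<ge> 0 \<Longrightarrow> real U \<le> N \<Longrightarrow> real V \<le> N \<Longrightarrow>
     \<delta> * real U * real V \<le> N / r\<^sup>2 \<Longrightarrow>
     real (card (approx_pairs \<theta> \<delta> U V)) \<le> C2 * (N * r powr (-9/8) + N powr (1/5))"
    using card_approx_pairs_large_ratio by metis
  \<comment> \<open>For r \<le> (log N)^(4/3) and Y \<le> sqrt (log N) both ranges are at least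
    N/(rY) - 1, the 1 being lost to rounding; this makes whichever range enters the sieve bound
    reach sqrt N.\<close>
  have "eventually (\<lambda>x::real. sqrt x \<le> x / (ln x powr (4/3) * sqrt (ln x)) - 1) at_top" by real_asymp
  moreover have "eventually (\<lambda>x::real. exp 2 \<le> x) at_top" by (rule eventually_ge_at_top)
  ultimately have "eventually (\<lambda>x::real. sqrt x \<le> x / (ln x powr (4/3) * sqrt (ln x)) - 1 \<and> exp 2 \<le> x) at_top"
    by (rule eventually_conj)
  then obtain B where B: "\<And>x::real. x \<ge> B \<Longrightarrow> sqrt x \<le> x / (ln x powr (4/3) * sqrt (ln x)) - 1 \<and> exp 2 \<le> x"
    by (auto simp: eventually_at_top_linorder)
  define N\<^sub>0 where "N\<^sub>0 = nat \<lceil>B\<rceil>"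
  have "real (card (approx_pairs \<theta> (Y / (real g * 2 ^ i * real N)) (N div g) (nat \<lfloor>real N / (2 ^ i * Y)\<rfloor>)))
       \<le> (C1 + 2 * C2) * (real N + sqrt \<kappa> * real N powr (19/20)) * (real g * 2 ^ i) powr (-9/8)"
    if h: "N \<ge> N\<^sub>0" "Y \<ge> 1" "Y\<^sup>2 \<le> ln (real N)" "1 \<le> g" "g \<le> N" "2 ^ i \<le> N" "\<kappa> > 0"
      and dioph: "\<And>(k::nat) (b::int). k \<ge> 1 \<Longrightarrow> \<bar>\<theta> * real k - of_int b\<bar> \<ge> (2 * real k) powr (-5/4) / \<kappa>"
    for \<theta> \<kappa> N Y g i
  proof -
    define r where "r = real g * 2 ^ i"
    define U where "U = N div g"
    define V where "V = nat \<lfloor>real N / (2 ^ i * Y)\<rfloor>"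
    define \<delta> where "\<delta> = Y / (r * real N)"
    let ?c = "real (card (approx_pairs \<theta> \<delta> U V))"
    have "real N \<ge> B" using h(1) unfolding N\<^sub>0_def by linarith
    note B' = B[OF this]
    have N: "real N \<ge> exp 2" using B' by simp
    then have N1: "real N \<ge> 1" using exp_ge_add_one_self[of 2] by linarith
    have g1: "real g \<ge> 1" and i1: "(2::real) ^ i \<ge> 1" using h(4) by simp_all
    then have r1: "r \<ge> 1" unfolding r_def using mult_mono[of 1 "real g" 1 "2 ^ i"] by simp
    have \<delta>0: "\<delta> \<ge> 0" unfolding \<delta>_def using h(2) r1 by simp
    have Ug: "real U \<le> real N / real g" unfolding U_def by (rule of_nat_div_le_of_nat)
    have V: "real V \<le> real N / (2 ^ i * Y)" unfolding V_def using h(2) by (intro of_nat_floor) simp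
    have "real N / (2 ^ i * Y) \<le> real N / 2 ^ i"
      using h(2) i1 by (intro divide_left_mono) (auto simp: mult_le_cancel_left1)
    then have Vi: "real V \<le> real N / 2 ^ i" using V by linarith
    have "real N / real g \<le> real N / 1" "real N / 2 ^ i \<le> real N / 1"
      using g1 i1 by (intro divide_left_mono; simp)+
    then have UVN: "real U \<le> real N" "real V \<le> real N" using Ug Vi by simp_all
    have "real U * real V \<le> real N / real g * (real N / (2 ^ i * Y))"
      using Ug V by (intro mult_mono) auto
    also have "\<dots> = (real N)\<^sup>2 / (r * Y)" by (simp add: r_def power2_eq_square)
    finally have UV: "real U * real V \<le> (real N)\<^sup>2 / (r * Y)" .
    have "\<delta> * (real U * real V) \<le> \<delta> * ((real N)\<^sup>2 / (r * Y))" using UV \<delta>0 by (rule mult_left_mono)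
    also have "\<dots> = real N / r\<^sup>2" unfolding \<delta>_def using h(2) r1 N1 by (simp add: power2_eq_square)
    finally have \<delta>UV: "\<delta> * real U * real V \<le> real N / r\<^sup>2" by (simp add: mult.assoc)
    have M: "real N \<le> real N + sqrt \<kappa> * real N powr (19/20)" using h(7) by simp
    have "?c \<le> (C1 + 2 * C2) * (real N + sqrt \<kappa> * real N powr (19/20)) * r powr (-9/8)"
    proof (cases "r powr (3/4) \<le> ln (real N)")
      case True
      have lnN: "ln (real N) \<ge> 0" using N1 by simp
      have "r = (r powr (3/4)) powr (4/3)" using r1 by (simp add: powr_powr)
      also have "\<dots> \<le> ln (real N) powr (4/3)" using True by (intro powr_mono2) auto
      finally have rle: "r \<le> ln (real N) powr (4/3)" .
      have Yle: "Y \<le> sqrt (ln (real N))" using h(3) by (rule real_le_rsqrt)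
      have le: "r * Y \<le> ln (real N) powr (4/3) * sqrt (ln (real N))"
        using rle Yle h(2) r1 by (intro mult_mono) auto
      have "real N / (ln (real N) powr (4/3) * sqrt (ln (real N))) \<le> real N / (r * Y)"
      proof -
        have "0 < r * Y" using r1 h(2) by simp
        moreover from this le have "0 < ln (real N) powr (4/3) * sqrt (ln (real N))" by linarith
        ultimately show ?thesis using le N1 by (intro divide_left_mono mult_pos_pos[of "r * Y"]) auto
      qed
      then have big: "sqrt (real N) \<le> real N / (r * Y) - 1" using B' by linarith
      \<comment> \<open>W is the range belonging to the larger of g and 2^i, which is at least sqrt
        r because their product is r.\<close>
      have "\<exists>W. (W = U \<or> W = V) \<and> sqrt (real N) \<le> real W \<and> real W \<le> real N / sqrt r"
      proof (cases "(2::real) ^ i \<le> real g")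
        case True
        have "r \<le> real g * real g" unfolding r_def using True by (intro mult_left_mono) auto
        then have "sqrt r \<le> real g" by (intro real_le_lsqrt) (use r1 in \<open>auto simp: power2_eq_square\<close>)
        then have 1: "real N / real g \<le> real N / sqrt r" using r1 g1 by (intro divide_left_mono) auto
        have "real g * 1 \<le> r * Y" unfolding r_def using g1 i1 h(2)
          by (intro mult_mono) (auto simp: mult_le_cancel_left1)
        then have "real N / (r * Y) \<le> real N / real g" using g1 by (intro divide_left_mono) auto
        moreover have "real N / real g < real U + 1"
        proof -
          have "N < (U + 1) * g" unfolding U_def using h(4) dividend_less_div_times[of g N] by (simp add: algebra_simps)
          then have "real N < real ((U + 1) * g)" by (subst of_nat_less_iff)
          then show ?thesis using g1 by (simp add: field_simps)
        qed
        ultimately have "sqrt (real N) \<le> real U" using big by linarith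
        then show ?thesis using 1 Ug by (intro exI[of _ U]) simp
      next
        case False
        have "r \<le> 2 ^ i * 2 ^ i" unfolding r_def using False by (intro mult_right_mono) auto
        then have "sqrt r \<le> 2 ^ i" by (intro real_le_lsqrt) (use r1 in \<open>auto simp: power2_eq_square\<close>)
        then have 1: "real N / 2 ^ i \<le> real N / sqrt r" using r1 i1 by (intro divide_left_mono) auto
        have "1 * (2 ^ i * Y) \<le> real g * (2 ^ i * Y)" using g1 h(2) by (intro mult_right_mono) auto
        then have "2 ^ i * Y \<le> r * Y" unfolding r_def by (simp add: mult.assoc)
        then have "real N / (r * Y) \<le> real N / (2 ^ i * Y)" using h(2) r1 by (intro divide_left_mono) auto
        moreover have "real N / (2 ^ i * Y) < real V + 1" unfolding V_def using h(2) by (simp; linarith)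
        ultimately have "sqrt (real N) \<le> real V" using big by linarith
        then show ?thesis using 1 Vi by (intro exI[of _ V]) simp
      qed
      then obtain W where W: "W = U \<or> W = V" "sqrt (real N) \<le> real W" "real W \<le> real N / sqrt r" by blast
      have "?c \<le> C1 * real N * r powr (-9/8)"
        by (rule C1(2)[OF r1 N True \<delta>0 UVN \<delta>UV W])
      also have "\<dots> \<le> (C1 + 2 * C2) * (real N + sqrt \<kappa> * real N powr (19/20)) * r powr (-9/8)"
        using C1(1) C2(1) M by (intro mult_right_mono mult_mono) auto
      finally show ?thesis .
    next
      case False
      show ?thesis
      proof (cases "approx_pairs \<theta> \<delta> U V = {}")
        case True
        then show ?thesis using C1(1) C2(1) h(7) by simp
      next
        case ne: False
        have "r powr (9/8) \<le> 2 * sqrt \<kappa> * real N powr (3/4)"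
          by (rule ratio_le_if_approx_pairs_nonempty[OF dioph h(7) _ _ h(2) \<delta>_def UV ne]) (use r1 N1 in auto)
        then have "r powr (-9/8) * (real N powr (1/5) * r powr (9/8))
           \<le> r powr (-9/8) * (real N powr (1/5) * (2 * sqrt \<kappa> * real N powr (3/4)))"
          by (intro mult_left_mono) auto
        also have "r powr (-9/8) * (real N powr (1/5) * r powr (9/8)) = real N powr (1/5) * (r powr (-9/8) * r powr (9/8))"
          by (simp only: mult_ac)
        also have "r powr (-9/8) * r powr (9/8) = 1" using r1 by (simp flip: powr_add)
        also have "r powr (-9/8) * (real N powr (1/5) * (2 * sqrt \<kappa> * real N powr (3/4)))
           = 2 * sqrt \<kappa> * (real N powr (1/5) * real N powr (3/4)) * r powr (-9/8)"
          by (simp only: mult_ac)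
        also have "real N powr (1/5) * real N powr (3/4) = real N powr (19/20)" by (simp flip: powr_add)
        finally have small: "real N powr (1/5) \<le> 2 * sqrt \<kappa> * real N powr (19/20) * r powr (-9/8)" by simp
        have "r \<le> real N * real N"
        proof -
          have "(2::real) ^ i \<le> real N" using of_nat_mono[OF h(6), where ?'a = real] by simp
          then show ?thesis unfolding r_def using h(5) by (intro mult_mono) auto
        qed
        then have rN: "r \<le> (real N)\<^sup>2" by (simp add: power2_eq_square)
        have "?c \<le> C2 * (real N * r powr (-9/8) + real N powr (1/5))"
          by (rule C2(2)[OF r1 N1 _ rN \<delta>0 UVN \<delta>UV]) (use False in simp)
        also have "\<dots> \<le> C2 * (2 * real N * r powr (-9/8) + 2 * sqrt \<kappa> * real N powr (19/20) * r powr (-9/8))"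
          using C2(1) small by (intro mult_left_mono add_mono) auto
        also have "\<dots> = 2 * C2 * (real N + sqrt \<kappa> * real N powr (19/20)) * r powr (-9/8)"
          by (simp add: algebra_simps)
        also have "\<dots> \<le> (C1 + 2 * C2) * (real N + sqrt \<kappa> * real N powr (19/20)) * r powr (-9/8)"
          using C1(1) C2(1) h(7) by (intro mult_right_mono) auto
        finally show ?thesis .
      qed
    qed
    then show ?thesis unfolding U_def V_def \<delta>_def r_def .
  qed
  then show ?thesis using C1(1) C2(1)
    by (intro exI[of _ "C1 + 2 * C2"] conjI exI[of _ N\<^sub>0] allI impI) auto
qed

section \<open>Counting in arithmetic blocks\<close>


lemma dist_nearest_int_le_iff:
  "dist_nearest_int t \<le> \<eta> \<longleftrightarrow> (\<exists>a::int. \<bar>t - of_int a\<bar> \<le> \<eta>)"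
  using dist_nearest_int_le order_trans unfolding dist_nearest_int_def by blast

lemma card_ints_in_interval:
  fixes x \<rho> :: real
  assumes "\<rho> \<ge> 0"
  shows "finite {t::int. \<bar>of_int t - x\<bar> \<le> \<rho>}"
    "real (card {t::int. \<bar>of_int t - x\<bar> \<le> \<rho>}) \<le> 2 * \<rho> + 1"
    "real (card {t::int. \<bar>of_int t - x\<bar> \<le> \<rho>}) \<ge> 2 * \<rho> - 1"
proof -
  have eq: "{t::int. \<bar>of_int t - x\<bar> \<le> \<rho>} = {\<lceil>x - \<rho>\<rceil>..\<lfloor>x + \<rho>\<rfloor>}"
    by (auto simp: abs_le_iff ceiling_le_iff le_floor_iff)
  show "finite {t::int. \<bar>of_int t - x\<bar> \<le> \<rho>}" unfolding eq by simp
  have "real (card {t::int. \<bar>of_int t - x\<bar> \<le> \<rho>}) = real (nat (\<lfloor>x + \<rho>\<rfloor> - \<lceil>x - \<rho>\<rceil> + 1))"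
    unfolding eq by simp
  moreover have "real (nat (\<lfloor>x + \<rho>\<rfloor> - \<lceil>x - \<rho>\<rceil> + 1)) = of_int (\<lfloor>x + \<rho>\<rfloor> - \<lceil>x - \<rho>\<rceil> + 1)"
    using assms by (subst of_nat_nat) linarith+
  ultimately show "real (card {t::int. \<bar>of_int t - x\<bar> \<le> \<rho>}) \<le> 2 * \<rho> + 1"
    "real (card {t::int. \<bar>of_int t - x\<bar> \<le> \<rho>}) \<ge> 2 * \<rho> - 1"
    by linarith+
qed

text \<open>The map $w \mapsto t = qa - bw$, with $a$ the integer nearest to $\beta w + \gamma$, turns the
  points counted in a block of length $q$ into the integers in an interval.\<close>

lemma card_block:
  fixes \<beta> \<gamma> \<eta> :: real and b :: int and q w\<^sub>0 :: nat
  assumes q: "q \<ge> 1" and co: "coprime b (int q)" and appr: "\<bar>real q * \<beta> - of_int b\<bar> \<le> 1 / real q"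
    and \<eta>: "0 \<le> \<eta>" "\<eta> \<le> 1/2"
  defines "S \<equiv> {w \<in> {w\<^sub>0<..w\<^sub>0 + q}. dist_nearest_int (\<beta> * real w + \<gamma>) \<le> \<eta>}"
  shows "\<bar>real (card S) - 2 * \<eta> * real q\<bar> \<le> 3"
proof -
  define \<epsilon> where "\<epsilon> = \<beta> - of_int b / real q"
  define c where "c = \<gamma> + \<epsilon> * real w\<^sub>0"
  have q0: "real q > 0" using q by simp
  have eps: "\<bar>\<epsilon> * real j\<bar> \<le> 1 / real q" if "j \<le> q" for j
  proof -
    have "\<bar>\<epsilon> * real j\<bar> = \<bar>\<epsilon>\<bar> * real j" by (simp add: abs_mult)
    also have "\<dots> \<le> \<bar>\<epsilon>\<bar> * real q" using that by (intro mult_left_mono) auto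
    also have "\<dots> = \<bar>\<epsilon> * real q\<bar>" by (simp add: abs_mult)
    also have "\<epsilon> * real q = real q * \<beta> - of_int b" unfolding \<epsilon>_def using q0 by (simp add: field_simps)
    finally show ?thesis using appr by linarith
  qed
  have key: "\<beta> * real w + \<gamma> - of_int a = c - of_int (int q * a - b * int w) / real q + \<epsilon> * real (w - w\<^sub>0)"
    if "w\<^sub>0 < w" for w a
    using that q0 unfolding c_def \<epsilon>_def by (simp add: field_simps of_nat_diff)
  have resid: "w = w'" if "w \<in> {w\<^sub>0<..w\<^sub>0 + q}" "w' \<in> {w\<^sub>0<..w\<^sub>0 + q}" "int q dvd b * (int w - int w')" for w w'
  proof -
    have "int q dvd int w - int w'" using that(3) co by (simp add: coprime_commute coprime_dvd_mult_right_iff)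
    moreover have "\<bar>int w - int w'\<bar> < int q" using that(1,2) by auto
    ultimately have "int w - int w' = 0" using dvd_imp_le_int[of "int w - int w'" "int q"] by fastforce
    then show ?thesis by simp
  qed
  define a where "a w = round (\<beta> * real w + \<gamma>)" for w :: nat
  define t where "t w = int q * a w - b * int w" for w :: nat
  have finS: "finite S" unfolding S_def by (rule finite_subset[of _ "{..w\<^sub>0 + q}"]) auto
  have "inj_on t S"
  proof (rule inj_onI)
    fix w w' assume "w \<in> S" "w' \<in> S" "t w = t w'"
    moreover from this have "b * (int w - int w') = int q * (a w - a w')"
      unfolding t_def by (simp add: algebra_simps)
    ultimately show "w = w'" by (intro resid) (auto simp: S_def)
  qed
  \<comment> \<open>Across one block the slope error \<epsilon> displaces a point by at most 1/q,
    hence the integer t by at most 1: this is the +1 in the radius here and the -1 in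
    \<open>T\<close> below.\<close>
  moreover have "t ` S \<subseteq> {t::int. \<bar>of_int t - real q * c\<bar> \<le> real q * \<eta> + 1}"
  proof
    fix s assume "s \<in> t ` S"
    then obtain w where w: "w \<in> S" "s = t w" by auto
    have "\<bar>\<beta> * real w + \<gamma> - of_int (a w)\<bar> \<le> \<eta>"
      using w(1) unfolding S_def dist_nearest_int_def a_def by simp
    then have "\<bar>c - of_int s / real q + \<epsilon> * real (w - w\<^sub>0)\<bar> \<le> \<eta>"
      using key[of w "a w"] w unfolding S_def t_def by simp
    moreover have "\<bar>\<epsilon> * real (w - w\<^sub>0)\<bar> \<le> 1 / real q" using w(1) by (intro eps) (auto simp: S_def)
    ultimately have "\<bar>c - of_int s / real q\<bar> \<le> \<eta> + 1 / real q" by linarith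
    then have "real q * \<bar>c - of_int s / real q\<bar> \<le> real q * (\<eta> + 1 / real q)"
      using q0 by (intro mult_left_mono) auto
    also have "real q * (\<eta> + 1 / real q) = real q * \<eta> + 1" using q0 by (simp add: algebra_simps)
    also have "real q * \<bar>c - of_int s / real q\<bar> = \<bar>real q * (c - of_int s / real q)\<bar>" by (simp add: abs_mult)
    also have "real q * (c - of_int s / real q) = real q * c - of_int s" using q0 by (simp add: algebra_simps)
    finally show "s \<in> {t::int. \<bar>of_int t - real q * c\<bar> \<le> real q * \<eta> + 1}" by (simp add: abs_minus_commute)
  qed
  moreover have pos: "0 \<le> real q * \<eta> + 1" using \<eta> by simp
  ultimately have "card S \<le> card {t::int. \<bar>of_int t - real q * c\<bar> \<le> real q * \<eta> + 1}"
    using card_ints_in_interval(1) by (intro card_inj_on_le)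
  then have up: "real (card S) \<le> 2 * \<eta> * real q + 3"
    using card_ints_in_interval(2)[OF pos, of "real q * c"] by (simp add: mult_ac)
  have "real (card S) \<ge> 2 * \<eta> * real q - 3"
  proof (cases "real q * \<eta> \<ge> 1")
    case False
    moreover have "2 * \<eta> * real q = 2 * (real q * \<eta>)" by simp
    ultimately have "2 * \<eta> * real q - 3 \<le> 0" by linarith
    then show ?thesis using of_nat_0_le_iff[of "card S"] by linarith
  next
    case True
    define T where "T = {t::int. \<bar>of_int t - real q * c\<bar> \<le> real q * \<eta> - 1}"
    have "\<exists>w. w \<in> S \<and> int q dvd s + b * int w" if s: "s \<in> T" for s
    proof -
      \<comment> \<open>For the converse, w is the solution of s + bw = 0 mod q lying in the block;
        starting from \<open>w\<^sub>0 + 1\<close> and adding a residue below q reaches each class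
        exactly once.\<close>
      obtain x where x: "[b * x = 1] (mod int q)" using cong_solve_coprime_int[OF co] by blast
      define w where "w = w\<^sub>0 + 1 + nat ((- s * x - int w\<^sub>0 - 1) mod int q)"
      have m: "0 \<le> (- s * x - int w\<^sub>0 - 1) mod int q" "(- s * x - int w\<^sub>0 - 1) mod int q < int q"
        using q by simp_all
      have w: "w\<^sub>0 < w" "w \<le> w\<^sub>0 + q" unfolding w_def using m by linarith+
      have "int w = int w\<^sub>0 + 1 + (- s * x - int w\<^sub>0 - 1) mod int q" unfolding w_def using m by simp
      then have "[int w = - s * x] (mod int q)" by (simp add: cong_def mod_simps)
      then have "[s + b * int w = s + b * (- s * x)] (mod int q)" by (intro cong_add cong_mult cong_refl)
      also have "s + b * (- s * x) = s - s * (b * x)" by (simp add: algebra_simps)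
      also have "[s - s * (b * x) = s - s * 1] (mod int q)" by (intro cong_diff cong_mult cong_refl x)
      finally have dv: "int q dvd s + b * int w" by (simp add: cong_0_iff)
      then obtain e where e: "s + b * int w = int q * e" by auto
      then have se: "s = int q * e - b * int w" by simp
      have "\<bar>of_int s - real q * c\<bar> \<le> real q * \<eta> - 1" using s by (simp add: T_def)
      then have "\<bar>of_int s - real q * c\<bar> / real q \<le> (real q * \<eta> - 1) / real q"
        using q0 by (intro divide_right_mono) auto
      also have "(real q * \<eta> - 1) / real q = \<eta> - 1 / real q" using q0 by (simp add: field_simps)
      also have "\<bar>of_int s - real q * c\<bar> / real q = \<bar>(of_int s - real q * c) / real q\<bar>" by simp
      also have "(of_int s - real q * c) / real q = - (c - of_int s / real q)" using q0 by (simp add: field_simps)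
      finally have "\<bar>c - of_int s / real q\<bar> \<le> \<eta> - 1 / real q" by simp
      moreover have "\<bar>\<epsilon> * real (w - w\<^sub>0)\<bar> \<le> 1 / real q" using w by (intro eps) auto
      ultimately have "\<bar>\<beta> * real w + \<gamma> - of_int e\<bar> \<le> \<eta>" 
        unfolding key[OF w(1), of e] se[symmetric] by linarith
      then have "w \<in> S" unfolding S_def dist_nearest_int_le_iff using w by auto
      then show ?thesis using dv by blast
    qed
    then obtain f where f: "\<And>s. s \<in> T \<Longrightarrow> f s \<in> S \<and> int q dvd s + b * int (f s)" by metis
    have "inj_on f T"
    proof (rule inj_onI)
      fix s s' assume s: "s \<in> T" "s' \<in> T" "f s = f s'"
      have "int q dvd (s + b * int (f s)) - (s' + b * int (f s'))" using f s(1,2) by (intro dvd_diff) auto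
      then have "int q dvd s - s'" using s(3) by simp
      \<comment> \<open>Since \<eta> \<le> 1/2, the interval defining \<open>T\<close> is shorter
        than q, so distinct s lie in distinct classes mod q.\<close>
      moreover have "\<bar>s - s'\<bar> < int q"
      proof -
        have "real q * \<eta> \<le> real q * (1/2)" using \<eta> by (intro mult_left_mono) auto
        then have "\<bar>real_of_int s - real_of_int s'\<bar> < real q" using s(1,2) unfolding T_def by auto
        then show ?thesis by linarith
      qed
      ultimately have "s - s' = 0" using dvd_imp_le_int[of "s - s'" "int q"] by fastforce
      then show "s = s'" by simp
    qed
    then have "card T \<le> card S" using f finS by (intro card_inj_on_le[of f]) auto
    then have "real (card T) \<le> real (card S)" by simp
    moreover have "2 * (real q * \<eta> - 1) - 1 \<le> real (card T)"
      unfolding T_def using True by (intro card_ints_in_interval(3)) simp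
    ultimately show ?thesis by (simp add: mult_ac)
  qed
  then show ?thesis using up by linarith
qed

text \<open>Monotonicity in L squeezes the count between those at consecutive multiples of q, where
  whole blocks are available.\<close>

lemma card_dist_nearest_int_le:
  fixes \<beta> \<gamma> \<eta> :: real and b :: int and q L :: nat
  assumes q: "q \<ge> 1" and co: "coprime b (int q)" and appr: "\<bar>real q * \<beta> - of_int b\<bar> \<le> 1 / real q"
    and \<eta>: "0 \<le> \<eta>" "\<eta> \<le> 1/2"
  shows "\<bar>real (card {w \<in> {1..L}. dist_nearest_int (\<beta> * real w + \<gamma>) \<le> \<eta>}) - 2 * \<eta> * real L\<bar>
     \<le> 3 * (real L / real q) + 2 * \<eta> * real q + 3"
proof -
  define n where "n L = card {w \<in> {1..L}. dist_nearest_int (\<beta> * real w + \<gamma>) \<le> \<eta>}" for L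
  have q0: "real q > 0" using q by simp
  have n_mono: "n L \<le> n L'" if "L \<le> L'" for L L'
    unfolding n_def using that by (intro card_mono) auto
  have blocks: "\<bar>real (n (k * q)) - 2 * \<eta> * (real k * real q)\<bar> \<le> 3 * real k" for k
  proof (induction k)
    case 0
    then show ?case by (simp add: n_def)
  next
    case (Suc k)
    have "n (Suc k * q) = n (k * q) + card {w \<in> {k * q<..k * q + q}. dist_nearest_int (\<beta> * real w + \<gamma>) \<le> \<eta>}"
      unfolding n_def by (subst card_Un_disjoint[symmetric]) (auto intro!: arg_cong[of _ _ card])
    moreover have "\<bar>real (card {w \<in> {k * q<..k * q + q}. dist_nearest_int (\<beta> * real w + \<gamma>) \<le> \<eta>}) - 2 * \<eta> * real q\<bar> \<le> 3"
      by (rule card_block[OF q co appr \<eta>])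
    moreover have "2 * \<eta> * (real (Suc k) * real q) = 2 * \<eta> * (real k * real q) + 2 * \<eta> * real q"
      by (simp add: algebra_simps)
    ultimately show ?case using Suc.IH by simp
  qed
  define k where "k = L div q"
  have "k * q \<le> L" unfolding k_def by simp
  moreover have "L \<le> (k + 1) * q" unfolding k_def using q dividend_less_div_times[of q L] by simp
  ultimately have nk: "n (k * q) \<le> n L" "n L \<le> n ((k + 1) * q)" using n_mono by auto
  have kq: "real k * real q \<le> real L" "real L \<le> real (k + 1) * real q"
    using \<open>k * q \<le> L\<close> \<open>L \<le> (k + 1) * q\<close> by (simp_all only: of_nat_mult[symmetric] of_nat_le_iff)
  have kL: "real k \<le> real L / real q" using kq(1) q0 by (simp add: field_simps)
  have "real (n L) \<le> real (n ((k + 1) * q))" "real (n (k * q)) \<le> real (n L)" using nk by simp_all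
  moreover have "2 * \<eta> * (real (k + 1) * real q) \<le> 2 * \<eta> * (real L + real q)"
    using kq(1) \<eta> by (intro mult_left_mono) (auto simp: algebra_simps)
  moreover have "2 * \<eta> * (real L - real q) \<le> 2 * \<eta> * (real k * real q)"
    using kq(2) \<eta> by (intro mult_left_mono) (auto simp: algebra_simps)
  ultimately have "\<bar>real (n L) - 2 * \<eta> * real L\<bar> \<le> 2 * \<eta> * real q + 3 * (real k + 1)"
    using blocks[of k] blocks[of "k + 1"] by (simp add: algebra_simps abs_le_iff)
  also have "\<dots> \<le> 3 * (real L / real q) + 2 * \<eta> * real q + 3" using kL by simp
  finally show ?thesis unfolding n_def .
qed

text \<open>Dirichlet's theorem with Q about 2^i N/Y gives a reduced h/q of a quality that the
  hypothesis forbids for q \<le> N/(2^i Y). So q lies between N/(2^i Y) and Q, and both L/q and q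
  X/N are of order at most 2^i Y, the latter because X = Y^2.\<close>

lemma card_dist_nearest_int_no_approx:
  fixes \<beta> \<gamma> X Y N :: real and L i :: nat
  assumes no: "\<And>(q::nat) (b::int). q \<ge> 1 \<Longrightarrow> real q \<le> N / (2 ^ i * Y) \<Longrightarrow> \<bar>\<beta> * real q - of_int b\<bar> > Y / (2 ^ i * N)"
    and Y: "Y \<ge> 1" "X = Y\<^sup>2" and N: "N \<ge> 1" "2 * X \<le> N" "real L \<le> N"
  shows "\<bar>real (card {w \<in> {1..L}. dist_nearest_int (\<beta> * real w + \<gamma>) \<le> X / N}) - 2 * (X / N) * real L\<bar>
    \<le> 9 * (2 ^ i * Y)"
proof -
  define Q where "Q = nat \<lceil>2 ^ i * N / Y\<rceil>"
  have pos: "2 ^ i * N / Y > 0" using N Y by simp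
  have Q: "2 ^ i * N / Y \<le> real Q" "real Q \<le> 2 ^ i * N / Y + 1" unfolding Q_def using pos by linarith+
  have Q0: "Q > 0" using Q(1) pos by (metis less_le_trans of_nat_0_less_iff)
  obtain h k where hk: "coprime h k" "0 < k" "k \<le> int Q" "\<bar>of_int k * \<beta> - of_int h\<bar> < 1 / real Q"
    using Dirichlet_approx_coprime[OF Q0] by metis
  define q where "q = nat k"
  have qk: "int q = k" "real q = of_int k" using hk(2) by (simp_all add: q_def)
  have q: "q \<ge> 1" using hk(2) by (simp add: q_def)
  have qQ: "real q \<le> real Q" using hk(3) qk by linarith
  have Y0: "Y > 0" and q0: "real q > 0" using Y q by simp_all
  have "1 / real Q \<le> 1 / (2 ^ i * N / Y)" using Q(1) pos Q0 by (intro divide_left_mono mult_pos_pos) simp_all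
  then have "\<bar>\<beta> * real q - of_int h\<bar> \<le> Y / (2 ^ i * N)" using hk(4) qk by (simp add: mult.commute)
  then have qbig: "real q > N / (2 ^ i * Y)" using no[OF q, of h] by linarith
  have "1 / real Q \<le> 1 / real q" using qQ q0 Q0 by (intro divide_left_mono) auto
  then have appr: "\<bar>real q * \<beta> - of_int h\<bar> \<le> 1 / real q" using hk(4) qk by simp
  have \<eta>: "0 \<le> X / N" "X / N \<le> 1/2" using N Y by (simp_all add: field_simps)
  have i1: "(2::real) ^ i * Y \<ge> 1" using Y mult_mono[of 1 "2 ^ i" 1 Y] by simp
  have "\<bar>real (card {w \<in> {1..L}. dist_nearest_int (\<beta> * real w + \<gamma>) \<le> X / N}) - 2 * (X / N) * real L\<bar>
     \<le> 3 * (real L / real q) + 2 * (X / N) * real q + 3"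
    by (rule card_dist_nearest_int_le[OF q _ appr \<eta>]) (use hk(1) qk(1) in simp)
  also have "real L / real q \<le> 2 ^ i * Y"
  proof -
    have "N < 2 ^ i * Y * real q" using qbig Y0 by (simp add: field_simps)
    then have "real L \<le> 2 ^ i * Y * real q" using N(3) by linarith
    then show ?thesis using q0 by (simp add: field_simps)
  qed
  also have "2 * (X / N) * real q \<le> 2 * (X / N) * (2 ^ i * N / Y + 1)"
    using qQ Q(2) \<eta> by (intro mult_left_mono) auto
  also have "\<dots> = 2 * (2 ^ i * Y) + 2 * (X / N)"
    using Y N by (simp add: field_simps power2_eq_square)
  finally have "\<bar>real (card {w \<in> {1..L}. dist_nearest_int (\<beta> * real w + \<gamma>) \<le> X / N}) - 2 * (X / N) * real L\<bar>
     \<le> 3 * (2 ^ i * Y) + (2 * (2 ^ i * Y) + 2 * (X / N)) + 3" by simp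
  \<comment> \<open>Here 2X/N \<le> 1 \<le> 2^i Y, and 3 + 2 + 1 + 3 = 9.\<close>
  then show ?thesis using \<eta>(2) i1 by linarith
qed

section \<open>Pair correlation\<close>


text \<open>The exceptional differences at level i: with \<theta> = 2\<alpha>, any other u has a
  count over w whose error is at most 9 * 2^i * Y.\<close>

definition well_approx :: "real \<Rightarrow> nat \<Rightarrow> real \<Rightarrow> nat \<Rightarrow> nat set" where
  "well_approx \<theta> N Y i = {u \<in> {1..N}. \<exists>(q::nat) (b::int). q \<ge> 1 \<and> real q \<le> real N / (2 ^ i * Y) \<and>
      \<bar>\<theta> * real u * real q - of_int b\<bar> \<le> Y / (2 ^ i * real N)}"

text \<open>Common factors are removed twice. Cancelling gcd(b, q) only shortens q, and the gain in
  tolerance is given away. Cancelling g, the common divisor of u and the new numerator, shrinks both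
  the range of u and the tolerance by g. The remaining numerator is coprime to both entries, and u
  is recovered as g times the first entry.\<close>

lemma card_well_approx_le:
  assumes N: "N \<ge> 1" and Y: "Y > 0"
  shows "card (well_approx \<theta> N Y i)
    \<le> (\<Sum>g = 1..N. card (approx_pairs \<theta> (Y / (real g * 2 ^ i * real N)) (N div g) (nat \<lfloor>real N / (2 ^ i * Y)\<rfloor>)))"
proof -
  define P where "P g = approx_pairs \<theta> (Y / (real g * 2 ^ i * real N)) (N div g) (nat \<lfloor>real N / (2 ^ i * Y)\<rfloor>)" for g
  have "well_approx \<theta> N Y i \<subseteq> (\<Union>g\<in>{1..N}. (\<lambda>(u, q). g * u) ` P g)"
  proof
    fix u assume "u \<in> well_approx \<theta> N Y i"
    then obtain q :: nat and b :: int where u: "1 \<le> u" "u \<le> N" and q: "q \<ge> 1" "real q \<le> real N / (2 ^ i * Y)"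
      and b: "\<bar>\<theta> * real u * real q - of_int b\<bar> \<le> Y / (2 ^ i * real N)"
      unfolding well_approx_def by auto
    define d where "d = nat (gcd b (int q))"
    have d: "int d = gcd b (int q)" unfolding d_def by simp
    have "gcd b (int q) \<noteq> 0" using q by simp
    then have d0: "d > 0" using d by (metis gr0I of_nat_0)
    obtain b1 q1' where "b = b1 * gcd b (int q)" "int q = q1' * gcd b (int q)" and co1: "coprime b1 q1'"
      using gcd_coprime_exists[OF \<open>gcd b (int q) \<noteq> 0\<close>] by blast
    then have b1: "b = int d * b1" and q1': "int q = int d * q1'"
      unfolding d by (simp_all only: mult.commute)
    define q1 where "q1 = nat q1'"
    have "int d * q1' > 0" using q q1' by linarith
    then have "q1' > 0" using d0 by (simp add: zero_less_mult_iff)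
    then have q1: "int q1 = q1'" "q1 \<ge> 1" unfolding q1_def by simp_all
    have "int q = int (d * q1)" unfolding of_nat_mult q1(1) by (rule q1')
    then have qq: "q = d * q1" by (simp only: of_nat_eq_iff)
    have "real q1 \<le> real q" unfolding qq using d0 by (simp add: mult_le_cancel_right1)
    then have q1V: "real q1 \<le> real N / (2 ^ i * Y)" using q(2) by linarith
    have b1_le: "\<bar>\<theta> * real u * real q1 - of_int b1\<bar> \<le> Y / (2 ^ i * real N)"
    proof -
      have "\<theta> * real u * real q - of_int b = real d * (\<theta> * real u * real q1 - of_int b1)"
        unfolding qq b1 by (simp add: algebra_simps)
      then have e: "\<bar>\<theta> * real u * real q - of_int b\<bar> = real d * \<bar>\<theta> * real u * real q1 - of_int b1\<bar>"
        by (simp only: abs_mult abs_of_nat)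
      have "1 * \<bar>\<theta> * real u * real q1 - of_int b1\<bar> \<le> real d * \<bar>\<theta> * real u * real q1 - of_int b1\<bar>"
        using d0 by (intro mult_right_mono) auto
      also note e[symmetric]
      also note b
      finally show ?thesis by simp
    qed
    define g where "g = nat (gcd b1 (int u))"
    have g: "int g = gcd b1 (int u)" unfolding g_def by simp
    have "gcd b1 (int u) \<noteq> 0" using u by simp
    then have g0: "g > 0" using g by (metis gr0I of_nat_0)
    obtain b0 u0' where "b1 = b0 * gcd b1 (int u)" "int u = u0' * gcd b1 (int u)" and co0: "coprime b0 u0'"
      using gcd_coprime_exists[OF \<open>gcd b1 (int u) \<noteq> 0\<close>] by blast
    then have b0: "b1 = int g * b0" and u0': "int u = int g * u0'"
      unfolding g by (simp_all only: mult.commute)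
    define u0 where "u0 = nat u0'"
    have "int g * u0' > 0" using u u0' by linarith
    then have "u0' > 0" using g0 by (simp add: zero_less_mult_iff)
    then have u0: "int u0 = u0'" "u0 \<ge> 1" unfolding u0_def by simp_all
    have "int u = int (g * u0)" unfolding of_nat_mult u0(1) by (rule u0')
    then have uu: "u = g * u0" by (simp only: of_nat_eq_iff)
    have "g * 1 \<le> g * u0" using u0(2) by (rule mult_le_mono2)
    also have "\<dots> \<le> N" using u(2) unfolding uu .
    finally have gN: "g \<le> N" by simp
    have "coprime b0 (int q1)" using co1 q1(1) b0 by (simp add: coprime_mult_left_iff)
    then have co: "coprime b0 (int (u0 * q1))" using co0 u0(1) by simp
    have b0_le: "\<bar>\<theta> * real (u0 * q1) - of_int b0\<bar> \<le> Y / (real g * 2 ^ i * real N)"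
    proof -
      have "\<theta> * real u * real q1 - of_int b1 = real g * (\<theta> * real (u0 * q1) - of_int b0)"
        unfolding uu b0 by (simp add: algebra_simps)
      then have "\<bar>\<theta> * real u * real q1 - of_int b1\<bar> = real g * \<bar>\<theta> * real (u0 * q1) - of_int b0\<bar>"
        by (simp only: abs_mult abs_of_nat)
      then have "real g * \<bar>\<theta> * real (u0 * q1) - of_int b0\<bar> \<le> Y / (2 ^ i * real N)"
        using b1_le by simp
      then have "\<bar>\<theta> * real (u0 * q1) - of_int b0\<bar> \<le> Y / (2 ^ i * real N) / real g"
        using g0 by (subst pos_le_divide_eq) (simp_all only: mult.commute of_nat_0_less_iff)
      then show ?thesis by (simp add: mult_ac)
    qed
    have "u0 \<le> N div g" using u uu g0 by (simp add: less_eq_div_iff_mult_less_eq mult.commute)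
    moreover have "q1 \<le> nat \<lfloor>real N / (2 ^ i * Y)\<rfloor>" using q1V by (rule le_nat_floor)
    moreover have "u0 * q1 \<ge> 1" using u0(2) q1(2) mult_le_mono[of 1 u0 1 q1] by simp
    ultimately have "(u0, q1) \<in> P g"
      unfolding P_def approx_pairs_def reduced_approx_def using u0(2) q1(2) co b0_le by blast
    then show "u \<in> (\<Union>g\<in>{1..N}. (\<lambda>(u, q). g * u) ` P g)"
      using gN g0 uu by (intro UN_I[of g] image_eqI[where x = "(u0, q1)"]) simp_all
  qed
  then have "card (well_approx \<theta> N Y i) \<le> card (\<Union>g\<in>{1..N}. (\<lambda>(u, q). g * u) ` P g)"
    by (intro card_mono finite_UN_I finite_imageI) (auto simp: P_def finite_approx_pairs)
  also have "\<dots> \<le> (\<Sum>g = 1..N. card ((\<lambda>(u, q). g * u) ` P g))" by (rule card_UN_le) simp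
  also have "\<dots> \<le> (\<Sum>g = 1..N. card (P g))"
    by (intro sum_mono card_image_le) (simp add: P_def finite_approx_pairs)
  finally show ?thesis unfolding P_def .
qed

text \<open>The exponent 9/8 > 1 is used twice: the sum of g^(-9/8) converges, and 2^i *
  (2^i)^(-9/8) = 2^(-i/8) leaves a geometric series, so neither summation costs a logarithm.\<close>

lemma sum_card_well_approx_le:
  "\<exists>C > 0. \<exists>N\<^sub>0::nat. \<forall>\<theta> \<kappa> (N::nat) Y I.
     N \<ge> N\<^sub>0 \<longrightarrow> Y \<ge> 1 \<longrightarrow> Y\<^sup>2 \<le> ln (real N) \<longrightarrow> (\<forall>i<I. 2 ^ i \<le> N) \<longrightarrow> \<kappa> > 0 \<longrightarrow>
     (\<forall>(k::nat) (b::int). k \<ge> 1 \<longrightarrow> \<bar>\<theta> * real k - of_int b\<bar> \<ge> (2 * real k) powr (-5/4) / \<kappa>) \<longrightarrow>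
     (\<Sum>i<I. 2 ^ i * real (card (well_approx \<theta> N Y i))) \<le> C * (real N + sqrt \<kappa> * real N powr (19/20))"
proof -
  obtain C N\<^sub>0 where C: "C > 0" "\<And>\<theta> \<kappa> (N::nat) Y (g::nat) (i::nat).
     N \<ge> N\<^sub>0 \<Longrightarrow> Y \<ge> 1 \<Longrightarrow> Y\<^sup>2 \<le> ln (real N) \<Longrightarrow> 1 \<le> g \<Longrightarrow> g \<le> N \<Longrightarrow> 2 ^ i \<le> N \<Longrightarrow> \<kappa> > 0 \<Longrightarrow>
     (\<forall>(k::nat) (b::int). k \<ge> 1 \<longrightarrow> \<bar>\<theta> * real k - of_int b\<bar> \<ge> (2 * real k) powr (-5/4) / \<kappa>) \<Longrightarrow>
     real (card (approx_pairs \<theta> (Y / (real g * 2 ^ i * real N)) (N div g) (nat \<lfloor>real N / (2 ^ i * Y)\<rfloor>)))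
       \<le> C * (real N + sqrt \<kappa> * real N powr (19/20)) * (real g * 2 ^ i) powr (-9/8)"
    using card_approx_pairs_uniform by metis
  define S1 where "S1 = (\<Sum>g::nat. real g powr (-9/8))"
  define \<rho> :: real where "\<rho> = 2 powr (-1/8)"
  define S2 where "S2 = (\<Sum>i::nat. \<rho> ^ i)"
  have sm1: "summable (\<lambda>g::nat. real g powr (-9/8))" by (simp add: summable_real_powr_iff)
  have "\<rho> < 2 powr 0" unfolding \<rho>_def by (intro powr_less_mono) auto
  then have \<rho>: "0 < \<rho>" "\<rho> < 1" by (simp_all add: \<rho>_def)
  then have sm2: "summable (\<lambda>i::nat. \<rho> ^ i)" by (intro summable_geometric) simp
  have S1: "(\<Sum>g = 1..n. real g powr (-9/8)) \<le> S1" for n :: nat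
    unfolding S1_def by (rule sum_le_suminf[OF sm1]) auto
  have S2: "(\<Sum>i<I. \<rho> ^ i) \<le> S2" for I
    unfolding S2_def by (rule sum_le_suminf[OF sm2]) (use \<rho> in auto)
  have S10: "S1 \<ge> 0" using S1[of 0] by simp
  have S20: "S2 \<ge> 0" using S2[of 0] by simp
  have "(\<Sum>i<I. 2 ^ i * real (card (well_approx \<theta> N Y i))) \<le> (C * S1 * S2 + 1) * (real N + sqrt \<kappa> * real N powr (19/20))"
    if h: "N \<ge> max 1 N\<^sub>0" "Y \<ge> 1" "Y\<^sup>2 \<le> ln (real N)" "\<forall>i<I. 2 ^ i \<le> N" "\<kappa> > 0"
      and dioph: "\<forall>(k::nat) (b::int). k \<ge> 1 \<longrightarrow> \<bar>\<theta> * real k - of_int b\<bar> \<ge> (2 * real k) powr (-5/4) / \<kappa>"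
    for \<theta> \<kappa> N Y I
  proof -
    let ?M = "real N + sqrt \<kappa> * real N powr (19/20)"
    have M: "?M \<ge> 0" using h(5) by simp
    have "(\<Sum>i<I. 2 ^ i * real (card (well_approx \<theta> N Y i))) \<le> (\<Sum>i<I. C * ?M * S1 * \<rho> ^ i)"
    proof (rule sum_mono)
      fix i assume "i \<in> {..<I}"
      then have iN: "2 ^ i \<le> N" using h(4) by auto
      let ?P = "\<lambda>g. approx_pairs \<theta> (Y / (real g * 2 ^ i * real N)) (N div g) (nat \<lfloor>real N / (2 ^ i * Y)\<rfloor>)"
      have "card (well_approx \<theta> N Y i) \<le> (\<Sum>g = 1..N. card (?P g))"
        by (rule card_well_approx_le) (use h in auto)
      then have "real (card (well_approx \<theta> N Y i)) \<le> real (\<Sum>g = 1..N. card (?P g))" by (rule of_nat_mono)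
      also have "\<dots> = (\<Sum>g = 1..N. real (card (?P g)))" by (rule of_nat_sum)
      also have "\<dots> \<le> (\<Sum>g = 1..N. C * ?M * (real g * 2 ^ i) powr (-9/8))"
        by (intro sum_mono C(2)) (use h iN dioph in auto)
      also have "\<dots> = C * ?M * (2 ^ i) powr (-9/8) * (\<Sum>g = 1..N. real g powr (-9/8))"
        unfolding sum_distrib_left by (intro sum.cong refl) (simp add: powr_mult)
      also have "\<dots> \<le> C * ?M * (2 ^ i) powr (-9/8) * S1"
        using C(1) M by (intro mult_left_mono S1 mult_nonneg_nonneg) auto
      finally have "2 ^ i * real (card (well_approx \<theta> N Y i)) \<le> 2 ^ i * (C * ?M * (2 ^ i) powr (-9/8) * S1)"
        by (intro mult_left_mono) auto
      also have "\<dots> = C * ?M * S1 * (2 ^ i * (2 ^ i) powr (-9/8))" by (simp only: mult_ac)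
      also have "2 ^ i * (2 ^ i) powr (-9/8) = \<rho> ^ i"
      proof -
        have "(2::real) ^ i * (2 ^ i) powr (-9/8) = 2 powr real i * 2 powr (real i * (-9/8))"
          by (simp add: powr_powr flip: powr_realpow)
        also have "\<dots> = 2 powr (real i + real i * (-9/8))" by (rule powr_add[symmetric])
        also have "real i + real i * (-9/8) = (-1/8) * real i" by simp
        also have "2 powr ((-1/8) * real i) = \<rho> ^ i" unfolding \<rho>_def by (simp add: powr_power)
        finally show ?thesis .
      qed
      finally show "2 ^ i * real (card (well_approx \<theta> N Y i)) \<le> C * ?M * S1 * \<rho> ^ i" .
    qed
    also have "\<dots> = C * ?M * S1 * (\<Sum>i<I. \<rho> ^ i)" by (simp add: sum_distrib_left)
    also have "\<dots> \<le> C * ?M * S1 * S2"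
      using C(1) M S10 by (intro mult_left_mono S2 mult_nonneg_nonneg) auto
    also have "\<dots> \<le> (C * S1 * S2 + 1) * ?M" using M by (simp add: algebra_simps)
    finally show ?thesis .
  qed
  moreover have "C * S1 * S2 + 1 > 0" using C(1) S10 S20 by (simp add: add_nonneg_pos)
  ultimately show ?thesis by blast
qed

text \<open>Take the first level j where P fails: 2^j is 1 plus the sum of all 2^i with i < j, and P
  holds at each of those levels. The error 2^j for one u is thereby charged to its exceptional
  levels, and summing over u produces the weighted cardinalities of the exceptional sets.\<close>

lemma ex_level_le:
  assumes "\<not> P I"
  shows "\<exists>j::nat. \<not> P j \<and> 2 ^ j \<le> 1 + (\<Sum>i | i < I \<and> P i. (2::real) ^ i)"
proof -
  define j where "j = (LEAST j. \<not> P j)"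
  have j: "\<not> P j" unfolding j_def by (rule LeastI[of "\<lambda>j. \<not> P j", OF assms])
  have j_le: "j \<le> I" unfolding j_def by (rule Least_le) (rule assms)
  have Pj: "P i" if "i < j" for i
    using not_less_Least[of i "\<lambda>j. \<not> P j"] that unfolding j_def by blast
  have "(2::real) ^ n = 1 + (\<Sum>i<n. 2 ^ i)" for n by (induction n) auto
  then have "(2::real) ^ j = 1 + (\<Sum>i<j. 2 ^ i)" .
  also have "(\<Sum>i<j. (2::real) ^ i) \<le> (\<Sum>i | i < I \<and> P i. 2 ^ i)"
  proof (rule sum_mono2)
    show "{..<j} \<subseteq> {i. i < I \<and> P i}" using Pj j_le by (auto intro: less_le_trans)
  qed auto
  finally show ?thesis using j by (intro exI[of _ j]) simp
qed

text \<open>With n = m + u the difference of squares is linear in m for fixed u; its sign is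
  immaterial because the distance to the nearest integer is an even function.\<close>

lemma pair_corr_eq_sum:
  "pair_corr \<alpha> N X * real N = (\<Sum>u = 1..N. real (card {w \<in> {1..N - u}.
      dist_nearest_int ((2 * \<alpha> * real u) * real w + \<alpha> * (real u)\<^sup>2) \<le> X / real N}))"
proof (cases "N = 0")
  case False
  let ?T = "{(m::nat, n::nat). 1 \<le> m \<and> m < n \<and> n \<le> N \<and>
              dist_nearest_int (\<alpha> * ((real m)\<^sup>2 - (real n)\<^sup>2)) \<le> X / real N}"
  let ?W = "\<lambda>u. {w \<in> {1..N - u}. dist_nearest_int ((2 * \<alpha> * real u) * real w + \<alpha> * (real u)\<^sup>2) \<le> X / real N}"
  have neg: "dist_nearest_int (- t) \<le> \<eta> \<longleftrightarrow> dist_nearest_int t \<le> \<eta>" for t \<eta>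
  proof -
    have "dist_nearest_int (- t) \<le> \<eta>" if "dist_nearest_int t \<le> \<eta>" for t
    proof -
      obtain a :: int where "\<bar>t - of_int a\<bar> \<le> \<eta>" using \<open>dist_nearest_int t \<le> \<eta>\<close> dist_nearest_int_le_iff by blast
      then have "\<bar>- t - of_int (- a)\<bar> \<le> \<eta>" by simp
      then show ?thesis using dist_nearest_int_le_iff by blast
    qed
    from this[of t] this[of "- t"] show ?thesis by auto
  qed
  have eq: "dist_nearest_int (\<alpha> * ((real m)\<^sup>2 - (real (m + u))\<^sup>2)) \<le> \<eta>
      \<longleftrightarrow> dist_nearest_int ((2 * \<alpha> * real u) * real m + \<alpha> * (real u)\<^sup>2) \<le> \<eta>" for m u :: nat and \<eta>
  proof -
    have "\<alpha> * ((real m)\<^sup>2 - (real (m + u))\<^sup>2) = - ((2 * \<alpha> * real u) * real m + \<alpha> * (real u)\<^sup>2)"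
      by (simp add: power2_eq_square algebra_simps)
    then show ?thesis by (simp only: neg)
  qed
  have "card ?T = card (SIGMA u:{1..N}. ?W u)"
  proof (rule bij_betw_same_card[of "\<lambda>(m, n). (n - m, m)"], rule bij_betw_byWitness[where f' = "\<lambda>(u, m). (m, m + u)"])
    show "(\<lambda>(m, n). (n - m, m)) ` ?T \<subseteq> (SIGMA u:{1..N}. ?W u)"
    proof (rule image_subsetI)
      fix z assume "z \<in> ?T"
      then obtain m n where z: "z = (m, n)" and h: "1 \<le> m" "m < n" "n \<le> N" "dist_nearest_int (\<alpha> * ((real m)\<^sup>2 - (real n)\<^sup>2)) \<le> X / real N"
        by auto
      define u where "u = n - m"
      have n: "n = m + u" using h(2) by (simp add: u_def)
      have "dist_nearest_int (2 * \<alpha> * real u * real m + \<alpha> * (real u)\<^sup>2) \<le> X / real N"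
        using h(4) eq[of m u] unfolding n by blast
      then show "(\<lambda>(m, n). (n - m, m)) z \<in> (SIGMA u:{1..N}. ?W u)"
        using h(1-3) unfolding z n by auto
    qed
    show "(\<lambda>(u, m). (m, m + u)) ` (SIGMA u:{1..N}. ?W u) \<subseteq> ?T"
    proof (rule image_subsetI)
      fix z assume "z \<in> (SIGMA u:{1..N}. ?W u)"
      then obtain u m where z: "z = (u, m)" and h: "u \<in> {1..N}" "m \<in> {1..N - u}"
        "dist_nearest_int ((2 * \<alpha> * real u) * real m + \<alpha> * (real u)\<^sup>2) \<le> X / real N"
        by auto
      have "dist_nearest_int (\<alpha> * ((real m)\<^sup>2 - (real (m + u))\<^sup>2)) \<le> X / real N"
        using h(3) eq[of m u] by blast
      then show "(\<lambda>(u, m). (m, m + u)) z \<in> ?T" using h(1,2) unfolding z by auto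
    qed
  qed auto
  also have "\<dots> = (\<Sum>u = 1..N. card (?W u))" by (subst card_SigmaI) auto
  finally show ?thesis unfolding pair_corr_def using False by simp
qed (simp add: pair_corr_def)

lemma pair_corr_error_le:
  assumes X: "1 \<le> X" and N: "N \<ge> 1" "2 * X \<le> real N" and I: "2 ^ I > N"
  shows "\<bar>pair_corr \<alpha> N X * real N - X * (real N - 1)\<bar>
    \<le> 9 * sqrt X * (real N + (\<Sum>i<I. 2 ^ i * real (card (well_approx (2 * \<alpha>) N (sqrt X) i))))"
proof -
  define Y where "Y = sqrt X"
  have Y: "Y \<ge> 1" "X = Y\<^sup>2" unfolding Y_def using X by simp_all
  let ?B = "well_approx (2 * \<alpha>) N Y"
  let ?W = "\<lambda>u. real (card {w \<in> {1..N - u}. dist_nearest_int ((2 * \<alpha> * real u) * real w + \<alpha> * (real u)\<^sup>2) \<le> X / real N})"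
  \<comment> \<open>At level I the upper bound for q drops below 1, so nothing is exceptional and
    the search for a level succeeds for every u.\<close>
  have notI: "u \<notin> ?B I" for u
  proof
    assume "u \<in> ?B I"
    then obtain q :: nat where q: "q \<ge> 1" "real q \<le> real N / (2 ^ I * Y)" unfolding well_approx_def by auto
    have "real N < 2 ^ I" using I by (metis of_nat_less_iff of_nat_numeral of_nat_power)
    also have "2 ^ I * 1 \<le> 2 ^ I * Y" using Y by (intro mult_left_mono) auto
    finally have "real N / (2 ^ I * Y) < 1" using Y by (simp add: field_simps)
    then show False using q by simp
  qed
  have each: "\<bar>?W u - 2 * (X / real N) * real (N - u)\<bar> \<le> 9 * Y * (1 + (\<Sum>i | i < I \<and> u \<in> ?B i. 2 ^ i))"
    if u: "u \<in> {1..N}" for u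
  proof -
    obtain j where j: "u \<notin> ?B j" "(2::real) ^ j \<le> 1 + (\<Sum>i | i < I \<and> u \<in> ?B i. 2 ^ i)"
      using ex_level_le[of "\<lambda>i. u \<in> ?B i" I] notI by blast
    have "\<bar>?W u - 2 * (X / real N) * real (N - u)\<bar> \<le> 9 * (2 ^ j * Y)"
    proof (rule card_dist_nearest_int_no_approx)
      fix q :: nat and b :: int assume q: "q \<ge> 1" "real q \<le> real N / (2 ^ j * Y)"
      show "Y / (2 ^ j * real N) < \<bar>2 * \<alpha> * real u * real q - of_int b\<bar>"
      proof (rule ccontr)
        assume "\<not> ?thesis"
        then have "\<bar>2 * \<alpha> * real u * real q - of_int b\<bar> \<le> Y / (2 ^ j * real N)" by simp
        then have "u \<in> ?B j" unfolding well_approx_def using u q by blast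
        then show False using j(1) by blast
      qed
    qed (use Y N in auto)
    also have "\<dots> = 9 * Y * 2 ^ j" by simp
    also have "\<dots> \<le> 9 * Y * (1 + (\<Sum>i | i < I \<and> u \<in> ?B i. 2 ^ i))" using j(2) Y by (intro mult_left_mono) auto
    finally show ?thesis .
  qed
  have main: "(\<Sum>u = 1..N. 2 * (X / real N) * real (N - u)) = X * (real N - 1)"
  proof -
    have "(\<Sum>u = 1..N. real (N - u)) = (\<Sum>u<N. real u)"
      by (rule sum.reindex_bij_witness[of _ "\<lambda>u. N - u" "\<lambda>u. N - u"]) auto
    also have "\<dots> = real N * (real N - 1) / 2" by (induction N) (auto simp: field_simps)
    finally have "(\<Sum>u = 1..N. real (N - u)) = real N * (real N - 1) / 2" .
    then have "(\<Sum>u = 1..N. 2 * (X / real N) * real (N - u)) = 2 * (X / real N) * (real N * (real N - 1) / 2)"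
      by (simp only: sum_distrib_left[symmetric])
    then show ?thesis using N by simp
  qed
  have "\<bar>pair_corr \<alpha> N X * real N - X * (real N - 1)\<bar> = \<bar>\<Sum>u = 1..N. ?W u - 2 * (X / real N) * real (N - u)\<bar>"
    unfolding pair_corr_eq_sum main[symmetric] sum_subtractf ..
  also have "\<dots> \<le> (\<Sum>u = 1..N. \<bar>?W u - 2 * (X / real N) * real (N - u)\<bar>)" by (rule sum_abs)
  also have "\<dots> \<le> (\<Sum>u = 1..N. 9 * Y * (1 + (\<Sum>i | i < I \<and> u \<in> ?B i. 2 ^ i)))" by (intro sum_mono each)
  also have "\<dots> = 9 * Y * (real N + (\<Sum>u = 1..N. \<Sum>i | i < I \<and> u \<in> ?B i. 2 ^ i))"
    by (simp only: sum_distrib_left[symmetric] sum.distrib) simp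
  also have "(\<Sum>u = 1..N. \<Sum>i | i < I \<and> u \<in> ?B i. (2::real) ^ i) = (\<Sum>i<I. \<Sum>u\<in>{u \<in> {1..N}. u \<in> ?B i}. 2 ^ i)"
    using sum.swap_restrict[of "{1..N}" "{..<I}" "\<lambda>u i. (2::real) ^ i" "\<lambda>u i. u \<in> ?B i"] by simp
  also have "\<dots> = (\<Sum>i<I. 2 ^ i * real (card (?B i)))"
  proof (rule sum.cong[OF refl])
    fix i
    have "{u \<in> {1..N}. u \<in> ?B i} = ?B i" by (auto simp: well_approx_def)
    then show "(\<Sum>u\<in>{u \<in> {1..N}. u \<in> ?B i}. (2::real) ^ i) = 2 ^ i * real (card (?B i))" by simp
  qed
  finally show ?thesis unfolding Y_def .
qed

text \<open>The trivial bound, for the finitely many N below the asymptotic threshold.\<close>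

lemma pair_corr_le: "N \<ge> 1 \<Longrightarrow> 0 \<le> pair_corr \<alpha> N X \<and> pair_corr \<alpha> N X \<le> real N"
proof -
  assume N: "N \<ge> 1"
  let ?T = "{(m::nat, n::nat). 1 \<le> m \<and> m < n \<and> n \<le> N \<and>
              dist_nearest_int (\<alpha> * ((real m)\<^sup>2 - (real n)\<^sup>2)) \<le> X / real N}"
  have "card ?T \<le> card ({1..N} \<times> {1..N})" by (rule card_mono) auto
  then have "card ?T \<le> N * N" by (simp add: card_cartesian_product)
  then have "real (card ?T) \<le> real (N * N)" by (rule of_nat_mono)
  then have "real (card ?T) \<le> real N * real N" by (simp only: of_nat_mult)
  then show ?thesis unfolding pair_corr_def using N by (simp add: pos_divide_le_eq)
qed

theorem theorem2:
  shows "\<exists>C\<^sub>1 > 0. \<exists>C\<^sub>2 > 0. \<forall>(\<alpha>::real) (\<kappa>::real).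
    \<kappa> > 1 \<longrightarrow>
    (\<forall>(a::int) (q::nat). q \<ge> 1 \<longrightarrow>
       \<bar>\<alpha> - real_of_int a / real q\<bar> \<ge> 1 / (\<kappa> * real q powr (9/4))) \<longrightarrow>
    (\<forall>(N::nat) (X::real). N \<ge> 1 \<longrightarrow> 1 \<le> X \<longrightarrow> X \<le> ln (real N) \<longrightarrow>
       \<bar>pair_corr \<alpha> N X - X\<bar> \<le> C\<^sub>1 * X powr (7/8) + C\<^sub>2 * (\<kappa>\<^sup>2 / ln (real N)))"
proof -
  from sum_card_well_approx_le obtain C N\<^sub>0 where C: "C > 0" "\<forall>\<theta> \<kappa> (N::nat) Y I.
     N \<ge> N\<^sub>0 \<longrightarrow> Y \<ge> 1 \<longrightarrow> Y\<^sup>2 \<le> ln (real N) \<longrightarrow> (\<forall>i<I. 2 ^ i \<le> N) \<longrightarrow> \<kappa> > 0 \<longrightarrow>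
     (\<forall>(k::nat) (b::int). k \<ge> 1 \<longrightarrow> \<bar>\<theta> * real k - of_int b\<bar> \<ge> (2 * real k) powr (-5/4) / \<kappa>) \<longrightarrow>
     (\<Sum>i<I. 2 ^ i * real (card (well_approx \<theta> N Y i))) \<le> C * (real N + sqrt \<kappa> * real N powr (19/20))"
    by (elim exE conjE)
  \<comment> \<open>The first condition makes X/N at most 1/2, as the count over residue classes
    requires; the second converts the power saving N^(-1/20) into 1/log N.\<close>
  have "eventually (\<lambda>x::real. 2 * ln x \<le> x \<and> sqrt (ln x) * x powr (-1/20) \<le> 1 / ln x) at_top"
    by (intro eventually_conj) real_asymp+
  then obtain B where B: "\<And>x::real. x \<ge> B \<Longrightarrow> 2 * ln x \<le> x \<and> sqrt (ln x) * x powr (-1/20) \<le> 1 / ln x"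
    by (auto simp: eventually_at_top_linorder)
  define N1 where "N1 = max N\<^sub>0 (nat \<lceil>B\<rceil>)"
  \<comment> \<open>9 (1 + C) comes from the error estimate, 1 from the term X/N, and 2
    \<open>N1\<close> from the trivial bound below the threshold.\<close>
  define C1 where "C1 = 10 + 9 * C + 2 * real N1"
  define C2 where "C2 = 9 * C"
  have "\<bar>pair_corr \<alpha> N X - X\<bar> \<le> C1 * X powr (7/8) + C2 * (\<kappa>\<^sup>2 / ln (real N))"
    if \<kappa>: "\<kappa> > 1" and dioph: "\<And>(a::int) (q::nat). q \<ge> 1 \<Longrightarrow> \<bar>\<alpha> - real_of_int a / real q\<bar> \<ge> 1 / (\<kappa> * real q powr (9/4))"
      and N: "N \<ge> 1" and X: "1 \<le> X" "X \<le> ln (real N)" for \<alpha> \<kappa> X :: real and N :: nat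
  proof -
    have N0: "real N > 0" using N by simp
    have lnN: "ln (real N) > 0" using X by linarith
    have Xp: "1 \<le> X powr (7/8)" using X by (simp add: ge_one_powr_ge_zero)
    have C2: "0 \<le> C2 * (\<kappa>\<^sup>2 / ln (real N))" unfolding C2_def using C(1) lnN by simp
    show ?thesis
    proof (cases "N \<ge> N1")
      case False
      have "X \<le> real N" using X(2) ln_le_minus_one[OF N0] by linarith
      then have "\<bar>pair_corr \<alpha> N X - X\<bar> \<le> 2 * real N1 * 1"
        using pair_corr_le[OF N, of \<alpha> X] X False by linarith
      also have "\<dots> \<le> C1 * X powr (7/8)" unfolding C1_def using C(1) Xp by (intro mult_mono) auto
      finally show ?thesis using C2 by linarith
    next
      case True
      then have NB: "N \<ge> N\<^sub>0" "real N \<ge> B" unfolding N1_def by linarith+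
      note B' = B[OF NB(2)]
      \<comment> \<open>The hypothesis is applied to the denominator 2k: multiplying |\<alpha> -
        b/(2k)| by 2k gives |2\<alpha> k - b|.\<close>
      have dioph': "\<forall>(k::nat) (b::int). k \<ge> 1 \<longrightarrow> \<bar>2 * \<alpha> * real k - of_int b\<bar> \<ge> (2 * real k) powr (-5/4) / \<kappa>"
      proof (intro allI impI)
        fix k :: nat and b :: int assume k: "k \<ge> 1"
        define x where "x = 2 * real k"
        have x: "x > 0" "real (2 * k) = x" using k by (simp_all add: x_def)
        have "1 / (\<kappa> * x powr (9/4)) \<le> \<bar>\<alpha> - of_int b / x\<bar>" using dioph[of "2 * k" b] k x by simp
        then have "x * (1 / (\<kappa> * x powr (9/4))) \<le> x * \<bar>\<alpha> - of_int b / x\<bar>" using x by (intro mult_left_mono) auto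
        also have "x * \<bar>\<alpha> - of_int b / x\<bar> = \<bar>x * (\<alpha> - of_int b / x)\<bar>" using x by (simp add: abs_mult)
        also have "x * (\<alpha> - of_int b / x) = 2 * \<alpha> * real k - of_int b" using x by (simp add: x_def algebra_simps)
        also have "x * (1 / (\<kappa> * x powr (9/4))) = x powr 1 * x powr (-9/4) / \<kappa>" using x \<kappa> by (simp add: powr_minus field_simps)
        also have "x powr 1 * x powr (-9/4) = x powr (-5/4)" by (subst powr_add[symmetric]) simp
        finally show "(2 * real k) powr (-5/4) / \<kappa> \<le> \<bar>2 * \<alpha> * real k - of_int b\<bar>" unfolding x_def .
      qed
      \<comment> \<open>Minimality serves two ends: level I has no exceptional u, and 2^i \<le> N at
        every level below it.\<close>
      define I where "I = (LEAST I. N < 2 ^ I)"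
      have I: "2 ^ I > N" unfolding I_def by (rule LeastI[of "\<lambda>I. N < 2 ^ I"]) (rule less_exp)
      have Ile: "\<forall>i<I. 2 ^ i \<le> N"
      proof (intro allI impI)
        fix i assume "i < I"
        then have "\<not> N < 2 ^ i" unfolding I_def by (rule not_less_Least)
        then show "2 ^ i \<le> N" by simp
      qed
      let ?S = "\<Sum>i<I. 2 ^ i * real (card (well_approx (2 * \<alpha>) N (sqrt X) i))"
      have S: "?S \<le> C * (real N + sqrt \<kappa> * real N powr (19/20))"
        using C(2) NB(1) X \<kappa> Ile dioph' by simp
      have "\<bar>pair_corr \<alpha> N X * real N - X * (real N - 1)\<bar> \<le> 9 * sqrt X * (real N + ?S)"
        by (rule pair_corr_error_le[OF X(1) N _ I]) (use X B' in linarith)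
      also have "\<dots> \<le> 9 * sqrt X * (real N + C * (real N + sqrt \<kappa> * real N powr (19/20)))"
        using S X by (intro mult_left_mono add_left_mono) auto
      finally have "\<bar>pair_corr \<alpha> N X * real N - X * (real N - 1)\<bar> / real N
         \<le> 9 * sqrt X * (real N + C * (real N + sqrt \<kappa> * real N powr (19/20))) / real N"
        using N0 by (intro divide_right_mono) auto
      also have "\<dots> = 9 * (1 + C) * sqrt X + 9 * C * (sqrt X * sqrt \<kappa> * (real N powr (19/20) / real N))"
        using N0 by (simp add: field_simps)
      also have "real N powr (19/20) / real N = real N powr (-1/20)"
        using N0 powr_diff[of "real N" "19/20" 1] by simp
      also have "\<bar>pair_corr \<alpha> N X * real N - X * (real N - 1)\<bar> / real N
         = \<bar>(pair_corr \<alpha> N X * real N - X * (real N - 1)) / real N\<bar>" by simp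
      also have "(pair_corr \<alpha> N X * real N - X * (real N - 1)) / real N = pair_corr \<alpha> N X - X + X / real N"
        using N0 by (simp add: field_simps)
      finally have E: "\<bar>pair_corr \<alpha> N X - X + X / real N\<bar>
         \<le> 9 * (1 + C) * sqrt X + 9 * C * (sqrt X * sqrt \<kappa> * real N powr (-1/20))" .
      \<comment> \<open>The estimate obtained involves sqrt \<kappa> and sqrt X; here and below they
        are weakened to the stated powers by \<kappa> > 1 and X \<ge> 1.\<close>
      have "sqrt \<kappa> \<le> sqrt ((\<kappa>\<^sup>2)\<^sup>2)"
      proof (intro real_sqrt_le_mono)
        have "\<kappa> ^ 1 \<le> \<kappa> ^ 4" using \<kappa> by (intro power_increasing) auto
        then show "\<kappa> \<le> (\<kappa>\<^sup>2)\<^sup>2" by (simp flip: power_mult)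
      qed
      then have \<kappa>2: "sqrt \<kappa> \<le> \<kappa>\<^sup>2" by (simp only: real_sqrt_abs abs_power2)
      have "sqrt X * real N powr (-1/20) \<le> sqrt (ln (real N)) * real N powr (-1/20)"
        using X by (intro mult_right_mono) auto
      then have "sqrt X * real N powr (-1/20) \<le> 1 / ln (real N)" using B' by linarith
      then have "sqrt \<kappa> * (sqrt X * real N powr (-1/20)) \<le> \<kappa>\<^sup>2 * (1 / ln (real N))"
        using \<kappa>2 X lnN by (intro mult_mono) auto
      then have "9 * C * (sqrt X * sqrt \<kappa> * real N powr (-1/20)) \<le> C2 * (\<kappa>\<^sup>2 / ln (real N))"
        unfolding C2_def using C(1) by (intro mult_left_mono) (auto simp: mult_ac)
      moreover have "sqrt X \<le> X powr (7/8)"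
        using X powr_mono[of "1/2" "7/8" X] by (simp add: powr_half_sqrt)
      then have "9 * (1 + C) * sqrt X \<le> 9 * (1 + C) * X powr (7/8)" using C(1) by (intro mult_left_mono) auto
      moreover have "X / real N \<le> 1 * X powr (7/8)"
      proof -
        have "X \<le> real N" using X(2) ln_le_minus_one[OF N0] by linarith
        then have "X / real N \<le> 1" using N0 by simp
        then show ?thesis using Xp by linarith
      qed
      moreover have "0 \<le> X / real N" using X N0 by simp
      moreover have "0 \<le> 2 * real N1 * X powr (7/8)" using Xp by simp
      ultimately have "\<bar>pair_corr \<alpha> N X - X\<bar> \<le> 1 * X powr (7/8) + 9 * (1 + C) * X powr (7/8)
          + 2 * real N1 * X powr (7/8) + C2 * (\<kappa>\<^sup>2 / ln (real N))"
        using E by linarith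
      then show ?thesis unfolding C1_def by (simp add: algebra_simps)
    qed
  qed
  moreover have "C1 > 0" "C2 > 0" using C(1) by (simp_all add: C1_def C2_def)
  ultimately show ?thesis by blast
qed

end
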